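(* Let $A\in\mathbb{R}^{n\times n}$, $B\in\mathbb{R}^{n\times m}$, let $Q\in\mathbb{R}^{n\times n}$, $R\in\mathbb{R}^{m\times m}$ be symmetric positive semidefinite, let $M_0,M_1\in\mathbb{R}^{k\times n}$ with $\operatorname{rank}(M_0\ \ M_1)=k$, and let $\gamma\in\mathbb{R}^k$. For $T>0$ consider the optimal control problem $(P_T)$: $$\min\ J_T(x,u)=\frac12\int_0^T\big(x(t)^\top Qx(t)+u(t)^\top Ru(t)\big)\,dt$$ over pairs $(x,u)$ with $\dot x(t)=Ax(t)+Bu(t)$ on $[0,T]$ and $M_0x(0)+M_1x(T)=\gamma$. Assume that: (H1) the pair $(A,B)$ is controllable; let then $x=X(D)y$, $u=U(D)y$ be a flat parametrization, let $E(D)=X(-D)^\top Q\,X(D)+U(-D)^\top R\,U(D)$ be the reduced Euler-Lagrange operator, and let $N$ be its total order; (H2) $E(D)$ is hyperbolic, i.e. $\det E(i\omega)\neq0$ for every $\omega\in\mathbb{R}$; (H3) let $\dot Z=\mathbb{A}Z$, $y=\mathbb{L}Z$, $Z(t)\in\mathbb{R}^N$, be a first-order realization of $E(D)y=0$, and let the prescribed endpoint condition together with the natural transversality conditions be written as $\mathbb{C}_0Z(0)+\mathbb{C}_1Z(T)=\eta$ with $\mathbb{C}_0,\mathbb{C}_1\in\mathbb{R}^{N\times N}$, $\eta\in\mathbb{R}^N$; this boundary operator is admissible, i.e. the map $E^s\times E^u\to\mathbb{R}^N$, $(a,b)\mapsto\mathbb{C}_0a+\mathbb{C}_1b$, is an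 isomorphism, where $E^s$ and $E^u$ are the stable and unstable spectral subspaces of $\mathbb{A}$. Then there exist $T_0>0$ and $C,\mu>0$ such that, for every $T\geq T_0$, problem $(P_T)$ has a unique optimal pair $(x^T,u^T)$ and $$|x^T(t)|+|u^T(t)|\leq C\big(e^{-\mu t}+e^{-\mu(T-t)}\big)\qquad\forall t\in[0,T].$$ More generally, an estimate of the same form holds for every derivative of the flat output $y^T$ (corresponding to $(x^T,u^T)$) that enters the expressions of $x$ and $u$.
   Context: Controls $u$ range over $L^2(0,T;\mathbb{R}^m)$, with $x$ the corresponding absolutely continuous solution; pointwise values of the optimal pair refer to its smooth representative. $D=\frac{d}{dt}$. Flat parametrization: polynomial matrices $X(D)\in\mathbb{R}[D]^{n\times m}$, $U(D)\in\mathbb{R}[D]^{m\times m}$ such that $y\mapsto(x,u)=(X(D)y,U(D)y)$ is a bijection from smooth functions $y:[0,T]\to\mathbb{R}^m$ (the flat output) onto the smooth trajectories of $\dot x=Ax+Bu$, whose inverse is also a polynomial differential operator in $(x,u)$. It is a known fact that such a parametrization exists when $(A,B)$ is controllable (e.g. from the Brunovsky form). Reduced problem: in flat coordinates the cost is $J_T(y)=\frac12\int_0^T\big((X(D)y)^\top Q(X(D)y)+(U(D)y)^\top R(U(D)y)\big)dt$ and the prescribed endpoint condition is $M_0(X(D)y)(0)+M_1(X(D)y)(T)=\gamma$. Its Euler-Lagrange equation is $E(D)y=0$. An admissible variation is a smooth $\delta y$ with $M_0(X(D)\delta y)(0)+M_1(X(D)\delta y)(T)=0$. After integrating by parts, the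 first variation of $J_T$ at $y$ in direction $\delta y$ equals $\int_0^T\langle E(D)y,\delta y\rangle dt$ plus a boundary term depending bilinearly on finite jets of $y$ and of $\delta y$ at $0$ and $T$. The natural transversality conditions on $y$ require this boundary term to vanish for every admissible variation $\delta y$. Total order: $N=\sum_j\deg d_j$, where $d_1,\dots,d_m$ are the invariant factors of the Smith normal form of $E(D)$ over $\mathbb{R}[D]$; equivalently $N=\deg\det E$, the dimension of the solution space of $E(D)y=0$ (under (H2), $\det E\not\equiv0$). First-order realization: matrices $\mathbb{A}\in\mathbb{R}^{N\times N}$, $\mathbb{L}\in\mathbb{R}^{m\times N}$ such that $Z\mapsto\mathbb{L}Z$ is a bijection from the solutions of $\dot Z=\mathbb{A}Z$ onto the solutions of $E(D)y=0$, and the eigenvalues of $\mathbb{A}$, counted with algebraic multiplicity, are exactly the roots of $\det E(\lambda)$. Such a realization exists; under (H2), $\mathbb{A}$ has no eigenvalue on the imaginary axis. $E^s$ (resp. $E^u$) is the spectral subspace of $\mathbb{A}$ for eigenvalues with negative (resp. positive) real part. Form of the boundary condition: $\mathbb{C}_0,\mathbb{C}_1,\eta$ do not depend on $T$, and are such that, for every $T>0$ and every solution $Z$ of $\dot Z=\mathbb{A}Z$ on $[0,T]$, the function $y=\mathbb{L}Z$ satisfies the prescribed endpoint condition and the natural transversality conditions if and only if $\mathbb{C}_0Z(0)+\mathbb{C}_1Z(T)=\eta$. *)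

theory Defs
  imports "HOL-Analysis.Analysis" "Jordan_Normal_Form.DL_Rank" "Jordan_Normal_Form.Char_Poly"
    "Jordan_Normal_Form.Matrix_Kernel"
begin

no_notation vec_nth (infixl \<open>$\<close> 90)
no_notation inner (infix \<open>\<bullet>\<close> 70)

type_synonym curve = "real \<Rightarrow> real Matrix.vec"
type_synonym rmat = "real Matrix.mat"
type_synonym pmat = "real poly Matrix.mat"

definition enorm :: "real Matrix.vec \<Rightarrow> real" where
  "enorm v = sqrt (v \<bullet> v)"

definition sym_psd :: "nat \<Rightarrow> rmat \<Rightarrow> bool" where
  "sym_psd n Q \<longleftrightarrow> Q \<in> carrier_mat n n \<and> transpose_mat Q = Q
     \<and> (\<forall>v \<in> carrier_vec n. 0 \<le> v \<bullet> (Q *\<^sub>v v))"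

definition L2_control :: "nat \<Rightarrow> real \<Rightarrow> curve \<Rightarrow> bool" where
  "L2_control m T u \<longleftrightarrow> (\<forall>t\<in>{0..T}. u t \<in> carrier_vec m)
     \<and> (\<forall>i<m. set_borel_measurable lebesgue {0..T} (\<lambda>t. u t $ i)
            \<and> set_integrable lebesgue {0..T} (\<lambda>t. (u t $ i)\<^sup>2))"

text \<open>
  Absolutely continuous (Caratheodory) solutions of \<open>x' = A x + B u\<close>: \<open>x\<close> is the
  indefinite Lebesgue integral of \<open>A x + B u\<close>. Integrability is required explicitly because the
  Bochner integral of a non-integrable function is \<open>0\<close>.
\<close>
definition ac_solution :: "rmat \<Rightarrow> rmat \<Rightarrow> real \<Rightarrow> curve \<Rightarrow> curve \<Rightarrow> bool" where
  "ac_solution A B T x u \<longleftrightarrow> (\<forall>t\<in>{0..T}. x t \<in> carrier_vec (dim_row A))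
     \<and> (\<forall>i<dim_row A.
          set_integrable lebesgue {0..T} (\<lambda>s. (A *\<^sub>v x s + B *\<^sub>v u s) $ i)
        \<and> (\<forall>t\<in>{0..T}. x t $ i
             = x 0 $ i + (LINT s:{0..t}|lebesgue. (A *\<^sub>v x s + B *\<^sub>v u s) $ i)))"

definition L2_trajectory :: "rmat \<Rightarrow> rmat \<Rightarrow> real \<Rightarrow> curve \<Rightarrow> curve \<Rightarrow> bool" where
  "L2_trajectory A B T x u \<longleftrightarrow> L2_control (dim_col B) T u \<and> ac_solution A B T x u"

definition controllable :: "rmat \<Rightarrow> rmat \<Rightarrow> bool" where
  "controllable A B \<longleftrightarrow>
     (\<forall>T>0. \<forall>a \<in> carrier_vec (dim_row A). \<forall>b \<in> carrier_vec (dim_row A).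
        \<exists>x u. L2_trajectory A B T x u \<and> x 0 = a \<and> x T = b)"

definition endpoint_value :: "rmat \<Rightarrow> rmat \<Rightarrow> real \<Rightarrow> curve \<Rightarrow> real Matrix.vec" where
  "endpoint_value M0 M1 T x = M0 *\<^sub>v x 0 + M1 *\<^sub>v x T"

definition cost :: "rmat \<Rightarrow> rmat \<Rightarrow> real \<Rightarrow> curve \<Rightarrow> curve \<Rightarrow> real" where
  "cost Q R T x u =
     1/2 * (LINT t:{0..T}|lebesgue. x t \<bullet> (Q *\<^sub>v x t) + u t \<bullet> (R *\<^sub>v u t))"

definition feasible_pair ::
  "rmat \<Rightarrow> rmat \<Rightarrow> rmat \<Rightarrow> rmat \<Rightarrow> real Matrix.vec \<Rightarrow> real \<Rightarrow> curve \<Rightarrow> curve \<Rightarrow> bool" where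
  "feasible_pair A B M0 M1 \<gamma> T x u \<longleftrightarrow>
     L2_trajectory A B T x u \<and> endpoint_value M0 M1 T x = \<gamma>"

definition optimal_pair ::
  "rmat \<Rightarrow> rmat \<Rightarrow> rmat \<Rightarrow> rmat \<Rightarrow> rmat \<Rightarrow> rmat \<Rightarrow> real Matrix.vec \<Rightarrow> real
     \<Rightarrow> curve \<Rightarrow> curve \<Rightarrow> bool" where
  "optimal_pair A B Q R M0 M1 \<gamma> T x u \<longleftrightarrow> feasible_pair A B M0 M1 \<gamma> T x u
     \<and> (\<forall>x' u'. feasible_pair A B M0 M1 \<gamma> T x' u' \<longrightarrow> cost Q R T x u \<le> cost Q R T x' u')"

text \<open>Derivatives are taken within \<open>S\<close>, hence are one-sided at the ends of \<open>S = {0..T}\<close>.\<close>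
primrec nderiv :: "real set \<Rightarrow> nat \<Rightarrow> (real \<Rightarrow> real) \<Rightarrow> real \<Rightarrow> real" where
  "nderiv S 0 f = f"
| "nderiv S (Suc p) f = (\<lambda>t. vector_derivative (nderiv S p f) (at t within S))"

text \<open>
  Curves on \<open>{0..T}\<close> are elements of \<open>PiE\<close> (\<open>undefined\<close> outside \<open>{0..T}\<close>), so that equality
  of curves is equality on \<open>{0..T}\<close> and bijections between spaces of curves make sense.
\<close>
definition smooth_curves :: "real \<Rightarrow> nat \<Rightarrow> curve set" where
  "smooth_curves T d = {y \<in> {0..T} \<rightarrow>\<^sub>E carrier_vec d.
     \<forall>i<d. \<forall>p. nderiv {0..T} p (\<lambda>t. y t $ i) differentiable_on {0..T}}"

definition curve_deriv :: "real \<Rightarrow> nat \<Rightarrow> nat \<Rightarrow> curve \<Rightarrow> curve" where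
  "curve_deriv T d p y = (\<lambda>t\<in>{0..T}. Matrix.vec d (\<lambda>j. nderiv {0..T} p (\<lambda>s. y s $ j) t))"

definition diffop :: "real \<Rightarrow> pmat \<Rightarrow> curve \<Rightarrow> curve" where
  "diffop T P y = (\<lambda>t\<in>{0..T}. Matrix.vec (dim_row P) (\<lambda>i. \<Sum>j<dim_col P.
     \<Sum>p\<le>degree (P $$ (i,j)). coeff (P $$ (i,j)) p * nderiv {0..T} p (\<lambda>s. y s $ j) t))"

definition smooth_trajectories :: "rmat \<Rightarrow> rmat \<Rightarrow> real \<Rightarrow> (curve \<times> curve) set" where
  "smooth_trajectories A B T =
     {(x, u). x \<in> smooth_curves T (dim_row A) \<and> u \<in> smooth_curves T (dim_col B)
        \<and> (\<forall>t\<in>{0..T}. \<forall>i<dim_row A. ((\<lambda>s. x s $ i) has_real_derivative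
              (A *\<^sub>v x t + B *\<^sub>v u t) $ i) (at t within {0..T}))}"

definition flat_parametrization :: "rmat \<Rightarrow> rmat \<Rightarrow> pmat \<Rightarrow> pmat \<Rightarrow> bool" where
  "flat_parametrization A B X U \<longleftrightarrow>
     (let n = dim_row A; m = dim_col B in
        X \<in> carrier_mat n m \<and> U \<in> carrier_mat m m
      \<and> (\<forall>T>0. bij_betw (\<lambda>y. (diffop T X y, diffop T U y))
                  (smooth_curves T m) (smooth_trajectories A B T))
      \<and> (\<exists>F \<in> carrier_mat m n. \<exists>G \<in> carrier_mat m m.
           \<forall>T>0. \<forall>y \<in> smooth_curves T m. \<forall>t\<in>{0..T}.
             y t = diffop T F (diffop T X y) t + diffop T G (diffop T U y) t))"

definition const_pmat :: "rmat \<Rightarrow> pmat" where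
  "const_pmat M = map_mat (\<lambda>c. [:c:]) M"

definition adjoint_pmat :: "pmat \<Rightarrow> pmat" where
  "adjoint_pmat P = transpose_mat (map_mat (\<lambda>p. pcompose p [:0, -1:]) P)"

definition euler_lagrange :: "rmat \<Rightarrow> rmat \<Rightarrow> pmat \<Rightarrow> pmat \<Rightarrow> pmat" where
  "euler_lagrange Q R X U =
     adjoint_pmat X * const_pmat Q * X + adjoint_pmat U * const_pmat R * U"

definition hyperbolic :: "pmat \<Rightarrow> bool" where
  "hyperbolic E \<longleftrightarrow> (\<forall>\<omega>::real.
     Determinant.det (map_mat (\<lambda>p. poly (map_poly complex_of_real p) (\<i> * complex_of_real \<omega>)) E) \<noteq> 0)"

text \<open>
  The sum of the degrees of the invariant factors in a Smith normal form. It is stated as a relation;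
  invariant factors are unique up to nonzero constants, so at most one \<open>N\<close> satisfies it.
\<close>
definition has_total_order :: "pmat \<Rightarrow> nat \<Rightarrow> bool" where
  "has_total_order E N \<longleftrightarrow>
     (\<exists>V W d. V \<in> carrier_mat (dim_row E) (dim_row E) \<and> invertible_mat V
        \<and> W \<in> carrier_mat (dim_row E) (dim_row E) \<and> invertible_mat W
        \<and> V * E * W = mat_diag (dim_row E) d
        \<and> (\<forall>j. Suc j < dim_row E \<longrightarrow> d j dvd d (Suc j))
        \<and> N = (\<Sum>j<dim_row E. degree (d j)))"

text \<open>
  The endpoint contribution of \<open>\<integral> (P(D) \<delta>) \<bullet> w\<close> on \<open>{0..T}\<close>, obtained from
  \<open>\<integral> f D\<^sup>p g = (\<Sum>k<p. (-1)^k [D\<^sup>k f D\<^sup>p\<^sup>-\<^sup>1\<^sup>-\<^sup>k g]) + (-1)^p \<integral> (D\<^sup>p f) g\<close>; here \<open>[h]\<close> is \<open>h T - h 0\<close>.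
\<close>
definition ibp_boundary :: "real \<Rightarrow> pmat \<Rightarrow> curve \<Rightarrow> curve \<Rightarrow> real" where
  "ibp_boundary T P w \<delta> =
     (\<Sum>i<dim_row P. \<Sum>j<dim_col P. \<Sum>p\<le>degree (P $$ (i,j)). coeff (P $$ (i,j)) p *
        (\<Sum>k<p. (-1)^k *
          (let h = (\<lambda>t. nderiv {0..T} k (\<lambda>s. w s $ i) t
                       * nderiv {0..T} (p - 1 - k) (\<lambda>s. \<delta> s $ j) t)
           in h T - h 0)))"

text \<open>
  The first variation of the cost at \<open>y\<close> in direction \<open>\<delta>\<close> is the integral of
  \<open>(X(D) \<delta>) \<bullet> (Q X(D) y) + (U(D) \<delta>) \<bullet> (R U(D) y)\<close>, whence this boundary term.
\<close>
definition boundary_term ::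
  "rmat \<Rightarrow> rmat \<Rightarrow> pmat \<Rightarrow> pmat \<Rightarrow> real \<Rightarrow> curve \<Rightarrow> curve \<Rightarrow> real" where
  "boundary_term Q R X U T y \<delta> =
     ibp_boundary T X (\<lambda>t. Q *\<^sub>v diffop T X y t) \<delta>
   + ibp_boundary T U (\<lambda>t. R *\<^sub>v diffop T U y t) \<delta>"

definition admissible_variations :: "rmat \<Rightarrow> rmat \<Rightarrow> pmat \<Rightarrow> real \<Rightarrow> curve set" where
  "admissible_variations M0 M1 X T =
     {\<delta> \<in> smooth_curves T (dim_col X). endpoint_value M0 M1 T (diffop T X \<delta>) = 0\<^sub>v (dim_row M0)}"

definition natural_transversality ::
  "rmat \<Rightarrow> rmat \<Rightarrow> rmat \<Rightarrow> rmat \<Rightarrow> pmat \<Rightarrow> pmat \<Rightarrow> real \<Rightarrow> curve \<Rightarrow> bool" where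
  "natural_transversality Q R M0 M1 X U T y \<longleftrightarrow>
     (\<forall>\<delta> \<in> admissible_variations M0 M1 X T. boundary_term Q R X U T y \<delta> = 0)"

definition linear_ode_solutions :: "rmat \<Rightarrow> real \<Rightarrow> curve set" where
  "linear_ode_solutions \<A> T = {Z \<in> {0..T} \<rightarrow>\<^sub>E carrier_vec (dim_row \<A>).
     \<forall>t\<in>{0..T}. \<forall>i<dim_row \<A>.
       ((\<lambda>s. Z s $ i) has_real_derivative (\<A> *\<^sub>v Z t) $ i) (at t within {0..T})}"

definition kernel_solutions :: "pmat \<Rightarrow> real \<Rightarrow> curve set" where
  "kernel_solutions E T = {y \<in> smooth_curves T (dim_col E).
     \<forall>t\<in>{0..T}. diffop T E y t = 0\<^sub>v (dim_row E)}"

definition output_curve :: "real \<Rightarrow> rmat \<Rightarrow> curve \<Rightarrow> curve" where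
  "output_curve T L Z = (\<lambda>t\<in>{0..T}. L *\<^sub>v Z t)"

definition first_order_realization :: "pmat \<Rightarrow> nat \<Rightarrow> rmat \<Rightarrow> rmat \<Rightarrow> bool" where
  "first_order_realization E N \<A> L \<longleftrightarrow>
     \<A> \<in> carrier_mat N N \<and> L \<in> carrier_mat (dim_row E) N
   \<and> (\<forall>T>0. bij_betw (output_curve T L) (linear_ode_solutions \<A> T) (kernel_solutions E T))
   \<and> (\<forall>z::complex. Polynomial.order z (char_poly (map_mat complex_of_real \<A>))
                  = Polynomial.order z (map_poly complex_of_real (Determinant.det E)))"

text \<open>
  The real vectors in the sum of the complex generalized eigenspaces belonging to the eigenvalues
  that lie in \<open>\<Omega>\<close>.
\<close>
definition spectral_subspace :: "rmat \<Rightarrow> complex set \<Rightarrow> real Matrix.vec set" where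
  "spectral_subspace \<A> \<Omega> =
     (let N = dim_row \<A>; \<A>\<^sub>C = map_mat complex_of_real \<A> in
      {v \<in> carrier_vec N. map_vec complex_of_real v \<in>
         LinearCombinations.module.span class_ring (module_vec TYPE(complex) N)
           (\<Union>z \<in> {z \<in> \<Omega>. eigenvalue \<A>\<^sub>C z}. mat_kernel (char_matrix \<A>\<^sub>C z ^\<^sub>m N))})"

definition stable_subspace :: "rmat \<Rightarrow> real Matrix.vec set" where
  "stable_subspace \<A> = spectral_subspace \<A> {z. Re z < 0}"

definition unstable_subspace :: "rmat \<Rightarrow> real Matrix.vec set" where
  "unstable_subspace \<A> = spectral_subspace \<A> {z. Re z > 0}"

definition boundary_form ::
  "rmat \<Rightarrow> rmat \<Rightarrow> rmat \<Rightarrow> rmat \<Rightarrow> real Matrix.vec \<Rightarrow> pmat \<Rightarrow> pmat \<Rightarrow> rmat \<Rightarrow> rmat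
     \<Rightarrow> rmat \<Rightarrow> rmat \<Rightarrow> real Matrix.vec \<Rightarrow> bool" where
  "boundary_form Q R M0 M1 \<gamma> X U \<A> L C0 C1 \<eta> \<longleftrightarrow>
     (\<forall>T>0. \<forall>Z \<in> linear_ode_solutions \<A> T.
        (endpoint_value M0 M1 T (diffop T X (output_curve T L Z)) = \<gamma>
         \<and> natural_transversality Q R M0 M1 X U T (output_curve T L Z))
        \<longleftrightarrow> C0 *\<^sub>v Z 0 + C1 *\<^sub>v Z T = \<eta>)"

text \<open>The map is linear, so it is an isomorphism if and only if it is bijective.\<close>
definition admissible_boundary_operator :: "rmat \<Rightarrow> rmat \<Rightarrow> rmat \<Rightarrow> bool" where
  "admissible_boundary_operator \<A> C0 C1 \<longleftrightarrow>
     bij_betw (\<lambda>(a, b). C0 *\<^sub>v a + C1 *\<^sub>v b)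
       (stable_subspace \<A> \<times> unstable_subspace \<A>) (carrier_vec (dim_row \<A>))"

definition enters :: "pmat \<Rightarrow> nat \<Rightarrow> bool" where
  "enters P p \<longleftrightarrow> (\<exists>i<dim_row P. \<exists>j<dim_col P. coeff (P $$ (i,j)) p \<noteq> 0)"

definition turnpike_weight :: "real \<Rightarrow> real \<Rightarrow> real \<Rightarrow> real" where
  "turnpike_weight \<mu> T t = exp (- \<mu> * t) + exp (- \<mu> * (T - t))"

end

theory Submission
  imports Defs
begin

text \<open>
  The boundary value problem for \<open>Z\<close> is, up to an error exponentially small in \<open>T\<close>, the isomorphism
  \<open>(a, b) \<mapsto> C0 a + C1 b\<close> applied to a solution decaying from \<open>a \<in> E\<^sup>s\<close> at \<open>0\<close> plus one decaying backwards
  from \<open>b \<in> E\<^sup>u\<close> at \<open>T\<close>; so for large \<open>T\<close> it is uniquely solvable, and the solution is small away from the ends.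

  The resulting smooth extremal is stationary against smooth admissible variations, by integration by
  parts and transversality. Through the costate, the first variation and the endpoint constraints
  are functionals of \<open>(x(0), u)\<close> with smooth kernels, so stationarity extends to all \<open>L\<^sup>2\<close> variations, and
  convexity gives optimality.

  Two optimal pairs differ by an \<open>L\<^sup>2\<close> trajectory of zero cost. Since \<open>det E(0) \<noteq> 0\<close>, there is no nonzero
  zero-cost equilibrium, which forces zero-cost trajectories to solve a linear equation \<open>x' = K x\<close>. They are
  therefore smooth, come from solutions of the homogeneous boundary value problem, and vanish.
\<close>

section \<open>Iterated derivatives and scalar differential operators\<close>

text \<open>\<open>R\<close> is only positive semidefinite, so the cost need not be coercive or
  strictly convex in u, and u need not be determined pointwise by a costate. Existence is therefore
  read off from one explicit extremal, and uniqueness needs its own argument. Flatness describes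
  smooth trajectories only, while competitors are merely L^2: the gap is bridged by duality for
  variations and by regularity for zero-cost differences.

  An equilibrium of zero cost has a constant flat output c, because the inverse of the
  parametrization is again a polynomial operator; then E(D)c = E(0)c = 0. Once such equilibria are
  excluded, x is a linear function H of x' along a zero-cost trajectory. Here x' is known only as an
  integrable function and H may be singular, so the relation is used in integrated form and the
  range of H is shrunk one power at a time.

  For the boundary value problem no dimensions of E^s and E^u are counted: preimages of the N unit
  vectors under (H3) give N solutions, whose independence follows from injectivity of the perturbed
  boundary map.\<close>

definition smooth_fun :: "real \<Rightarrow> (real \<Rightarrow> real) \<Rightarrow> bool" where
  "smooth_fun T f \<longleftrightarrow> (\<forall>p. nderiv {0..T} p f differentiable_on {0..T})"

lemma nderiv_nderiv: "nderiv S p (nderiv S q f) = nderiv S (p + q) f"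
  by (induction p) auto

lemma has_vector_derivative_agree:
  assumes "(f has_real_derivative d) (at t within S)" "t \<in> S" "\<And>x. x \<in> S \<Longrightarrow> g x = f x"
  shows "(g has_vector_derivative d) (at t within S)"
  using has_vector_derivative_transform[OF assms(2,3)] assms(1)
  by (simp add: has_real_derivative_iff_has_vector_derivative)

text \<open>Neither function has to be differentiable: within S both have the same candidates for a
  derivative at every stage, and \<open>vector_derivative\<close> chooses from these candidates
  alone.\<close>

lemma nderiv_cong:
  assumes "\<forall>t\<in>S. f t = g t" "t \<in> S"
  shows "nderiv S p f t = nderiv S p g t"
  using assms(2)
proof (induction p arbitrary: t)
  case 0
  then show ?case using assms by simp
next
  case (Suc p)
  have "(nderiv S p f has_vector_derivative d) (at t within S) \<longleftrightarrow>
    (nderiv S p g has_vector_derivative d) (at t within S)" for d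
    using has_vector_derivative_transform[OF Suc.prems, of "nderiv S p f" "nderiv S p g" d]
      has_vector_derivative_transform[OF Suc.prems, of "nderiv S p g" "nderiv S p f" d] Suc.IH by fastforce
  then show ?case by (simp add: vector_derivative_def)
qed

lemma smooth_fun_nderiv: "smooth_fun T f \<Longrightarrow> smooth_fun T (nderiv {0..T} q f)"
  by (simp add: smooth_fun_def nderiv_nderiv)

lemma smooth_fun_has_derivative:
  assumes "smooth_fun T f" "t \<in> {0..T}"
  shows "(nderiv {0..T} p f has_real_derivative nderiv {0..T} (Suc p) f t) (at t within {0..T})"
  using assms unfolding smooth_fun_def
  by (simp add: differentiable_on_def vector_derivative_works
      has_real_derivative_iff_has_vector_derivative)

text \<open>An iterated derivative is identified by exhibiting the whole tower of its successors.
  \<open>0 < T\<close> makes the derivative within the interval unique, also at the two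
  ends.\<close>

lemma nderiv_eqI:
  assumes "0 < T"
    and "\<And>p t. t \<in> {0..T} \<Longrightarrow> (F p has_real_derivative F (Suc p) t) (at t within {0..T})"
    and "t \<in> {0..T}"
  shows "nderiv {0..T} p (F 0) t = F p t"
  using assms(3)
proof (induction p arbitrary: t)
  case (Suc p)
  have "(nderiv {0..T} p (F 0) has_vector_derivative F (Suc p) t) (at t within {0..T})"
    by (rule has_vector_derivative_agree[OF assms(2)[OF Suc.prems, of p] Suc.prems Suc.IH])
  then show ?case
    using vector_derivative_within_cbox[of 0 T t "nderiv {0..T} p (F 0)" "F (Suc p) t"] assms(1) Suc.prems
    by simp
qed simp

lemma smooth_funI:
  assumes "0 < T"
    and "\<And>p t. t \<in> {0..T} \<Longrightarrow> (F p has_real_derivative F (Suc p) t) (at t within {0..T})"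
  shows "smooth_fun T (F 0)"
  unfolding smooth_fun_def differentiable_on_def
proof (intro allI ballI)
  fix p t assume t: "t \<in> {0..T}"
  have "(nderiv {0..T} p (F 0) has_vector_derivative F (Suc p) t) (at t within {0..T})"
    by (rule has_vector_derivative_agree[OF assms(2)[OF t, of p] t])
      (rule nderiv_eqI[of T F], use assms in auto)
  then show "nderiv {0..T} p (F 0) differentiable at t within {0..T}"
    by (rule differentiableI_vector)
qed

lemma smooth_fun_cong:
  assumes "\<forall>t\<in>{0..T}. f t = g t" "smooth_fun T f"
  shows "smooth_fun T g"
  unfolding smooth_fun_def differentiable_on_def
proof (intro allI ballI)
  fix p t assume t: "t \<in> {0..T}"
  have "(nderiv {0..T} p g has_vector_derivative nderiv {0..T} (Suc p) f t) (at t within {0..T})"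
    by (rule has_vector_derivative_agree[OF smooth_fun_has_derivative[OF assms(2) t, of p] t])
      (rule nderiv_cong, use assms in auto)
  then show "nderiv {0..T} p g differentiable at t within {0..T}"
    by (rule differentiableI_vector)
qed

lemma smooth_fun_continuous:
  "smooth_fun T f \<Longrightarrow> continuous_on {0..T} (nderiv {0..T} p f)"
  by (simp add: smooth_fun_def differentiable_imp_continuous_on)

lemma smooth_fun_const: "0 < T \<Longrightarrow> smooth_fun T (\<lambda>t. c)"
  and nderiv_const: "0 < T \<Longrightarrow> t \<in> {0..T} \<Longrightarrow> nderiv {0..T} p (\<lambda>t. c) t = (if p = 0 then c else 0)"
proof -
  let ?F = "\<lambda>p t. if p = (0::nat) then c else 0"
  have *: "(?F p has_real_derivative ?F (Suc p) t) (at t within {0..T})" for p t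
    by (cases p) auto
  show "smooth_fun T (\<lambda>t. c)" if "0 < T" using smooth_funI[OF that, of ?F] * by simp
  show "nderiv {0..T} p (\<lambda>t. c) t = ?F p t" if "0 < T" "t \<in> {0..T}"
    using nderiv_eqI[OF that(1), of ?F t p] * that(2) by simp
qed

lemma smooth_fun_lincomb:
  assumes "0 < T" "\<And>i. i \<in> I \<Longrightarrow> smooth_fun T (f i)"
  shows "smooth_fun T (\<lambda>t. \<Sum>i\<in>I. c i * f i t)"
    and "t \<in> {0..T} \<Longrightarrow>
      nderiv {0..T} p (\<lambda>t. \<Sum>i\<in>I. c i * f i t) t = (\<Sum>i\<in>I. c i * nderiv {0..T} p (f i) t)"
proof -
  let ?F = "\<lambda>p t. \<Sum>i\<in>I. c i * nderiv {0..T} p (f i) t"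
  have *: "(?F p has_real_derivative ?F (Suc p) t) (at t within {0..T})" if "t \<in> {0..T}" for p t
    by (intro DERIV_sum DERIV_cmult smooth_fun_has_derivative assms that)
  show "smooth_fun T (\<lambda>t. \<Sum>i\<in>I. c i * f i t)"
    using smooth_funI[of T ?F, OF assms(1) *] by simp
  show "t \<in> {0..T} \<Longrightarrow>
      nderiv {0..T} p (\<lambda>t. \<Sum>i\<in>I. c i * f i t) t = (\<Sum>i\<in>I. c i * nderiv {0..T} p (f i) t)"
    using nderiv_eqI[of T ?F t p] assms(1) * by simp
qed

lemma smooth_fun_add:
  assumes "0 < T" "smooth_fun T f" "smooth_fun T g"
  shows "smooth_fun T (\<lambda>t. f t + g t)"
    and "t \<in> {0..T} \<Longrightarrow> nderiv {0..T} p (\<lambda>t. f t + g t) t = nderiv {0..T} p f t + nderiv {0..T} p g t"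
  using smooth_fun_lincomb(1)[of T "{0::nat,1}" "\<lambda>i. if i = 0 then f else g" "\<lambda>_. 1"]
    smooth_fun_lincomb(2)[of T "{0::nat,1}" "\<lambda>i. if i = 0 then f else g" t p "\<lambda>_. 1"] assms by auto

lemma smooth_fun_cmult:
  assumes "0 < T" "smooth_fun T f"
  shows "smooth_fun T (\<lambda>t. c * f t)"
    and "t \<in> {0..T} \<Longrightarrow> nderiv {0..T} p (\<lambda>t. c * f t) t = c * nderiv {0..T} p f t"
  using smooth_fun_lincomb(1)[of T "{0::nat}" "\<lambda>i. f" "\<lambda>_. c"]
    smooth_fun_lincomb(2)[of T "{0::nat}" "\<lambda>i. f" t p "\<lambda>_. c"] assms by auto

section \<open>Scalar operators P(D) and their formal adjoints\<close>

definition pdiff :: "real \<Rightarrow> real poly \<Rightarrow> (real \<Rightarrow> real) \<Rightarrow> real \<Rightarrow> real" where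
  "pdiff T P f t = (\<Sum>p\<le>degree P. coeff P p * nderiv {0..T} p f t)"

lemma pdiff_altdef:
  assumes "degree P \<le> d"
  shows "pdiff T P f t = (\<Sum>p\<le>d. coeff P p * nderiv {0..T} p f t)"
  unfolding pdiff_def by (rule sum.mono_neutral_left) (use assms in \<open>auto simp: coeff_eq_0\<close>)

lemma pdiff_cong:
  "\<forall>t\<in>{0..T}. f t = g t \<Longrightarrow> t \<in> {0..T} \<Longrightarrow> pdiff T P f t = pdiff T P g t"
  unfolding pdiff_def by (intro sum.cong refl arg_cong2[of _ _ _ _ "(*)"] nderiv_cong)

lemma pdiff_0 [simp]: "pdiff T 0 f t = 0"
  by (simp add: pdiff_def)

lemma pdiff_add: "pdiff T (P + Q) f t = pdiff T P f t + pdiff T Q f t"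
proof -
  have "degree (P + Q) \<le> max (degree P) (degree Q)" by (rule degree_add_le_max)
  then show ?thesis
    by (simp add: pdiff_altdef[of _ "max (degree P) (degree Q)"] distrib_right sum.distrib)
qed

lemma pdiff_sum: "pdiff T (\<Sum>i\<in>I. P i) f t = (\<Sum>i\<in>I. pdiff T (P i) f t)"
  by (induction I rule: infinite_finite_induct) (auto simp: pdiff_add)

lemma pdiff_smult: "pdiff T (Polynomial.smult c P) f t = c * pdiff T P f t"
  by (simp add: pdiff_altdef[of _ "degree P"] degree_smult_le sum_distrib_left mult.assoc)

text \<open>Horner form a + P(D) D, with the single D applied to f first. This is what lets
  \<open>pdiff_mult\<close> go by induction on the polynomial.\<close>

lemma pdiff_pCons: "pdiff T (pCons a P) f t = a * f t + pdiff T P (nderiv {0..T} 1 f) t"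
proof -
  have "pdiff T (pCons a P) f t = (\<Sum>p\<le>Suc (degree P). coeff (pCons a P) p * nderiv {0..T} p f t)"
    by (rule pdiff_altdef) (rule degree_pCons_le)
  also have "\<dots> = a * f t + (\<Sum>p\<le>degree P. coeff P p * nderiv {0..T} (Suc p) f t)"
    by (simp add: sum.atMost_Suc_shift del: nderiv.simps(2) sum.atMost_Suc)
  finally show ?thesis by (simp only: pdiff_def nderiv_nderiv) simp
qed

text \<open>Every positive power of D kills a constant, so only the value of the symbol at 0
  survives; this links equilibria to E(0).\<close>

lemma pdiff_const:
  assumes "0 < T" "t \<in> {0..T}" shows "pdiff T P (\<lambda>t. c) t = poly P 0 * c"
  using assms by (auto simp: pdiff_def nderiv_const if_distrib poly_0_coeff_0 cong: if_cong)

lemma smooth_fun_pdiff: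
  assumes "0 < T" "smooth_fun T f"
  shows "smooth_fun T (pdiff T P f)"
    and "t \<in> {0..T} \<Longrightarrow> nderiv {0..T} p (pdiff T P f) t = pdiff T P (nderiv {0..T} p f) t"
proof -
  note * = smooth_fun_lincomb[OF assms(1), of "{..degree P}" "\<lambda>p. nderiv {0..T} p f"]
  show "smooth_fun T (pdiff T P f)"
    unfolding pdiff_def using *(1)[OF smooth_fun_nderiv[OF assms(2)]] by simp
  show "t \<in> {0..T} \<Longrightarrow> nderiv {0..T} p (pdiff T P f) t = pdiff T P (nderiv {0..T} p f) t"
    unfolding pdiff_def using *(2)[OF smooth_fun_nderiv[OF assms(2)]]
    by (simp add: nderiv_nderiv add.commute)
qed

lemma pdiff_lincomb:
  assumes "0 < T" "\<And>i. i \<in> I \<Longrightarrow> smooth_fun T (f i)" "t \<in> {0..T}"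
  shows "pdiff T P (\<lambda>t. \<Sum>i\<in>I. c i * f i t) t = (\<Sum>i\<in>I. c i * pdiff T P (f i) t)"
  unfolding pdiff_def using smooth_fun_lincomb(2)[OF assms(1,2,3), of I] assms(2)
  by (simp add: sum_distrib_left mult.left_commute[of _ "c _"] sum.swap[of _ I])

text \<open>Constant coefficients make Q(D) commute with D on smooth functions; the induction step
  uses this to move one derivative past Q(D).\<close>

lemma pdiff_mult:
  assumes "0 < T" "smooth_fun T f" "t \<in> {0..T}"
  shows "pdiff T (P * Q) f t = pdiff T P (pdiff T Q f) t"
  using assms(2,3)
proof (induction P arbitrary: f t)
  case (pCons a P)
  have "pdiff T (pCons a P * Q) f t = a * pdiff T Q f t + pdiff T (P * Q) (nderiv {0..T} 1 f) t"
    by (simp add: mult_pCons_left pdiff_add pdiff_smult pdiff_pCons del: nderiv.simps)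
  also have "pdiff T (P * Q) (nderiv {0..T} 1 f) t = pdiff T P (pdiff T Q (nderiv {0..T} 1 f)) t"
    using pCons by (simp add: smooth_fun_nderiv del: nderiv.simps)
  also have "\<dots> = pdiff T P (nderiv {0..T} 1 (pdiff T Q f)) t"
    using smooth_fun_pdiff(2)[OF assms(1) pCons.prems(1), where p=1] pCons.prems
    by (intro pdiff_cong) auto
  finally show ?case by (simp only: pdiff_pCons)
qed simp

text \<open>\<open>[:0, -1:]\<close> is the polynomial -D, so the composition is P(-D), the formal
  adjoint of P(D) in the scalar case.\<close>

lemma coeff_pcompose_neg: "coeff (pcompose P [:0, -1:]) p = (-1) ^ p * coeff (P :: real poly) p"
proof (induction P arbitrary: p)
  case (pCons a P)
  then show ?case by (cases p) (auto simp: pcompose_pCons coeff_pCons split: nat.splits)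
qed simp

lemma degree_pcompose_neg: "degree (pcompose P [:0, -1:]) = degree (P :: real poly)"
  by simp

text \<open>The boundary form left behind when \<open>D\<^sup>p\<close> is moved from \<open>f\<close> onto \<open>w\<close>.\<close>
definition concomitant :: "real \<Rightarrow> nat \<Rightarrow> (real \<Rightarrow> real) \<Rightarrow> (real \<Rightarrow> real) \<Rightarrow> real \<Rightarrow> real" where
  "concomitant T p w f t =
     (\<Sum>k<p. (-1) ^ k * (nderiv {0..T} k w t * nderiv {0..T} (p - 1 - k) f t))"

text \<open>Lagrange's identity. By the product rule the k-th summand contributes the difference of
  consecutive terms of one sequence, so the sum telescopes to its first and last term.\<close>

lemma concomitant_deriv:
  assumes w: "smooth_fun T w" and f: "smooth_fun T f" and t: "t \<in> {0..T}"
  shows "(concomitant T p w f has_real_derivative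
    (w t * nderiv {0..T} p f t - (-1) ^ p * nderiv {0..T} p w t * f t)) (at t within {0..T})"
proof -
  let ?g = "\<lambda>k. (-1) ^ k * (nderiv {0..T} k w t * nderiv {0..T} (p - k) f t)"
  have "(concomitant T p w f has_real_derivative
     (\<Sum>k<p. (-1) ^ k * (nderiv {0..T} k w t * nderiv {0..T} (Suc (p - 1 - k)) f t
        + nderiv {0..T} (Suc k) w t * nderiv {0..T} (p - 1 - k) f t))) (at t within {0..T})"
    unfolding concomitant_def[abs_def]
    by (intro DERIV_sum DERIV_cmult DERIV_mult' smooth_fun_has_derivative assms)
  also have "(\<Sum>k<p. (-1) ^ k * (nderiv {0..T} k w t * nderiv {0..T} (Suc (p - 1 - k)) f t
        + nderiv {0..T} (Suc k) w t * nderiv {0..T} (p - 1 - k) f t)) = (\<Sum>k<p. ?g k - ?g (Suc k))"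
  proof (rule sum.cong[OF refl])
    fix k assume "k \<in> {..<p}"
    then have "Suc (p - 1 - k) = p - k" "p - 1 - k = p - Suc k" by auto
    then show "(-1) ^ k * (nderiv {0..T} k w t * nderiv {0..T} (Suc (p - 1 - k)) f t
        + nderiv {0..T} (Suc k) w t * nderiv {0..T} (p - 1 - k) f t) = ?g k - ?g (Suc k)"
      by (simp add: algebra_simps del: nderiv.simps(2))
  qed
  also have "\<dots> = ?g 0 - ?g p" by (rule sum_lessThan_telescope')
  finally show ?thesis by (simp add: mult.assoc del: nderiv.simps(2))
qed

lemma integral_pdiff_by_parts:
  assumes T: "0 < T" and w: "smooth_fun T w" and f: "smooth_fun T f"
  shows "((\<lambda>t. pdiff T P f t * w t - f t * pdiff T (pcompose P [:0, -1:]) w t) has_integral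
     (\<Sum>p\<le>degree P. coeff P p * (concomitant T p w f T - concomitant T p w f 0))) {0..T}"
proof -
  let ?c = "\<lambda>p t. w t * nderiv {0..T} p f t - (-1) ^ p * nderiv {0..T} p w t * f t"
  have "(?c p has_integral (concomitant T p w f T - concomitant T p w f 0)) {0..T}" for p
    using T concomitant_deriv[OF w f] fundamental_theorem_of_calculus[of 0 T "concomitant T p w f" "?c p"]
    by (auto simp: has_real_derivative_iff_has_vector_derivative)
  then have "((\<lambda>t. \<Sum>p\<le>degree P. coeff P p * ?c p t) has_integral
     (\<Sum>p\<le>degree P. coeff P p * (concomitant T p w f T - concomitant T p w f 0))) {0..T}"
    by (intro has_integral_sum has_integral_mult_right) auto
  moreover have "(\<Sum>p\<le>degree P. coeff P p * ?c p t)
      = pdiff T P f t * w t - f t * pdiff T (pcompose P [:0, -1:]) w t" for t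
    unfolding pdiff_def degree_pcompose_neg coeff_pcompose_neg
    by (simp add: sum_distrib_left sum_distrib_right sum_subtractf algebra_simps)
  ultimately show ?thesis by simp
qed

section \<open>Matrix differential operators and the first variation\<close>

lemma smooth_curves_iff:
  "y \<in> smooth_curves T d \<longleftrightarrow> y \<in> {0..T} \<rightarrow>\<^sub>E carrier_vec d \<and> (\<forall>i<d. smooth_fun T (\<lambda>t. y t $ i))"
  by (simp add: smooth_curves_def smooth_fun_def)

lemma smooth_curves_carrier: "y \<in> smooth_curves T d \<Longrightarrow> t \<in> {0..T} \<Longrightarrow> y t \<in> carrier_vec d"
  by (auto simp: smooth_curves_iff)

lemma smooth_curves_smooth: "y \<in> smooth_curves T d \<Longrightarrow> i < d \<Longrightarrow> smooth_fun T (\<lambda>t. y t $ i)"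
  by (simp add: smooth_curves_iff)

lemma smooth_curves_restrictI:
  assumes "\<And>t. t \<in> {0..T} \<Longrightarrow> y t \<in> carrier_vec d" "\<And>i. i < d \<Longrightarrow> smooth_fun T (\<lambda>t. y t $ i)"
  shows "restrict y {0..T} \<in> smooth_curves T d"
  unfolding smooth_curves_iff
proof (intro conjI allI impI)
  fix i assume "i < d"
  from assms(2)[OF this] show "smooth_fun T (\<lambda>t. restrict y {0..T} t $ i)"
    by (rule smooth_fun_cong[rotated]) simp
qed (use assms in auto)

lemma diffop_index:
  assumes "t \<in> {0..T}" "i < dim_row P"
  shows "diffop T P y t $ i = (\<Sum>j<dim_col P. pdiff T (P $$ (i,j)) (\<lambda>s. y s $ j) t)"
  using assms by (simp add: diffop_def pdiff_def)

lemma diffop_dim [simp]: "t \<in> {0..T} \<Longrightarrow> dim_vec (diffop T P y t) = dim_row P"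
  by (simp add: diffop_def)

lemma diffop_carrier [simp]: "t \<in> {0..T} \<Longrightarrow> diffop T P y t \<in> carrier_vec (dim_row P)"
  by (simp add: diffop_def)

lemma diffop_cong:
  assumes "\<And>t. t \<in> {0..T} \<Longrightarrow> y t = z t"
  shows "diffop T P y = diffop T P z"
proof
  fix t
  show "diffop T P y t = diffop T P z t"
  proof (cases "t \<in> {0..T}")
    case True
    then show ?thesis
      using assms by (intro eq_vecI) (auto simp: diffop_index intro!: sum.cong pdiff_cong)
  qed (simp only: diffop_def restrict_def if_False)
qed

lemma diffop_smooth:
  assumes "0 < T" "y \<in> smooth_curves T d" "P \<in> carrier_mat r d"
  shows "diffop T P y \<in> smooth_curves T r"
  unfolding smooth_curves_iff
proof (intro conjI allI impI)
  show "diffop T P y \<in> {0..T} \<rightarrow>\<^sub>E carrier_vec r"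
    using assms by (auto simp: diffop_def)
  fix i assume "i < r"
  have "smooth_fun T (\<lambda>t. \<Sum>j<d. 1 * pdiff T (P $$ (i,j)) (\<lambda>s. y s $ j) t)"
    using assms by (intro smooth_fun_lincomb smooth_fun_pdiff) (auto simp: smooth_curves_iff)
  then show "smooth_fun T (\<lambda>t. diffop T P y t $ i)"
    by (rule smooth_fun_cong[rotated]) (use \<open>i < r\<close> assms in \<open>auto simp: diffop_index\<close>)
qed

lemma diffop_mult:
  assumes T: "0 < T" and P: "P \<in> carrier_mat a b" and Q: "Q \<in> carrier_mat b c"
    and y: "y \<in> smooth_curves T c"
  shows "diffop T (P * Q) y = diffop T P (diffop T Q y)"
proof
  fix t
  show "diffop T (P * Q) y t = diffop T P (diffop T Q y) t"
  proof (cases "t \<in> {0..T}")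
    case t: True
    show ?thesis
    proof (rule eq_vecI)
      fix i assume "i < dim_vec (diffop T P (diffop T Q y) t)"
      then have i: "i < a" using t P by simp
      have "diffop T (P * Q) y t $ i =
          (\<Sum>j<c. pdiff T (\<Sum>k<b. P $$ (i,k) * Q $$ (k,j)) (\<lambda>s. y s $ j) t)"
        using t i P Q by (auto simp: diffop_index scalar_prod_def atLeast0LessThan intro!: sum.cong)
      also have "\<dots> = (\<Sum>j<c. \<Sum>k<b. pdiff T (P $$ (i,k)) (pdiff T (Q $$ (k,j)) (\<lambda>s. y s $ j)) t)"
        using T t smooth_curves_smooth[OF y] by (simp add: pdiff_sum pdiff_mult)
      also have "\<dots> = (\<Sum>k<b. \<Sum>j<c. 1 * pdiff T (P $$ (i,k)) (pdiff T (Q $$ (k,j)) (\<lambda>s. y s $ j)) t)"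
        by (subst sum.swap) simp
      also have "\<dots> = (\<Sum>k<b. pdiff T (P $$ (i,k))
           (\<lambda>t. \<Sum>j<c. 1 * pdiff T (Q $$ (k,j)) (\<lambda>s. y s $ j) t) t)"
        using T t smooth_curves_smooth[OF y]
        by (intro sum.cong refl pdiff_lincomb[symmetric] smooth_fun_pdiff) auto
      also have "\<dots> = (\<Sum>k<b. pdiff T (P $$ (i,k)) (\<lambda>s. diffop T Q y s $ k) t)"
        using T t Q by (intro sum.cong refl pdiff_cong) (auto simp: diffop_index)
      also have "\<dots> = diffop T P (diffop T Q y) t $ i"
        using t i P by (auto simp: diffop_index)
      finally show "diffop T (P * Q) y t $ i = diffop T P (diffop T Q y) t $ i" .
    qed (use t P in auto)
  qed (simp only: diffop_def restrict_def if_False)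
qed

lemma diffop_add:
  assumes "P \<in> carrier_mat a b" "Q \<in> carrier_mat a b" "t \<in> {0..T}"
  shows "diffop T (P + Q) y t = diffop T P y t + diffop T Q y t"
  using assms by (intro eq_vecI) (auto simp: diffop_index pdiff_add sum.distrib)

lemma diffop_const_pmat:
  assumes "t \<in> {0..T}" "y t \<in> carrier_vec (dim_col M)"
  shows "diffop T (const_pmat M) y t = M *\<^sub>v y t"
  using assms by (intro eq_vecI)
    (auto simp: diffop_index const_pmat_def scalar_prod_def atLeast0LessThan pdiff_pCons intro!: sum.cong)

lemma diffop_lincomb:
  assumes "0 < T" "y \<in> smooth_curves T d" "z \<in> smooth_curves T d" "P \<in> carrier_mat r d" "t \<in> {0..T}"
  shows "diffop T P (\<lambda>t\<in>{0..T}. y t + c \<cdot>\<^sub>v z t) t = diffop T P y t + c \<cdot>\<^sub>v diffop T P z t"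
proof (rule eq_vecI)
  fix i assume "i < dim_vec (diffop T P y t + c \<cdot>\<^sub>v diffop T P z t)"
  then have i: "i < r" using assms by simp
  have "pdiff T (P $$ (i,j)) (\<lambda>s. (\<lambda>t\<in>{0..T}. y t + c \<cdot>\<^sub>v z t) s $ j) t
     = pdiff T (P $$ (i,j)) (\<lambda>s. y s $ j) t + c * pdiff T (P $$ (i,j)) (\<lambda>s. z s $ j) t" if "j < d" for j
  proof -
    have "pdiff T (P $$ (i,j)) (\<lambda>s. (\<lambda>t\<in>{0..T}. y t + c \<cdot>\<^sub>v z t) s $ j) t
      = pdiff T (P $$ (i,j)) (\<lambda>s. \<Sum>l\<in>{0::nat,1}. (if l = 0 then 1 else c) * (if l = 0 then y else z) s $ j) t"
      using assms that by (intro pdiff_cong) (auto dest!: smooth_curves_carrier)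
    also have "\<dots> = (\<Sum>l\<in>{0::nat,1}. (if l = 0 then 1 else c) *
        pdiff T (P $$ (i,j)) (\<lambda>s. (if l = 0 then y else z) s $ j) t)"
      using assms that by (intro pdiff_lincomb) (auto simp: smooth_curves_iff)
    finally show ?thesis by simp
  qed
  then show "diffop T P (\<lambda>t\<in>{0..T}. y t + c \<cdot>\<^sub>v z t) t $ i = (diffop T P y t + c \<cdot>\<^sub>v diffop T P z t) $ i"
    using assms i by (auto simp: diffop_index sum.distrib sum_distrib_left)
qed (use assms in auto)

lemma mult_mat_vec_smooth:
  assumes "0 < T" "y \<in> smooth_curves T d" "M \<in> carrier_mat r d"
  shows "(\<lambda>t\<in>{0..T}. M *\<^sub>v y t) \<in> smooth_curves T r"
proof (rule smooth_curves_restrictI)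
  fix i assume "i < r"
  have "smooth_fun T (\<lambda>t. \<Sum>j<d. M $$ (i,j) * y t $ j)"
    using assms by (intro smooth_fun_lincomb) (auto simp: smooth_curves_iff)
  then show "smooth_fun T (\<lambda>t. (M *\<^sub>v y t) $ i)"
    by (rule smooth_fun_cong[rotated])
      (use \<open>i < r\<close> assms in \<open>auto simp: scalar_prod_def atLeast0LessThan dest!: smooth_curves_carrier\<close>)
qed (use assms smooth_curves_carrier in \<open>auto intro!: mult_mat_vec_carrier\<close>)

lemma euler_lagrange_carrier:
  assumes "Q \<in> carrier_mat n n" "R \<in> carrier_mat m m" "X \<in> carrier_mat n m" "U \<in> carrier_mat m m"
  shows "euler_lagrange Q R X U \<in> carrier_mat m m"
  using assms by (auto simp: euler_lagrange_def adjoint_pmat_def)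

text \<open>In this form E(D)y depends on y only through Qx and Ru, where x = X(D)y and u = U(D)y.
  Besides preparing the integration by parts, it shows that flat outputs of zero-cost trajectories
  solve E(D)y = 0.\<close>

lemma diffop_euler_lagrange:
  assumes T: "0 < T" and Q: "Q \<in> carrier_mat n n" and R: "R \<in> carrier_mat m m"
    and X: "X \<in> carrier_mat n m" and U: "U \<in> carrier_mat m m"
    and y: "y \<in> smooth_curves T m" and t: "t \<in> {0..T}"
  shows "diffop T (euler_lagrange Q R X U) y t =
     diffop T (adjoint_pmat X) (\<lambda>t. Q *\<^sub>v diffop T X y t) t
   + diffop T (adjoint_pmat U) (\<lambda>t. R *\<^sub>v diffop T U y t) t"
proof -
  have *: "diffop T (adjoint_pmat P * const_pmat M * P) y t
      = diffop T (adjoint_pmat P) (\<lambda>t. M *\<^sub>v diffop T P y t) t"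
    if P: "P \<in> carrier_mat r m" and M: "M \<in> carrier_mat r r" for P M r
  proof -
    have aP: "adjoint_pmat P \<in> carrier_mat m r" and cM: "const_pmat M \<in> carrier_mat r r"
      using P M by (auto simp: adjoint_pmat_def const_pmat_def)
    have "diffop T (adjoint_pmat P * const_pmat M * P) y
      = diffop T (adjoint_pmat P) (diffop T (const_pmat M) (diffop T P y))"
      using diffop_mult[OF T mult_carrier_mat[OF aP cM] P y]
        diffop_mult[OF T aP cM diffop_smooth[OF T y P]] by simp
    also have "\<dots> = diffop T (adjoint_pmat P) (\<lambda>t. M *\<^sub>v diffop T P y t)"
      using P M by (intro diffop_cong) (auto simp: diffop_const_pmat)
    finally show ?thesis by simp
  qed
  have "adjoint_pmat X * const_pmat Q * X \<in> carrier_mat m m"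
    "adjoint_pmat U * const_pmat R * U \<in> carrier_mat m m"
    using X U by (auto simp: adjoint_pmat_def)
  from diffop_add[OF this t, where y=y] show ?thesis
    unfolding euler_lagrange_def *[OF X Q] *[OF U R] .
qed

text \<open>The scalar identities are summed over all entries; \<open>adjoint_pmat\<close>
  transposes and replaces D by -D, and the concomitants add up to
  \<open>ibp_boundary\<close>.\<close>

lemma diffop_by_parts:
  assumes T: "0 < T" and P: "P \<in> carrier_mat r d" and \<delta>: "\<delta> \<in> smooth_curves T d"
    and w: "\<And>t. t \<in> {0..T} \<Longrightarrow> w t \<in> carrier_vec r" "\<And>i. i < r \<Longrightarrow> smooth_fun T (\<lambda>t. w t $ i)"
  shows "((\<lambda>t. diffop T P \<delta> t \<bullet> w t - \<delta> t \<bullet> diffop T (adjoint_pmat P) w t) has_integral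
     ibp_boundary T P w \<delta>) {0..T}"
proof -
  let ?g = "\<lambda>i j t. pdiff T (P $$ (i,j)) (\<lambda>s. \<delta> s $ j) t * w t $ i
       - \<delta> t $ j * pdiff T (pcompose (P $$ (i,j)) [:0, -1:]) (\<lambda>s. w s $ i) t"
  let ?b = "\<lambda>i j. \<Sum>p\<le>degree (P $$ (i,j)). coeff (P $$ (i,j)) p *
     (concomitant T p (\<lambda>s. w s $ i) (\<lambda>s. \<delta> s $ j) T - concomitant T p (\<lambda>s. w s $ i) (\<lambda>s. \<delta> s $ j) 0)"
  have "((\<lambda>t. \<Sum>i<r. \<Sum>j<d. ?g i j t) has_integral (\<Sum>i<r. \<Sum>j<d. ?b i j)) {0..T}"
    using \<delta> by (intro has_integral_sum integral_pdiff_by_parts T w) (auto simp: smooth_curves_iff)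
  also have "(\<Sum>i<r. \<Sum>j<d. ?b i j) = ibp_boundary T P w \<delta>"
    using P by (simp add: ibp_boundary_def concomitant_def Let_def sum_subtractf right_diff_distrib)
  finally show ?thesis
  proof (rule has_integral_eq[rotated])
    fix t assume t: "t \<in> {0..T}"
    have "diffop T P \<delta> t \<bullet> w t = (\<Sum>i<r. \<Sum>j<d. pdiff T (P $$ (i,j)) (\<lambda>s. \<delta> s $ j) t * w t $ i)"
      using t P w(1)[OF t] by (auto simp: scalar_prod_def atLeast0LessThan diffop_index sum_distrib_right)
    moreover have "\<delta> t \<bullet> diffop T (adjoint_pmat P) w t =
      (\<Sum>i<r. \<Sum>j<d. \<delta> t $ j * pdiff T (pcompose (P $$ (i,j)) [:0, -1:]) (\<lambda>s. w s $ i) t)"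
      using t P by (subst sum.swap)
        (auto simp: scalar_prod_def atLeast0LessThan diffop_index sum_distrib_left adjoint_pmat_def intro!: sum.cong)
    ultimately show "(\<Sum>i<r. \<Sum>j<d. ?g i j t)
        = diffop T P \<delta> t \<bullet> w t - \<delta> t \<bullet> diffop T (adjoint_pmat P) w t"
      by (simp add: sum_subtractf)
  qed
qed

text \<open>The two interior terms left by integration by parts combine to the scalar product of
  \<delta> with E(D)y, which vanishes on the kernel; only the endpoint contribution remains.\<close>

lemma first_variation_smooth:
  assumes T: "0 < T" and Q: "Q \<in> carrier_mat n n" and R: "R \<in> carrier_mat m m"
    and X: "X \<in> carrier_mat n m" and U: "U \<in> carrier_mat m m"
    and y: "y \<in> kernel_solutions (euler_lagrange Q R X U) T" and \<delta>: "\<delta> \<in> smooth_curves T m"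
  shows "((\<lambda>t. diffop T X \<delta> t \<bullet> (Q *\<^sub>v diffop T X y t) + diffop T U \<delta> t \<bullet> (R *\<^sub>v diffop T U y t))
     has_integral boundary_term Q R X U T y \<delta>) {0..T}"
proof -
  let ?w = "\<lambda>t. Q *\<^sub>v diffop T X y t" and ?v = "\<lambda>t. R *\<^sub>v diffop T U y t"
  have E: "euler_lagrange Q R X U \<in> carrier_mat m m" by (rule euler_lagrange_carrier[OF Q R X U])
  then have ys: "y \<in> smooth_curves T m"
    and y0: "\<And>t. t \<in> {0..T} \<Longrightarrow> diffop T (euler_lagrange Q R X U) y t = 0\<^sub>v m"
    using y by (auto simp: kernel_solutions_def)
  have sm: "smooth_fun T (\<lambda>t. (M *\<^sub>v diffop T P y t) $ i)"
    if "P \<in> carrier_mat r m" "M \<in> carrier_mat r r" "i < r" for P M r i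
    using smooth_curves_smooth[OF mult_mat_vec_smooth[OF T diffop_smooth[OF T ys that(1)] that(2)] that(3)]
    by (rule smooth_fun_cong[rotated]) simp
  have "((\<lambda>t. (diffop T X \<delta> t \<bullet> ?w t - \<delta> t \<bullet> diffop T (adjoint_pmat X) ?w t)
     + (diffop T U \<delta> t \<bullet> ?v t - \<delta> t \<bullet> diffop T (adjoint_pmat U) ?v t)) has_integral
     boundary_term Q R X U T y \<delta>) {0..T}"
    unfolding boundary_term_def
    using mult_mat_vec_carrier[OF Q, of "diffop T X y _"] mult_mat_vec_carrier[OF R, of "diffop T U y _"]
      diffop_carrier[of _ T X y] diffop_carrier[of _ T U y] X U
    by (intro has_integral_add diffop_by_parts[OF T X \<delta>] diffop_by_parts[OF T U \<delta>]
        sm[OF X Q] sm[OF U R]) auto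
  then show ?thesis
  proof (rule has_integral_eq[rotated])
    fix t assume t: "t \<in> {0..T}"
    have a: "diffop T (adjoint_pmat X) ?w t \<in> carrier_vec m" "diffop T (adjoint_pmat U) ?v t \<in> carrier_vec m"
      using X U t by (auto simp: adjoint_pmat_def diffop_def)
    have "\<delta> t \<bullet> diffop T (adjoint_pmat X) ?w t + \<delta> t \<bullet> diffop T (adjoint_pmat U) ?v t
       = \<delta> t \<bullet> diffop T (euler_lagrange Q R X U) y t"
      unfolding diffop_euler_lagrange[OF T Q R X U ys t]
      using smooth_curves_carrier[OF \<delta> t] a by (simp add: scalar_prod_add_distrib)
    also have "\<dots> = 0" using y0[OF t] smooth_curves_carrier[OF \<delta> t] by simp
    finally show "(diffop T X \<delta> t \<bullet> ?w t - \<delta> t \<bullet> diffop T (adjoint_pmat X) ?w t)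
     + (diffop T U \<delta> t \<bullet> ?v t - \<delta> t \<bullet> diffop T (adjoint_pmat U) ?v t)
      = diffop T X \<delta> t \<bullet> ?w t + diffop T U \<delta> t \<bullet> ?v t" by simp
  qed
qed

section \<open>Linear differential equations\<close>

lemma has_real_derivative_agree:
  assumes "(f has_real_derivative d) (at t within S)" "t \<in> S" "\<And>x. x \<in> S \<Longrightarrow> g x = f x"
  shows "(g has_real_derivative d) (at t within S)"
  using has_vector_derivative_agree[OF assms] by (simp add: has_real_derivative_iff_has_vector_derivative)

text \<open>Powers are defined with the new factor on the right; the series and nilpotency arguments
  below peel it off on the left.\<close>

lemma pow_mat_Suc_left:
  fixes A :: "'a :: comm_ring_1 Matrix.mat"
  shows "A \<in> carrier_mat n n \<Longrightarrow> A ^\<^sub>m Suc k = A * A ^\<^sub>m k"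
proof (induction k)
  case (Suc k)
  then show ?case
    using assoc_mult_mat[OF Suc.prems pow_carrier_mat[OF Suc.prems] Suc.prems, of k] by simp
qed simp

lemma mult_mat_vec_index_sum:
  fixes M :: "'a :: comm_ring_1 Matrix.mat"
  assumes "M \<in> carrier_mat r c" "v \<in> carrier_vec c" "i < r"
  shows "(M *\<^sub>v v) $ i = (\<Sum>j<c. M $$ (i,j) * v $ j)"
  using assms by (auto simp: scalar_prod_def atLeast0LessThan)

lemma mult_mat_index_sum:
  assumes "M \<in> carrier_mat a b" "P \<in> carrier_mat b c" "i < a" "j < c"
  shows "(M * P) $$ (i,j) = (\<Sum>l<b. M $$ (i,l) * P $$ (l,j))"
  using assms by (auto simp: scalar_prod_def atLeast0LessThan)

text \<open>The sum of all absolute entries dominates every row sum, which is what the induction on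
  k needs.\<close>

lemma mat_power_bound:
  fixes A :: "real Matrix.mat"
  assumes A: "A \<in> carrier_mat n n" and "i < n" "j < n"
  shows "\<bar>(A ^\<^sub>m k) $$ (i,j)\<bar> \<le> (\<Sum>i<n. \<Sum>l<n. \<bar>A $$ (i,l)\<bar>) ^ k"
  using \<open>i < n\<close>
proof (induction k arbitrary: i)
  case 0
  then show ?case using A \<open>j < n\<close> by simp
next
  case (Suc k)
  let ?b = "\<Sum>i<n. \<Sum>l<n. \<bar>A $$ (i,l)\<bar>"
  have "(A ^\<^sub>m Suc k) $$ (i,j) = (A * A ^\<^sub>m k) $$ (i,j)"
    by (simp only: pow_mat_Suc_left[OF A])
  also have "\<bar>\<dots>\<bar> = \<bar>\<Sum>l<n. A $$ (i,l) * (A ^\<^sub>m k) $$ (l,j)\<bar>"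
    using A Suc.prems \<open>j < n\<close> pow_carrier_mat[OF A, of k]
    by (auto simp: scalar_prod_def atLeast0LessThan)
  also have "\<dots> \<le> (\<Sum>l<n. \<bar>A $$ (i,l)\<bar> * ?b ^ k)"
    using Suc.IH by (intro order.trans[OF sum_abs] sum_mono) (auto simp: abs_mult intro!: mult_left_mono)
  also have "\<dots> = (\<Sum>l<n. \<bar>A $$ (i,l)\<bar>) * ?b ^ k" by (simp add: sum_distrib_right)
  also have "\<dots> \<le> ?b * ?b ^ k"
    using Suc.prems
    by (intro mult_right_mono zero_le_power sum_nonneg member_le_sum[of i "{..<n}" "\<lambda>i. \<Sum>l<n. \<bar>A $$ (i,l)\<bar>"]) auto
  finally show ?case by simp
qed

section \<open>The matrix exponential and linear initial value problems\<close>

definition mat_exp :: "real Matrix.mat \<Rightarrow> real \<Rightarrow> real Matrix.mat" where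
  "mat_exp A t = Matrix.mat (dim_row A) (dim_row A) (\<lambda>(i,j). \<Sum>k. (A ^\<^sub>m k) $$ (i,j) / fact k * t ^ k)"

lemma mat_exp_carrier [simp]: "A \<in> carrier_mat n n \<Longrightarrow> mat_exp A t \<in> carrier_mat n n"
  by (simp add: mat_exp_def)

lemma mat_exp_summable:
  fixes A :: "real Matrix.mat"
  assumes A: "A \<in> carrier_mat n n" and ij: "i < n" "j < n"
  shows "summable (\<lambda>k. (A ^\<^sub>m k) $$ (i,j) / fact k * t ^ k)"
proof (rule summable_comparison_test')
  let ?b = "\<Sum>i<n. \<Sum>l<n. \<bar>A $$ (i,l)\<bar>"
  show "summable (\<lambda>k. (?b * \<bar>t\<bar>) ^ k /\<^sub>R fact k)" by (rule summable_exp_generic)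
  fix k :: nat
  show "norm ((A ^\<^sub>m k) $$ (i,j) / fact k * t ^ k) \<le> (?b * \<bar>t\<bar>) ^ k /\<^sub>R fact k"
    using mat_power_bound[OF A ij, of k]
    by (auto simp: abs_mult power_mult_distrib power_abs field_simps intro!: mult_left_mono)
qed

lemma mat_exp_sums:
  fixes A :: "real Matrix.mat"
  assumes A: "A \<in> carrier_mat n n" and ij: "i < n" "j < n"
  shows "(\<lambda>k. (A ^\<^sub>m k) $$ (i,j) / fact k * t ^ k) sums (mat_exp A t $$ (i,j))"
  using summable_sums[OF mat_exp_summable[OF assms]] A ij by (simp add: mat_exp_def)

lemma mat_exp_0: "A \<in> carrier_mat n n \<Longrightarrow> mat_exp A 0 = 1\<^sub>m n"
proof (intro eq_matI)
  fix i j assume A: "A \<in> carrier_mat n n" and "i < dim_row (1\<^sub>m n :: real Matrix.mat)" "j < dim_col (1\<^sub>m n :: real Matrix.mat)"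
  then have ij: "i < n" "j < n" by auto
  show "mat_exp A 0 $$ (i,j) = 1\<^sub>m n $$ (i,j)"
    using sums_unique2[OF mat_exp_sums[OF A ij, of 0] powser_sums_zero] A by simp
qed (auto simp: mat_exp_def)

text \<open>Termwise differentiation shifts the coefficients to A^(k+1) / k!, and this power factors
  both as A A^k and as A^k A. The two factorizations give the derivative and the commutation from
  the same series.\<close>

lemma mat_exp_deriv:
  fixes A :: "real Matrix.mat"
  assumes A: "A \<in> carrier_mat n n" and ij: "i < n" "j < n"
  shows "((\<lambda>t. mat_exp A t $$ (i,j)) has_real_derivative (A * mat_exp A t) $$ (i,j)) (at t within S)"
    and "(mat_exp A t * A) $$ (i,j) = (A * mat_exp A t) $$ (i,j)"
proof -
  let ?c = "\<lambda>k. (A ^\<^sub>m k) $$ (i,j) / fact k"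
  have d: "diffs ?c k = (A ^\<^sub>m Suc k) $$ (i,j) / fact k" for k
    unfolding diffs_def fact_Suc by (simp del: of_nat_Suc pow_mat.simps)
  have "((\<lambda>t. \<Sum>k. ?c k * t ^ k) has_real_derivative (\<Sum>k. diffs ?c k * t ^ k)) (at t)"
    using termdiffs_strong_converges_everywhere[of ?c t] mat_exp_summable[OF A ij] by blast
  moreover have "(\<lambda>t. mat_exp A t $$ (i,j)) = (\<lambda>t. \<Sum>k. ?c k * t ^ k)"
    using A ij by (auto simp: mat_exp_def)
  ultimately have *: "((\<lambda>t. mat_exp A t $$ (i,j)) has_real_derivative (\<Sum>k. diffs ?c k * t ^ k)) (at t)"
    by simp
  have c: "A ^\<^sub>m k \<in> carrier_mat n n" for k by (rule pow_carrier_mat[OF A])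
  have "(\<lambda>k. \<Sum>l<n. A $$ (i,l) * ((A ^\<^sub>m k) $$ (l,j) / fact k * t ^ k))
     sums (\<Sum>l<n. A $$ (i,l) * mat_exp A t $$ (l,j))"
    by (intro sums_sum sums_mult mat_exp_sums) (use A ij in auto)
  moreover have "(\<Sum>l<n. A $$ (i,l) * ((A ^\<^sub>m k) $$ (l,j) / fact k * t ^ k)) = diffs ?c k * t ^ k" for k
  proof -
    have "(A ^\<^sub>m Suc k) $$ (i,j) = (A * A ^\<^sub>m k) $$ (i,j)" by (simp only: pow_mat_Suc_left[OF A])
    also have "\<dots> = (\<Sum>l<n. A $$ (i,l) * (A ^\<^sub>m k) $$ (l,j))"
      using A ij c[of k] by (auto simp: scalar_prod_def atLeast0LessThan)
    finally show ?thesis unfolding d by (simp add: sum_divide_distrib sum_distrib_right mult.assoc)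
  qed
  ultimately have 1: "(\<lambda>k. diffs ?c k * t ^ k) sums (A * mat_exp A t) $$ (i,j)"
    unfolding mult_mat_index_sum[OF A mat_exp_carrier[OF A] ij] by simp
  have "(\<lambda>k. \<Sum>l<n. ((A ^\<^sub>m k) $$ (i,l) / fact k * t ^ k) * A $$ (l,j))
     sums (\<Sum>l<n. mat_exp A t $$ (i,l) * A $$ (l,j))"
    by (intro sums_sum sums_mult2 mat_exp_sums) (use A ij in auto)
  moreover have "(\<Sum>l<n. ((A ^\<^sub>m k) $$ (i,l) / fact k * t ^ k) * A $$ (l,j)) = diffs ?c k * t ^ k" for k
  proof -
    have "(A ^\<^sub>m Suc k) $$ (i,j) = (\<Sum>l<n. (A ^\<^sub>m k) $$ (i,l) * A $$ (l,j))"
      using A ij c[of k] by (auto simp: scalar_prod_def atLeast0LessThan)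
    then show ?thesis unfolding d
      by (simp add: sum_divide_distrib sum_distrib_right sum_distrib_left mult_ac)
  qed
  ultimately have 2: "(\<lambda>k. diffs ?c k * t ^ k) sums (mat_exp A t * A) $$ (i,j)"
    unfolding mult_mat_index_sum[OF mat_exp_carrier[OF A] A ij] by simp
  show "(mat_exp A t * A) $$ (i,j) = (A * mat_exp A t) $$ (i,j)" by (rule sums_unique2[OF 2 1])
  show "((\<lambda>t. mat_exp A t $$ (i,j)) has_real_derivative (A * mat_exp A t) $$ (i,j)) (at t within S)"
    using * unfolding sums_unique[OF 1, symmetric] by (rule has_field_derivative_at_within)
qed

lemma mat_exp_commute:
  assumes A: "A \<in> carrier_mat n n" shows "mat_exp A t * A = A * mat_exp A t"
  using A carrier_matD[OF mat_exp_carrier[OF A, of t]]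
  by (intro eq_matI) (auto intro!: mat_exp_deriv(2)[OF A] simp del: index_mult_mat(1))

lemma mat_exp_neg_deriv:
  fixes A :: "real Matrix.mat"
  assumes A: "A \<in> carrier_mat n n" and ij: "i < n" "j < n"
  shows "((\<lambda>t. mat_exp A (-t) $$ (i,j)) has_real_derivative - ((mat_exp A (-t) * A) $$ (i,j))) (at t within S)"
proof -
  have "((\<lambda>t. mat_exp A (-t) $$ (i,j)) has_real_derivative ((A * mat_exp A (-t)) $$ (i,j)) * (-1)) (at t within S)"
    by (rule DERIV_chain2[where f="\<lambda>t. mat_exp A t $$ (i,j)", OF mat_exp_deriv(1)[OF A ij]])
      (auto intro!: derivative_eq_intros)
  then show ?thesis by (simp add: mat_exp_commute[OF A])
qed

text \<open>Multiplying by \<open>exp (-tA)\<close> turns \<open>x' = A x + f\<close> into a pure quadrature.\<close>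
lemma mat_exp_neg_mult_deriv:
  fixes A :: "real Matrix.mat"
  assumes A: "A \<in> carrier_mat n n" and i: "i < n" and t: "t \<in> S"
    and x: "\<And>t. t \<in> S \<Longrightarrow> x t \<in> carrier_vec n" and f: "f t \<in> carrier_vec n"
    and d: "\<And>j. j < n \<Longrightarrow> ((\<lambda>s. x s $ j) has_real_derivative (A *\<^sub>v x t + f t) $ j) (at t within S)"
  shows "((\<lambda>s. (mat_exp A (-s) *\<^sub>v x s) $ i) has_real_derivative (mat_exp A (-t) *\<^sub>v f t) $ i) (at t within S)"
proof -
  let ?W = "\<lambda>s. mat_exp A (-s)"
  have W: "?W s \<in> carrier_mat n n" for s using A by simp
  have "((\<lambda>s. \<Sum>j<n. ?W s $$ (i,j) * x s $ j) has_real_derivative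
     (\<Sum>j<n. ?W t $$ (i,j) * (A *\<^sub>v x t + f t) $ j + - ((?W t * A) $$ (i,j)) * x t $ j)) (at t within S)"
    by (intro DERIV_sum DERIV_mult' mat_exp_neg_deriv d) (use A i in auto)
  also have "(\<Sum>j<n. ?W t $$ (i,j) * (A *\<^sub>v x t + f t) $ j + - ((?W t * A) $$ (i,j)) * x t $ j)
     = (?W t *\<^sub>v (A *\<^sub>v x t + f t)) $ i - ((?W t * A) *\<^sub>v x t) $ i"
    using mult_mat_vec_index_sum[OF W[of t] _ i, of "A *\<^sub>v x t + f t"] A x[OF t] f
      mult_mat_vec_index_sum[OF mult_carrier_mat[OF W[of t] A] x[OF t] i]
    by (simp add: sum_subtractf del: index_mult_mat(1) index_mult_mat_vec)
  also have "?W t *\<^sub>v (A *\<^sub>v x t + f t) = (?W t * A) *\<^sub>v x t + ?W t *\<^sub>v f t"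
    using mult_add_distrib_mat_vec[OF W[of t] mult_mat_vec_carrier[OF A x[OF t]] f]
      assoc_mult_mat_vec[OF W[of t] A x[OF t]] by simp
  also have "((?W t * A) *\<^sub>v x t + ?W t *\<^sub>v f t) $ i - ((?W t * A) *\<^sub>v x t) $ i = (?W t *\<^sub>v f t) $ i"
    using W[of t] i by (simp del: index_mult_mat_vec)
  finally show ?thesis
    by (rule has_real_derivative_agree[OF _ t mult_mat_vec_index_sum[OF W x i]])
qed

text \<open>Each column of exp(tA) solves x' = A x, so by \<open>mat_exp_neg_mult_deriv\<close> with
  zero forcing exp(-tA) exp(tA) is constant in t and equals its value at 0. The reverse product is
  then a fact about square matrices.\<close>

lemma mat_exp_inverse:
  fixes A :: "real Matrix.mat"
  assumes A: "A \<in> carrier_mat n n"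
  shows "mat_exp A (-t) * mat_exp A t = 1\<^sub>m n" "mat_exp A t * mat_exp A (-t) = 1\<^sub>m n"
proof -
  show 1: "mat_exp A (-t) * mat_exp A t = 1\<^sub>m n"
  proof (rule eq_matI)
    fix i j assume "i < dim_row (1\<^sub>m n :: real Matrix.mat)" "j < dim_col (1\<^sub>m n :: real Matrix.mat)"
    then have ij: "i < n" "j < n" by auto
    let ?x = "\<lambda>t. Matrix.col (mat_exp A t) j"
    have x: "?x s \<in> carrier_vec n" for s using mat_exp_carrier[OF A, of s] by auto
    have "((\<lambda>s. (mat_exp A (-s) *\<^sub>v ?x s) $ i) has_real_derivative (mat_exp A (-t) *\<^sub>v 0\<^sub>v n) $ i) (at t within UNIV)" for t
    proof (rule mat_exp_neg_mult_deriv[OF A ij(1)])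
      fix l assume l: "l < n"
      have "(A *\<^sub>v ?x t + 0\<^sub>v n) $ l = (A * mat_exp A t) $$ (l,j)"
        using A carrier_matD[OF mat_exp_carrier[OF A, of t]] l ij by simp
      moreover have "(\<lambda>s. ?x s $ l) = (\<lambda>s. mat_exp A s $$ (l,j))"
        using A l ij by (simp add: mat_exp_def)
      ultimately show "((\<lambda>s. ?x s $ l) has_real_derivative (A *\<^sub>v ?x t + 0\<^sub>v n) $ l) (at t within UNIV)"
        using mat_exp_deriv(1)[OF A l ij(2)] by simp
    qed (use x in auto)
    then have "\<forall>t. ((\<lambda>s. (mat_exp A (-s) *\<^sub>v ?x s) $ i) has_real_derivative 0) (at t)"
      using ij carrier_matD[OF mat_exp_carrier[OF A]] by (simp add: scalar_prod_def)
    from DERIV_isconst_all[OF this, of t 0]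
    show "(mat_exp A (-t) * mat_exp A t) $$ (i,j) = 1\<^sub>m n $$ (i,j)"
      using carrier_matD[OF mat_exp_carrier[OF A]] ij by (simp add: mat_exp_0[OF A])
  qed (use carrier_matD[OF mat_exp_carrier[OF A]] in auto)
  show "mat_exp A t * mat_exp A (-t) = 1\<^sub>m n"
    using mat_mult_left_right_inverse[OF _ _ 1] A by simp
qed

text \<open>Variation of constants. The value is prescribed at an arbitrary s because states start
  at 0 while costates end at T.\<close>

lemma linear_ode_forced:
  fixes A :: "real Matrix.mat"
  assumes A: "A \<in> carrier_mat n n" and T: "0 < T" and s: "s \<in> {0..T}" and a: "a \<in> carrier_vec n"
    and f: "\<And>t. f t \<in> carrier_vec n" "\<And>i. i < n \<Longrightarrow> continuous_on {0..T} (\<lambda>t. f t $ i)"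
  shows "\<exists>x. (\<forall>t. x t \<in> carrier_vec n) \<and> x s = a \<and> (\<forall>t\<in>{0..T}. \<forall>i<n.
     ((\<lambda>t. x t $ i) has_real_derivative (A *\<^sub>v x t + f t) $ i) (at t within {0..T}))"
proof -
  let ?Y = "\<lambda>t. mat_exp A t" and ?W = "\<lambda>t. mat_exp A (-t)"
  have Y: "?Y t \<in> carrier_mat n n" for t using A by simp
  define F where "F t = Matrix.vec n (\<lambda>i. integral {0..t} (\<lambda>r. (?W r *\<^sub>v f r) $ i))" for t
  have cW: "continuous_on {0..T} (\<lambda>t. ?W t $$ (i,j))" if "i < n" "j < n" for i j
    by (rule DERIV_continuous_on) (rule mat_exp_neg_deriv[OF A that])
  have c: "continuous_on {0..T} (\<lambda>r. (?W r *\<^sub>v f r) $ i)" if "i < n" for i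
  proof -
    have "continuous_on {0..T} (\<lambda>r. \<Sum>j<n. ?W r $$ (i,j) * f r $ j)"
      using that by (intro continuous_intros cW f) auto
    then show ?thesis
      using that carrier_matD[OF mat_exp_carrier[OF A]]
      by (simp add: scalar_prod_def atLeast0LessThan carrier_vecD[OF f(1)])
  qed
  have F: "F t \<in> carrier_vec n" for t by (simp add: F_def)
  have dF: "((\<lambda>t. F t $ i) has_real_derivative (?W t *\<^sub>v f t) $ i) (at t within {0..T})"
    if "i < n" "t \<in> {0..T}" for i t
    using integral_has_real_derivative[OF c[OF that(1)] that(2)] that by (simp add: F_def)
  \<comment> \<open>Normalizes the integration constant: exp(sA) (b + F s) has to be a.\<close>
  define b where "b = ?W s *\<^sub>v a - F s"
  have b: "b \<in> carrier_vec n" using Y[of "-s"] a F[of s] by (simp add: b_def)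
  define x where "x t = ?Y t *\<^sub>v (b + F t)" for t
  have x: "x t \<in> carrier_vec n" for t using Y[of t] b F by (simp add: x_def)
  have "b + F s = ?W s *\<^sub>v a"
    using Y[of "-s"] a F[of s] by (intro eq_vecI) (auto simp: b_def)
  then have "x s = (?Y s * ?W s) *\<^sub>v a"
    using Y[of s] Y[of "-s"] a by (simp add: x_def)
  then have xs: "x s = a" using mat_exp_inverse(2)[OF A, of s] a by simp
  have "((\<lambda>t. x t $ i) has_real_derivative (A *\<^sub>v x t + f t) $ i) (at t within {0..T})"
    if i: "i < n" and t: "t \<in> {0..T}" for i t
  proof -
    have "((\<lambda>t. \<Sum>j<n. ?Y t $$ (i,j) * (b $ j + F t $ j)) has_real_derivative
      (\<Sum>j<n. ?Y t $$ (i,j) * (?W t *\<^sub>v f t) $ j + (A * ?Y t) $$ (i,j) * (b $ j + F t $ j))) (at t within {0..T})"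
      by (intro DERIV_sum DERIV_mult' mat_exp_deriv(1)[OF A i])
        (auto intro!: derivative_eq_intros dF t)
    also have "(\<Sum>j<n. ?Y t $$ (i,j) * (?W t *\<^sub>v f t) $ j + (A * ?Y t) $$ (i,j) * (b $ j + F t $ j))
       = (?Y t *\<^sub>v (?W t *\<^sub>v f t)) $ i + ((A * ?Y t) *\<^sub>v (b + F t)) $ i"
      using mult_mat_vec_index_sum[OF Y[of t] mult_mat_vec_carrier[OF Y[of "-t"] f(1)[of t]] i]
        mult_mat_vec_index_sum[OF mult_carrier_mat[OF A Y[of t]] add_carrier_vec[OF b F[of t]] i] b F[of t]
      by (simp add: sum.distrib del: index_mult_mat(1) index_mult_mat_vec)
    also have "?Y t *\<^sub>v (?W t *\<^sub>v f t) = (?Y t * ?W t) *\<^sub>v f t"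
      using Y[of t] Y[of "-t"] f(1)[of t] by simp
    also have "\<dots> = f t" using mat_exp_inverse(2)[OF A, of t] f(1)[of t] by simp
    also have "(A * ?Y t) *\<^sub>v (b + F t) = A *\<^sub>v x t"
      unfolding x_def by (rule assoc_mult_mat_vec[OF A Y[of t] add_carrier_vec[OF b F[of t]]])
    finally have "((\<lambda>t. \<Sum>j<n. ?Y t $$ (i,j) * (b $ j + F t $ j)) has_real_derivative
        (A *\<^sub>v x t + f t) $ i) (at t within {0..T})"
      using A i x[of t] f(1)[of t] by (simp add: add.commute)
    moreover have "x t $ i = (\<Sum>j<n. ?Y t $$ (i,j) * (b $ j + F t $ j))" for t
      unfolding x_def using Y[of t] i b F[of t] by (auto simp: scalar_prod_def atLeast0LessThan)
    ultimately show ?thesis by simp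
  qed
  then show ?thesis using x xs by blast
qed

lemma linear_ode_solutions_carrier:
  "Z \<in> linear_ode_solutions A T \<Longrightarrow> t \<in> {0..T} \<Longrightarrow> Z t \<in> carrier_vec (dim_row A)"
  by (auto simp: linear_ode_solutions_def)

text \<open>exp(-tA) Z(t) has zero derivative, hence stays at its initial value 0, and exp(-tA) is
  invertible.\<close>

lemma linear_ode_zero:
  fixes A :: "real Matrix.mat"
  assumes A: "A \<in> carrier_mat n n" and Z: "Z \<in> linear_ode_solutions A T" and "0 < T" and Z0: "Z 0 = 0\<^sub>v n"
    and t: "t \<in> {0..T}"
  shows "Z t = 0\<^sub>v n"
proof -
  have zc: "Z s \<in> carrier_vec n" if "s \<in> {0..T}" for s
    using linear_ode_solutions_carrier[OF Z that] A by simp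
  have W: "mat_exp A s \<in> carrier_mat n n" for s using A by simp
  have "(mat_exp A (-t) *\<^sub>v Z t) $ i = (mat_exp A (-0) *\<^sub>v Z 0) $ i" if i: "i < n" for i
  proof (rule has_field_derivative_zero_constant[of "{0..T}", THEN exE])
    fix s assume s: "s \<in> {0..T}"
    have "((\<lambda>s. (mat_exp A (-s) *\<^sub>v Z s) $ i) has_real_derivative (mat_exp A (-s) *\<^sub>v 0\<^sub>v n) $ i) (at s within {0..T})"
      using Z A zc s by (intro mat_exp_neg_mult_deriv[OF A i s]) (auto simp: linear_ode_solutions_def)
    then show "((\<lambda>s. (mat_exp A (-s) *\<^sub>v Z s) $ i) has_real_derivative 0) (at s within {0..T})"
      using W[of "-s"] i by simp
  next
    fix c assume "\<forall>s\<in>{0..T}. (mat_exp A (-s) *\<^sub>v Z s) $ i = c"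
    then have "(mat_exp A (-t) *\<^sub>v Z t) $ i = c" "(mat_exp A (-0) *\<^sub>v Z 0) $ i = c"
      using bspec[of "{0..T}" "\<lambda>s. (mat_exp A (-s) *\<^sub>v Z s) $ i = c" t] bspec[of "{0..T}" "\<lambda>s. (mat_exp A (-s) *\<^sub>v Z s) $ i = c" 0] t by (auto simp del: index_mult_mat_vec)
    then show ?thesis by (simp only:)
  qed auto
  then have "mat_exp A (-t) *\<^sub>v Z t = 0\<^sub>v n"
    using W[of "-t"] W[of 0] Z0 by (intro eq_vecI) auto
  then have "mat_exp A t *\<^sub>v (mat_exp A (-t) *\<^sub>v Z t) = 0\<^sub>v n" using W[of t] by auto
  moreover have "mat_exp A t *\<^sub>v (mat_exp A (-t) *\<^sub>v Z t) = (mat_exp A t * mat_exp A (-t)) *\<^sub>v Z t"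
    using W[of t] W[of "-t"] zc[OF t] by simp
  ultimately show ?thesis using mat_exp_inverse(2)[OF A, of t] zc[OF t] by simp
qed

section \<open>Stable and unstable solutions and the boundary value problem\<close>

lemma inverse_mat_exists:
  fixes M :: "'a :: field Matrix.mat"
  assumes M: "M \<in> carrier_mat n n" and inj: "\<And>v. v \<in> carrier_vec n \<Longrightarrow> M *\<^sub>v v = 0\<^sub>v n \<Longrightarrow> v = 0\<^sub>v n"
  obtains P where "P \<in> carrier_mat n n" "P * M = 1\<^sub>m n" "M * P = 1\<^sub>m n"
proof -
  have "Determinant.det M \<noteq> 0"
    using inj det_0_iff_vec_prod_zero_field[OF M] by blast
  from det_non_zero_imp_unit[OF M this, of "()"] show ?thesis
    using that unfolding Units_def ring_mat_def by auto
qed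

text \<open>One term of the exponential series is below its sum; this is how polynomial factors are
  absorbed into a slower exponential.\<close>

lemma pow_div_fact_le_exp:
  fixes x :: real
  assumes "0 \<le> x" shows "x ^ k / fact k \<le> exp x"
proof -
  have "(\<Sum>j\<in>{k}. x ^ j /\<^sub>R fact j) \<le> (\<Sum>j. x ^ j /\<^sub>R fact j)"
    using assms by (intro sum_le_suminf summable_exp_generic) auto
  then show ?thesis by (simp add: exp_def field_simps)
qed

text \<open>\<open>\<sigma> = 1\<close> means decay at \<open>+\<infinity>\<close>, \<open>\<sigma> = -1\<close> decay at \<open>-\<infinity>\<close>.\<close>
definition complex_decay :: "real \<Rightarrow> nat \<Rightarrow> complex Matrix.mat \<Rightarrow> complex Matrix.vec \<Rightarrow> bool" where
  "complex_decay \<sigma> N M v \<longleftrightarrow> v \<in> carrier_vec N \<and> (\<exists>W. (\<forall>t. W t \<in> carrier_vec N) \<and> W 0 = v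
     \<and> (\<forall>t. \<forall>i<N. ((\<lambda>s. W s $ i) has_vector_derivative (M *\<^sub>v W t) $ i) (at t))
     \<and> (\<exists>C\<ge>0. \<exists>\<mu>>0. \<forall>t. 0 \<le> \<sigma> * t \<longrightarrow> (\<forall>i<N. cmod (W t $ i) \<le> C * exp (- \<mu> * (\<sigma> * t)))))"

lemma complex_decay_zero:
  assumes "M \<in> carrier_mat N N" shows "complex_decay \<sigma> N M (0\<^sub>v N)"
  unfolding complex_decay_def using assms
  by (auto intro!: exI[of _ "\<lambda>_. 0\<^sub>v N"] exI[of _ "0::real"] exI[of _ "1::real"])

lemma complex_decay_smult:
  assumes M: "M \<in> carrier_mat N N" and v: "complex_decay \<sigma> N M v"
  shows "complex_decay \<sigma> N M (c \<cdot>\<^sub>v v)"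
proof -
  from v obtain W C \<mu> where W: "\<And>t. W t \<in> carrier_vec N" "W 0 = v" "v \<in> carrier_vec N"
    "\<And>t i. i < N \<Longrightarrow> ((\<lambda>s. W s $ i) has_vector_derivative (M *\<^sub>v W t) $ i) (at t)"
    and C: "0 \<le> C" "0 < \<mu>" "\<And>t i. 0 \<le> \<sigma> * t \<Longrightarrow> i < N \<Longrightarrow> cmod (W t $ i) \<le> C * exp (- \<mu> * (\<sigma> * t))"
    unfolding complex_decay_def by blast
  have "((\<lambda>s. (c \<cdot>\<^sub>v W s) $ i) has_vector_derivative (M *\<^sub>v (c \<cdot>\<^sub>v W t)) $ i) (at t)" if "i < N" for t i
  proof -
    have "M *\<^sub>v (c \<cdot>\<^sub>v W t) = c \<cdot>\<^sub>v (M *\<^sub>v W t)" using M W(1) by (rule mult_mat_vec)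
    then show ?thesis
      using has_vector_derivative_mult_right[OF W(4)[OF that], of c] that M carrier_vecD[OF W(1)]
      by (simp add: scalar_prod_def)
  qed
  moreover have "cmod ((c \<cdot>\<^sub>v W t) $ i) \<le> (cmod c * C) * exp (- \<mu> * (\<sigma> * t))" if "0 \<le> \<sigma> * t" "i < N" for t i
    using mult_left_mono[OF C(3)[OF that], of "cmod c"] that carrier_vecD[OF W(1)]
    by (simp add: norm_mult mult.assoc)
  ultimately show ?thesis
    unfolding complex_decay_def using W C
    by (intro conjI exI[of _ "\<lambda>t. c \<cdot>\<^sub>v W t"] exI[of _ "cmod c * C"] exI[of _ \<mu>]) auto
qed

lemma complex_decay_add:
  assumes M: "M \<in> carrier_mat N N" and v: "complex_decay \<sigma> N M v" and v': "complex_decay \<sigma> N M v'"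
  shows "complex_decay \<sigma> N M (v + v')"
proof -
  from v obtain W C \<mu> where W: "\<And>t. W t \<in> carrier_vec N" "W 0 = v" "v \<in> carrier_vec N"
    "\<And>t i. i < N \<Longrightarrow> ((\<lambda>s. W s $ i) has_vector_derivative (M *\<^sub>v W t) $ i) (at t)"
    and C: "0 \<le> C" "0 < \<mu>" "\<And>t i. 0 \<le> \<sigma> * t \<Longrightarrow> i < N \<Longrightarrow> cmod (W t $ i) \<le> C * exp (- \<mu> * (\<sigma> * t))"
    unfolding complex_decay_def by blast
  from v' obtain W' C' \<mu>' where W': "\<And>t. W' t \<in> carrier_vec N" "W' 0 = v'" "v' \<in> carrier_vec N"
    "\<And>t i. i < N \<Longrightarrow> ((\<lambda>s. W' s $ i) has_vector_derivative (M *\<^sub>v W' t) $ i) (at t)"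
    and C': "0 \<le> C'" "0 < \<mu>'" "\<And>t i. 0 \<le> \<sigma> * t \<Longrightarrow> i < N \<Longrightarrow> cmod (W' t $ i) \<le> C' * exp (- \<mu>' * (\<sigma> * t))"
    unfolding complex_decay_def by blast
  have "((\<lambda>s. (W s + W' s) $ i) has_vector_derivative (M *\<^sub>v (W t + W' t)) $ i) (at t)" if "i < N" for t i
  proof -
    have "M *\<^sub>v (W t + W' t) = M *\<^sub>v W t + M *\<^sub>v W' t"
      using M W(1) W'(1) by (rule mult_add_distrib_mat_vec)
    then show ?thesis
      using has_vector_derivative_add[OF W(4)[OF that] W'(4)[OF that]] that M
        carrier_vecD[OF W(1)] carrier_vecD[OF W'(1)]
      by (simp add: scalar_prod_def)
  qed
  moreover have "cmod ((W t + W' t) $ i) \<le> (C + C') * exp (- min \<mu> \<mu>' * (\<sigma> * t))"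
    if t: "0 \<le> \<sigma> * t" and i: "i < N" for t i
  proof -
    have "cmod ((W t + W' t) $ i) \<le> cmod (W t $ i) + cmod (W' t $ i)"
      using i carrier_vecD[OF W(1)] carrier_vecD[OF W'(1)] by (simp add: norm_triangle_ineq)
    also have "\<dots> \<le> C * exp (- \<mu> * (\<sigma> * t)) + C' * exp (- \<mu>' * (\<sigma> * t))"
      by (intro add_mono C(3) C'(3) t i)
    also have "\<dots> \<le> C * exp (- min \<mu> \<mu>' * (\<sigma> * t)) + C' * exp (- min \<mu> \<mu>' * (\<sigma> * t))"
      using t C C' by (intro add_mono mult_left_mono) (auto intro!: mult_right_mono)
    finally show ?thesis by (simp add: distrib_right)
  qed
  ultimately show ?thesis
    unfolding complex_decay_def using W C W' C'
    by (intro conjI exI[of _ "\<lambda>t. W t + W' t"] exI[of _ "C + C'"] exI[of _ "min \<mu> \<mu>'"]) auto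
qed

text \<open>Differentiating a truncated exponential sum shifts its coefficients and loses one term.
  \<open>c N = 0\<close>, which expresses nilpotency in the application, allows the shifted sum to
  be written with the old range.\<close>

lemma sum_shift_taylor:
  fixes c :: "nat \<Rightarrow> complex"
  assumes "c N = 0"
  shows "(\<Sum>k<N. of_nat k * t ^ (k - 1) / fact k * c k) = (\<Sum>k<N. t ^ k / fact k * c (Suc k))"
proof (cases N)
  case (Suc K)
  have *: "of_nat (Suc k) * t ^ k / fact (Suc k) = t ^ k / (fact k :: complex)" for k
    unfolding fact_Suc of_nat_mult[symmetric]
    by (simp del: of_nat_Suc of_nat_mult add: field_simps)
  have "(\<Sum>k<N. of_nat k * t ^ (k - 1) / fact k * c k)
     = (\<Sum>k<K. of_nat (Suc k) * t ^ k / fact (Suc k) * c (Suc k))"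
    unfolding Suc by (subst sum.lessThan_Suc_shift) (simp del: of_nat_Suc fact_Suc)
  also have "\<dots> = (\<Sum>k<N. t ^ k / fact k * c (Suc k))"
    unfolding * using assms by (simp add: Suc)
  finally show ?thesis .
qed simp

text \<open>The solution is exp(zt) times the exponential of the nilpotent part, a polynomial in t
  because (M - z)^N v = 0. Half of the rate |Re z| is sacrificed to dominate the polynomial.\<close>

lemma complex_decay_generalized_eigenvector:
  fixes M :: "complex Matrix.mat"
  assumes M: "M \<in> carrier_mat N N" and v: "v \<in> mat_kernel (char_matrix M z ^\<^sub>m N)"
    and \<sigma>: "\<bar>\<sigma>\<bar> = 1" and z: "\<sigma> * Re z < 0"
  shows "complex_decay \<sigma> N M v"
proof -
  let ?K = "char_matrix M z"
  have K: "?K \<in> carrier_mat N N" using M by simp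
  have Kp: "?K ^\<^sub>m k \<in> carrier_mat N N" for k using K by (rule pow_carrier_mat)
  have vc: "v \<in> carrier_vec N" and KN: "?K ^\<^sub>m N *\<^sub>v v = 0\<^sub>v N" using mat_kernelD[OF Kp v] by auto
  define c where "c k = ?K ^\<^sub>m k *\<^sub>v v" for k
  have c: "c k \<in> carrier_vec N" for k unfolding c_def by (rule mult_mat_vec_carrier[OF Kp vc])
  have cN: "c N = 0\<^sub>v N" by (simp add: c_def KN)
  have cSuc: "c (Suc k) = ?K *\<^sub>v c k" for k
  proof -
    have "?K ^\<^sub>m Suc k = ?K * ?K ^\<^sub>m k" by (rule pow_mat_Suc_left[OF K])
    then show ?thesis unfolding c_def using assoc_mult_mat_vec[OF K Kp vc] by simp
  qed
  have c0: "c 0 = v" using K vc by (simp add: c_def)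
  define W where "W t = Matrix.vec N (\<lambda>i. exp (z * of_real t) *
     (\<Sum>k<N. of_real t ^ k / fact k * c k $ i))" for t :: real
  have W: "W t \<in> carrier_vec N" for t by (simp add: W_def)
  have MW: "(M *\<^sub>v W t) $ i = z * W t $ i + (?K *\<^sub>v W t) $ i" if "i < N" for i t
  proof -
    have "(?K *\<^sub>v W t) $ i = (\<Sum>j<N. M $$ (i,j) * W t $ j + (if j = i then - z * W t $ j else 0))"
      unfolding mult_mat_vec_index_sum[OF K W that]
      using M that by (intro sum.cong refl) (auto simp: char_matrix_def algebra_simps)
    also have "\<dots> = (M *\<^sub>v W t) $ i - z * W t $ i"
      unfolding mult_mat_vec_index_sum[OF M W that] using that by (simp add: sum.distrib)
    finally show ?thesis by simp
  qed
  have KW: "(?K *\<^sub>v W t) $ i = exp (z * of_real t) * (\<Sum>k<N. of_real t ^ k / fact k * c (Suc k) $ i)"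
    if "i < N" for i t
  proof -
    have "(?K *\<^sub>v W t) $ i = (\<Sum>j<N. ?K $$ (i,j) * (exp (z * of_real t) *
       (\<Sum>k<N. of_real t ^ k / fact k * c k $ j)))"
      unfolding mult_mat_vec_index_sum[OF K W that] by (simp add: W_def)
    also have "\<dots> = exp (z * of_real t) * (\<Sum>k<N. of_real t ^ k / fact k * (\<Sum>j<N. ?K $$ (i,j) * c k $ j))"
      unfolding sum_distrib_left by (subst sum.swap) (simp add: mult_ac)
    finally show ?thesis unfolding cSuc mult_mat_vec_index_sum[OF K c that] .
  qed
  have dW: "((\<lambda>s. W s $ i) has_vector_derivative (M *\<^sub>v W t) $ i) (at t)" if i: "i < N" for t i
  proof -
    \<comment> \<open>Differentiated as a function of a complex variable and then restricted to the
      real line.\<close>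
    let ?f = "\<lambda>w. exp (z * w) * (\<Sum>k<N. w ^ k / fact k * c k $ i)"
    have "(?f has_field_derivative
       z * exp (z * of_real t) * (\<Sum>k<N. of_real t ^ k / fact k * c k $ i)
       + exp (z * of_real t) * (\<Sum>k<N. of_nat k * of_real t ^ (k - 1) / fact k * c k $ i)) (at (of_real t))"
      by (auto intro!: derivative_eq_intros simp: algebra_simps)
    also have "(\<Sum>k<N. of_nat k * of_real t ^ (k - 1) / fact k * c k $ i)
      = (\<Sum>k<N. of_real t ^ k / fact k * c (Suc k) $ i)"
      by (rule sum_shift_taylor) (simp add: cN i)
    finally have "(?f has_field_derivative (M *\<^sub>v W t) $ i) (at (of_real t))"
      unfolding MW[OF i] KW[OF i] using i by (simp add: W_def mult.assoc)
    from has_vector_derivative_real_field[OF this, of UNIV] show ?thesis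
      using i by (simp add: W_def)
  qed
  define a where "a = - (\<sigma> * Re z)"
  have a: "0 < a" using z by (simp add: a_def)
  \<comment> \<open>From t^k / k! = (2/a)^k (a t/2)^k / k! \<le> (2/a)^k exp(a t/2), with \<sigma> t
    in the place of t.\<close>
  define C where "C = (\<Sum>k<N. (2 / a) ^ k * (\<Sum>j<N. cmod (c k $ j)))"
  have C: "0 \<le> C" unfolding C_def using a by (intro sum_nonneg mult_nonneg_nonneg) (auto intro: sum_nonneg)
  have bound: "cmod (W t $ i) \<le> C * exp (- (a / 2) * (\<sigma> * t))" if t: "0 \<le> \<sigma> * t" and i: "i < N" for t i
  proof -
    have abst: "\<bar>t\<bar> = \<sigma> * t" using \<sigma> t by (auto simp: abs_if split: if_splits)
    have "\<sigma> * \<sigma> = 1" using \<sigma> by (auto simp: abs_if split: if_splits)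
    then have "Re z * t = - a * (\<sigma> * t)" unfolding a_def by (simp add: algebra_simps) algebra
    then have ez: "cmod (exp (z * of_real t)) = exp (- a * (\<sigma> * t))" by simp
    have "cmod (W t $ i) \<le> exp (- a * (\<sigma> * t)) * (\<Sum>k<N. cmod (of_real t ^ k / fact k * c k $ i))"
      using i ez by (simp add: W_def norm_mult) (rule norm_sum)
    also have "\<dots> \<le> exp (- a * (\<sigma> * t)) * (\<Sum>k<N. ((2 / a) ^ k * exp (a / 2 * (\<sigma> * t))) * (\<Sum>j<N. cmod (c k $ j)))"
    proof (intro mult_left_mono sum_mono)
      fix k
      have "cmod (of_real t ^ k / fact k) = (\<sigma> * t) ^ k / fact k"
        by (simp add: norm_divide norm_power abst)
      also have "\<dots> = (2 / a) ^ k * ((a / 2 * (\<sigma> * t)) ^ k / fact k)"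
        using a by (simp add: power_mult_distrib power_divide)
      also have "\<dots> \<le> (2 / a) ^ k * exp (a / 2 * (\<sigma> * t))"
        using a t by (intro mult_left_mono pow_div_fact_le_exp) auto
      finally have "cmod (of_real t ^ k / fact k) \<le> (2 / a) ^ k * exp (a / 2 * (\<sigma> * t))" .
      moreover have "cmod (c k $ i) \<le> (\<Sum>j<N. cmod (c k $ j))"
        using i by (intro member_le_sum) auto
      ultimately show "cmod (of_real t ^ k / fact k * c k $ i)
          \<le> ((2 / a) ^ k * exp (a / 2 * (\<sigma> * t))) * (\<Sum>j<N. cmod (c k $ j))"
        unfolding norm_mult using a by (intro mult_mono) auto
    qed auto
    also have "\<dots> = C * (exp (- a * (\<sigma> * t)) * exp (a / 2 * (\<sigma> * t)))"
      unfolding C_def sum_distrib_left sum_distrib_right by (simp add: mult_ac)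
    also have "exp (- a * (\<sigma> * t)) * exp (a / 2 * (\<sigma> * t)) = exp (- (a / 2) * (\<sigma> * t))"
      unfolding exp_add[symmetric] by (simp add: algebra_simps)
    finally show ?thesis .
  qed
  have "W 0 = v"
  proof (rule eq_vecI)
    fix i assume "i < dim_vec v"
    then have i: "i < N" using vc by simp
    then obtain K where K: "N = Suc K" by (cases N) auto
    have "(\<Sum>k<N. 0 ^ k / fact k * c k $ i) = c 0 $ i"
      unfolding K by (subst sum.lessThan_Suc_shift) simp
    then show "W 0 $ i = v $ i" using i by (simp add: W_def c0)
  qed (use vc W in auto)
  with W dW C a bound vc show ?thesis
    unfolding complex_decay_def
    by (intro conjI exI[of _ W] exI[of _ C] exI[of _ "a / 2"]) auto
qed

text \<open>Initial vectors of decaying solutions form a subspace, so decay only has to be checked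
  on the generalized eigenvectors that span.\<close>

lemma complex_decay_span:
  fixes M :: "complex Matrix.mat"
  assumes M: "M \<in> carrier_mat N N" and S: "\<And>v. v \<in> S \<Longrightarrow> complex_decay \<sigma> N M v"
    and v: "v \<in> LinearCombinations.module.span class_ring (module_vec TYPE(complex) N) S"
  shows "complex_decay \<sigma> N M v"
proof -
  interpret vec_space "TYPE(complex)" N .
  have "submodule class_ring {v. complex_decay \<sigma> N M v} V"
    unfolding submodule_def
    using complex_decay_add[OF M] complex_decay_smult[OF M] complex_decay_zero[OF M, of \<sigma>] module_axioms
    by (auto simp: module_vec_simps complex_decay_def)
  from span_is_subset[OF _ this, of S] S v show ?thesis by auto
qed

text \<open>Constant and rate are arguments here, so that a single pair can serve a finite family of
  solutions.\<close>

definition real_decay :: "real \<Rightarrow> nat \<Rightarrow> real Matrix.mat \<Rightarrow> (real \<Rightarrow> real Matrix.vec) \<Rightarrow> real \<Rightarrow> real \<Rightarrow> bool" where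
  "real_decay \<sigma> N A Z C \<mu> \<longleftrightarrow> (\<forall>t. Z t \<in> carrier_vec N)
     \<and> (\<forall>t. \<forall>i<N. ((\<lambda>s. Z s $ i) has_real_derivative (A *\<^sub>v Z t) $ i) (at t))
     \<and> (\<forall>t. 0 \<le> \<sigma> * t \<longrightarrow> (\<forall>i<N. \<bar>Z t $ i\<bar> \<le> C * exp (- \<mu> * (\<sigma> * t))))"

text \<open>\<open>A\<close> is real, so the real part of a complex solution started at a real
  vector solves the same equation with the same start, and taking real parts does not increase
  moduli.\<close>

lemma spectral_subspace_decay:
  fixes A :: "real Matrix.mat"
  assumes A: "A \<in> carrier_mat N N" and v: "v \<in> spectral_subspace A \<Omega>"
    and \<sigma>: "\<bar>\<sigma>\<bar> = 1" and \<Omega>: "\<And>z. z \<in> \<Omega> \<Longrightarrow> \<sigma> * Re z < 0"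
  shows "v \<in> carrier_vec N" "\<exists>Z C \<mu>. 0 \<le> C \<and> 0 < \<mu> \<and> Z 0 = v \<and> real_decay \<sigma> N A Z C \<mu>"
proof -
  let ?A = "map_mat complex_of_real A"
  have M: "?A \<in> carrier_mat N N" using A by simp
  have dimA: "dim_row A = N" using A by simp
  show vc: "v \<in> carrier_vec N" using v A by (auto simp: spectral_subspace_def Let_def)
  have "complex_decay \<sigma> N ?A (map_vec complex_of_real v)"
  proof (rule complex_decay_span[OF M])
    show "map_vec complex_of_real v \<in> LinearCombinations.module.span class_ring (module_vec TYPE(complex) N)
           (\<Union>z \<in> {z \<in> \<Omega>. eigenvalue ?A z}. mat_kernel (char_matrix ?A z ^\<^sub>m N))"
      using v unfolding spectral_subspace_def Let_def dimA by blast
  qed (use complex_decay_generalized_eigenvector[OF M _ \<sigma>] \<Omega> in blast)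
  then obtain W C \<mu> where W: "\<And>t. W t \<in> carrier_vec N" "W 0 = map_vec complex_of_real v"
    "\<And>t i. i < N \<Longrightarrow> ((\<lambda>s. W s $ i) has_vector_derivative (?A *\<^sub>v W t) $ i) (at t)"
    and C: "0 \<le> C" "0 < \<mu>" "\<And>t i. 0 \<le> \<sigma> * t \<Longrightarrow> i < N \<Longrightarrow> cmod (W t $ i) \<le> C * exp (- \<mu> * (\<sigma> * t))"
    unfolding complex_decay_def by blast
  define Z where "Z t = map_vec Re (W t)" for t
  have Z: "Z t \<in> carrier_vec N" for t using W(1) by (simp add: Z_def)
  have "((\<lambda>s. Z s $ i) has_real_derivative (A *\<^sub>v Z t) $ i) (at t)" if i: "i < N" for t i
  proof -
    have "((\<lambda>s. Re (W s $ i)) has_vector_derivative Re ((?A *\<^sub>v W t) $ i)) (at t)"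
      using bounded_linear.has_vector_derivative[OF bounded_linear_Re W(3)[OF i]] .
    moreover have "Re ((?A *\<^sub>v W t) $ i) = (A *\<^sub>v Z t) $ i"
      unfolding mult_mat_vec_index_sum[OF M W(1) i] mult_mat_vec_index_sum[OF A Z i]
      using A i carrier_vecD[OF W(1)] by (simp add: Z_def)
    ultimately show ?thesis
      using i carrier_vecD[OF W(1)] by (simp add: Z_def has_real_derivative_iff_has_vector_derivative)
  qed
  moreover have "\<bar>Z t $ i\<bar> \<le> C * exp (- \<mu> * (\<sigma> * t))" if "0 \<le> \<sigma> * t" "i < N" for t i
    using order.trans[OF abs_Re_le_cmod C(3)[OF that]] that carrier_vecD[OF W(1)] by (simp add: Z_def)
  moreover have "Z 0 = v" using vc by (intro eq_vecI) (auto simp: Z_def W(2))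
  ultimately show "\<exists>Z C \<mu>. 0 \<le> C \<and> 0 < \<mu> \<and> Z 0 = v \<and> real_decay \<sigma> N A Z C \<mu>"
    using C Z unfolding real_decay_def by blast
qed

lemma real_decay_uniform:
  assumes "\<And>j. j < (n::nat) \<Longrightarrow> \<exists>Z C \<mu>. 0 \<le> C \<and> 0 < \<mu> \<and> Z 0 = v j \<and> real_decay \<sigma> N A Z C \<mu>"
  obtains Z C \<mu> where "0 \<le> C" "0 < \<mu>" "\<And>j. j < n \<Longrightarrow> Z j 0 = v j" "\<And>j. j < n \<Longrightarrow> real_decay \<sigma> N A (Z j) C \<mu>"
proof -
  obtain Z C \<mu> where *: "\<And>j. j < n \<Longrightarrow> 0 \<le> C j \<and> 0 < \<mu> j \<and> Z j 0 = v j \<and> real_decay \<sigma> N A (Z j) (C j) (\<mu> j)"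
    using assms by metis
  define c where "c = (\<Sum>j<n. C j)"
  \<comment> \<open>The inserted 1 keeps the minimum meaningful when n = 0.\<close>
  define m where "m = Min (insert 1 (\<mu> ` {..<n}))"
  have m: "0 < m" unfolding m_def using * by (subst Min_gr_iff) auto
  have mj: "m \<le> \<mu> j" if "j < n" for j unfolding m_def using that by (intro Min_le) auto
  have cj: "C j \<le> c" if "j < n" for j unfolding c_def using that * by (intro member_le_sum) auto
  have "real_decay \<sigma> N A (Z j) c m" if j: "j < n" for j
    unfolding real_decay_def
  proof (intro conjI allI impI)
    fix t i assume t: "0 \<le> \<sigma> * t" and i: "i < N"
    have "\<bar>Z j t $ i\<bar> \<le> C j * exp (- \<mu> j * (\<sigma> * t))"
      using *[OF j] t i by (simp add: real_decay_def)
    also have "\<dots> \<le> c * exp (- m * (\<sigma> * t))"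
      using mult_right_mono[OF mj[OF j] t] cj[OF j] *[OF j] by (intro mult_mono) auto
    finally show "\<bar>Z j t $ i\<bar> \<le> c * exp (- m * (\<sigma> * t))" .
  qed (use *[OF j] in \<open>auto simp: real_decay_def\<close>)
  moreover have "0 \<le> c" unfolding c_def using * by (intro sum_nonneg) auto
  ultimately show ?thesis using that[of c m Z] m * by blast
qed

lemma linear_ode_solutions_lincomb:
  fixes A :: "real Matrix.mat"
  assumes A: "A \<in> carrier_mat n n" and "Z \<in> linear_ode_solutions A T" "Z' \<in> linear_ode_solutions A T"
  shows "(\<lambda>t\<in>{0..T}. Z t + c \<cdot>\<^sub>v Z' t) \<in> linear_ode_solutions A T"
proof -
  have Z: "\<And>t. t \<in> {0..T} \<Longrightarrow> Z t \<in> carrier_vec n" "\<And>t. t \<in> {0..T} \<Longrightarrow> Z' t \<in> carrier_vec n"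
    using assms linear_ode_solutions_carrier by fastforce+
  have "((\<lambda>s. (\<lambda>t\<in>{0..T}. Z t + c \<cdot>\<^sub>v Z' t) s $ i) has_real_derivative
      (A *\<^sub>v ((\<lambda>t\<in>{0..T}. Z t + c \<cdot>\<^sub>v Z' t) t)) $ i) (at t within {0..T})"
    if t: "t \<in> {0..T}" and i: "i < n" for t i
  proof -
    have "((\<lambda>s. Z s $ i + c * Z' s $ i) has_real_derivative
        (A *\<^sub>v Z t) $ i + c * (A *\<^sub>v Z' t) $ i) (at t within {0..T})"
      using assms t i by (auto intro!: derivative_eq_intros simp: linear_ode_solutions_def)
    also have "(A *\<^sub>v Z t) $ i + c * (A *\<^sub>v Z' t) $ i = (A *\<^sub>v (Z t + c \<cdot>\<^sub>v Z' t)) $ i"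
      using mult_add_distrib_mat_vec[OF A Z(1)[OF t], of "c \<cdot>\<^sub>v Z' t"] mult_mat_vec[OF A Z(2)[OF t], of c]
        Z(1,2)[OF t] A i by simp
    finally have D: "((\<lambda>s. Z s $ i + c * Z' s $ i) has_real_derivative
        (A *\<^sub>v (Z t + c \<cdot>\<^sub>v Z' t)) $ i) (at t within {0..T})" .
    have ag: "(\<lambda>t\<in>{0..T}. Z t + c \<cdot>\<^sub>v Z' t) s $ i = Z s $ i + c * Z' s $ i" if "s \<in> {0..T}" for s
      using Z(1,2)[OF that] that i by simp
    show ?thesis using has_real_derivative_agree[OF D t ag] t by simp
  qed
  then show ?thesis
    unfolding linear_ode_solutions_def using A Z by auto
qed

text \<open>The boundary value problem is a small perturbation of \<open>(a, b) \<mapsto> C0 a + C1 b\<close>: the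
  superpositions of decaying solutions started from a basis of \<open>E\<^sup>s\<close> at \<open>0\<close> and from a basis of
  \<open>E\<^sup>u\<close> at \<open>T\<close> form an \<open>N\<close>-dimensional family, hence they exhaust the solution space.\<close>
lemma boundary_value_problem:
  fixes A :: "real Matrix.mat"
  assumes A: "A \<in> carrier_mat N N" and C0: "C0 \<in> carrier_mat N N" and C1: "C1 \<in> carrier_mat N N"
    and adm: "admissible_boundary_operator A C0 C1" and \<eta>: "\<eta> \<in> carrier_vec N"
  obtains T\<^sub>0 C \<mu> where "0 < T\<^sub>0" "0 < C" "0 < \<mu>"
    "\<And>T. T\<^sub>0 \<le> T \<Longrightarrow> \<exists>Z\<in>linear_ode_solutions A T. C0 *\<^sub>v Z 0 + C1 *\<^sub>v Z T = \<eta>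
       \<and> (\<forall>t\<in>{0..T}. \<forall>i<N. \<bar>Z t $ i\<bar> \<le> C * turnpike_weight \<mu> T t)"
    "\<And>T Z t. T\<^sub>0 \<le> T \<Longrightarrow> Z \<in> linear_ode_solutions A T \<Longrightarrow> C0 *\<^sub>v Z 0 + C1 *\<^sub>v Z T = 0\<^sub>v N
       \<Longrightarrow> t \<in> {0..T} \<Longrightarrow> Z t = 0\<^sub>v N"
proof -
  \<comment> \<open>Surjectivity in (H3) gives preimages of the unit vectors. With these as data,
    the leading part of the boundary map on coefficients is the identity matrix.\<close>
  have "\<exists>a b. a \<in> stable_subspace A \<and> b \<in> unstable_subspace A \<and> C0 *\<^sub>v a + C1 *\<^sub>v b = unit_vec N j" for j
  proof -
    have "unit_vec N j \<in> (\<lambda>(a, b). C0 *\<^sub>v a + C1 *\<^sub>v b) ` (stable_subspace A \<times> unstable_subspace A)"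
      using adm A unfolding admissible_boundary_operator_def bij_betw_def by simp
    then show ?thesis by (auto simp: image_iff) metis
  qed
  then obtain a b where ab: "\<And>j. a j \<in> stable_subspace A" "\<And>j. b j \<in> unstable_subspace A"
    "\<And>j. C0 *\<^sub>v a j + C1 *\<^sub>v b j = unit_vec N j" by metis
  have a: "a j \<in> carrier_vec N" "\<exists>Z C \<mu>. 0 \<le> C \<and> 0 < \<mu> \<and> Z 0 = a j \<and> real_decay 1 N A Z C \<mu>" for j
    using spectral_subspace_decay[OF A ab(1)[unfolded stable_subspace_def], of 1 j] by auto
  have b: "b j \<in> carrier_vec N" "\<exists>Z C \<mu>. 0 \<le> C \<and> 0 < \<mu> \<and> Z 0 = b j \<and> real_decay (-1) N A Z C \<mu>" for j
    using spectral_subspace_decay[OF A ab(2)[unfolded unstable_subspace_def], of "-1" j] by auto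
  obtain Za Ca \<mu>a where Ca: "0 \<le> Ca" "0 < \<mu>a" and Za0: "\<And>j. j < N \<Longrightarrow> Za j 0 = a j"
    and Za: "\<And>j. j < N \<Longrightarrow> real_decay 1 N A (Za j) Ca \<mu>a"
    by (rule real_decay_uniform[of N a 1 N A, OF a(2)]) (rule that)
  obtain Zb Cb \<mu>b where Cb: "0 \<le> Cb" "0 < \<mu>b" and Zb0: "\<And>j. j < N \<Longrightarrow> Zb j 0 = b j"
    and Zb: "\<And>j. j < N \<Longrightarrow> real_decay (-1) N A (Zb j) Cb \<mu>b"
    by (rule real_decay_uniform[of N b "-1" N A, OF b(2)]) (rule that)
  define \<mu> where "\<mu> = min \<mu>a \<mu>b"
  define K where "K = Ca + Cb"
  have \<mu>: "0 < \<mu>" and K: "0 \<le> K" using Ca Cb by (auto simp: \<mu>_def K_def)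
  have Zac: "Za j t \<in> carrier_vec N" and Zbc: "Zb j t \<in> carrier_vec N" if "j < N" for j t
    using Za[OF that] Zb[OF that] by (auto simp: real_decay_def)
  have Zab: "\<bar>Za j t $ i\<bar> \<le> K * exp (- \<mu> * t)" if "j < N" "i < N" "0 \<le> t" for i j t
  proof -
    have "\<bar>Za j t $ i\<bar> \<le> Ca * exp (- \<mu>a * t)" using Za[OF that(1)] that by (simp add: real_decay_def)
    also have "\<dots> \<le> K * exp (- \<mu> * t)"
      using Ca Cb that mult_right_mono[of \<mu> \<mu>a t] by (intro mult_mono) (auto simp: K_def \<mu>_def)
    finally show ?thesis .
  qed
  have Zbb: "\<bar>Zb j (- t) $ i\<bar> \<le> K * exp (- \<mu> * t)" if "j < N" "i < N" "0 \<le> t" for i j t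
  proof -
    have "\<forall>t. 0 \<le> - 1 * t \<longrightarrow> (\<forall>i<N. \<bar>Zb j t $ i\<bar> \<le> Cb * exp (- \<mu>b * (- 1 * t)))"
      using Zb[OF that(1)] unfolding real_decay_def by blast
    from spec[OF this, of "- t"] have "\<bar>Zb j (- t) $ i\<bar> \<le> Cb * exp (- \<mu>b * t)" using that by simp
    also have "\<dots> \<le> K * exp (- \<mu> * t)"
      using Ca Cb that mult_right_mono[of \<mu> \<mu>b t] by (intro mult_mono) (auto simp: K_def \<mu>_def)
    finally show ?thesis .
  qed
  define c0 where "c0 = (\<Sum>i<N. \<Sum>l<N. \<bar>C0 $$ (i,l)\<bar> + \<bar>C1 $$ (i,l)\<bar>)"
  have c0: "0 \<le> c0" unfolding c0_def by (intro sum_nonneg) auto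
  \<comment> \<open>\<Delta> collects the cross terms: the backward family seen at 0, a distance T
    before its data, and the forward family seen at T. Both are of order exp(-\<mu> T).\<close>
  define \<Delta> where "\<Delta> T = Matrix.mat N N (\<lambda>(i,j). (C0 *\<^sub>v Zb j (-T) + C1 *\<^sub>v Za j T) $ i)" for T
  have \<Delta>c: "\<Delta> T \<in> carrier_mat N N" for T by (simp add: \<Delta>_def)
  have \<Delta>: "(\<Sum>i<N. \<bar>\<Delta> T $$ (i,j)\<bar>) \<le> c0 * K * exp (- \<mu> * T)" if "j < N" "0 \<le> T" for j T
  proof -
    have "\<bar>\<Delta> T $$ (i,j)\<bar> \<le> (\<Sum>l<N. (\<bar>C0 $$ (i,l)\<bar> + \<bar>C1 $$ (i,l)\<bar>) * (K * exp (- \<mu> * T)))" if "i < N" for i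
    proof -
      have "\<Delta> T $$ (i,j) = (\<Sum>l<N. C0 $$ (i,l) * Zb j (-T) $ l + C1 $$ (i,l) * Za j T $ l)"
        using \<open>i < N\<close> \<open>j < N\<close> C1 mult_mat_vec_index_sum[OF C0 Zbc[OF \<open>j < N\<close>] \<open>i < N\<close>]
          mult_mat_vec_index_sum[OF C1 Zac[OF \<open>j < N\<close>] \<open>i < N\<close>]
        by (simp add: \<Delta>_def sum.distrib del: index_mult_mat_vec)
      also have "\<bar>\<dots>\<bar> \<le> (\<Sum>l<N. \<bar>C0 $$ (i,l)\<bar> * \<bar>Zb j (-T) $ l\<bar> + \<bar>C1 $$ (i,l)\<bar> * \<bar>Za j T $ l\<bar>)"
        by (intro order.trans[OF sum_abs] sum_mono) (metis abs_triangle_ineq abs_mult)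
      also have "\<dots> \<le> (\<Sum>l<N. \<bar>C0 $$ (i,l)\<bar> * (K * exp (- \<mu> * T)) + \<bar>C1 $$ (i,l)\<bar> * (K * exp (- \<mu> * T)))"
        using Zab[OF \<open>j < N\<close> _ \<open>0 \<le> T\<close>] Zbb[OF \<open>j < N\<close> _ \<open>0 \<le> T\<close>]
        by (intro sum_mono add_mono mult_left_mono) auto
      finally show ?thesis by (simp add: distrib_right)
    qed
    then have "(\<Sum>i<N. \<bar>\<Delta> T $$ (i,j)\<bar>)
      \<le> (\<Sum>i<N. \<Sum>l<N. (\<bar>C0 $$ (i,l)\<bar> + \<bar>C1 $$ (i,l)\<bar>) * (K * exp (- \<mu> * T)))"
      by (intro sum_mono) auto
    then show ?thesis unfolding c0_def by (simp only: sum_distrib_right mult.assoc)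
  qed
  \<comment> \<open>Chosen so that c0 K exp(-\<mu> T) \<le> 1/2 from there on; the + 1 keeps the
    argument of the logarithm positive if c0 K = 0.\<close>
  define T\<^sub>0 where "T\<^sub>0 = max 1 (ln (2 * (c0 * K + 1)) / \<mu>)"
  have T0: "0 < T\<^sub>0" by (simp add: T\<^sub>0_def)
  have half: "c0 * K * exp (- \<mu> * T) \<le> 1 / 2" if "T\<^sub>0 \<le> T" for T
  proof -
    have "ln (2 * (c0 * K + 1)) \<le> \<mu> * T" using that \<mu> by (simp add: T\<^sub>0_def field_simps)
    then have "exp (ln (2 * (c0 * K + 1))) \<le> exp (\<mu> * T)" by simp
    moreover have "0 < 2 * (c0 * K + 1)" using mult_nonneg_nonneg[OF c0 K] by simp
    ultimately have "2 * (c0 * K + 1) \<le> exp (\<mu> * T)" by (simp only: exp_ln)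
    then have "c0 * K \<le> exp (\<mu> * T) / 2" by simp
    then show ?thesis by (simp add: exp_minus field_simps)
  qed
  define \<Psi> where "\<Psi> T = 1\<^sub>m N + \<Delta> T" for T
  have \<Psi>c: "\<Psi> T \<in> carrier_mat N N" for T using \<Delta>c by (simp add: \<Psi>_def)
  \<comment> \<open>In the l1 norm the column sums of \<Delta> bound its operator norm by 1/2, so 1
    + \<Delta> shrinks no vector below half its length.\<close>
  have coercive: "(\<Sum>i<N. \<bar>c $ i\<bar>) \<le> 2 * (\<Sum>i<N. \<bar>(\<Psi> T *\<^sub>v c) $ i\<bar>)" if c: "c \<in> carrier_vec N" and T: "T\<^sub>0 \<le> T" for c T
  proof -
    have T': "0 \<le> T" using T T0 by simp
    have e: "(\<Psi> T *\<^sub>v c) $ i = c $ i + (\<Delta> T *\<^sub>v c) $ i" if "i < N" for i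
      using that c \<Delta>c[of T] add_mult_distrib_mat_vec[OF one_carrier_mat \<Delta>c[of T] c] by (simp add: \<Psi>_def)
    have "(\<Sum>i<N. \<bar>(\<Delta> T *\<^sub>v c) $ i\<bar>) \<le> (\<Sum>i<N. \<Sum>j<N. \<bar>\<Delta> T $$ (i,j)\<bar> * \<bar>c $ j\<bar>)"
      using mult_mat_vec_index_sum[OF \<Delta>c c]
      by (intro sum_mono) (auto simp: abs_mult[symmetric] simp del: index_mult_mat_vec intro!: sum_abs)
    also have "\<dots> = (\<Sum>j<N. (\<Sum>i<N. \<bar>\<Delta> T $$ (i,j)\<bar>) * \<bar>c $ j\<bar>)"
      by (subst sum.swap) (simp add: sum_distrib_right)
    also have "\<dots> \<le> (\<Sum>j<N. 1 / 2 * \<bar>c $ j\<bar>)"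
      by (intro sum_mono mult_right_mono order.trans[OF \<Delta>[OF _ T'] half[OF T]]) auto
    also have "\<dots> = (\<Sum>j<N. \<bar>c $ j\<bar>) / 2" by (simp add: sum_divide_distrib)
    finally have 1: "(\<Sum>i<N. \<bar>(\<Delta> T *\<^sub>v c) $ i\<bar>) \<le> (\<Sum>j<N. \<bar>c $ j\<bar>) / 2" .
    have "(\<Sum>i<N. \<bar>c $ i\<bar>) \<le> (\<Sum>i<N. \<bar>(\<Psi> T *\<^sub>v c) $ i\<bar> + \<bar>(\<Delta> T *\<^sub>v c) $ i\<bar>)"
      by (intro sum_mono) (simp add: e del: index_mult_mat_vec)
    with 1 show ?thesis by (simp add: sum.distrib)
  qed
  have \<Psi>inj: "c = 0\<^sub>v N" if "c \<in> carrier_vec N" "T\<^sub>0 \<le> T" "\<Psi> T *\<^sub>v c = 0\<^sub>v N" for c T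
  proof -
    have "(\<Sum>i<N. \<bar>c $ i\<bar>) \<le> 0" using coercive[OF that(1,2)] that(3) by simp
    then have "\<forall>i\<in>{..<N}. \<bar>c $ i\<bar> = 0"
      by (subst sum_nonneg_eq_0_iff[symmetric]) (auto intro: antisym sum_nonneg)
    then show ?thesis using that(1) by (intro eq_vecI) auto
  qed
  define Y where "Y T c t = Matrix.vec N (\<lambda>i. \<Sum>j<N. c $ j * (Za j t $ i + Zb j (t - T) $ i))" for T c and t :: real
  have Yc: "Y T c t \<in> carrier_vec N" for T c t by (simp add: Y_def)
  have Ysol: "restrict (Y T c) {0..T} \<in> linear_ode_solutions A T" for T c
  proof -
    have "((\<lambda>s. Y T c s $ i) has_real_derivative (A *\<^sub>v Y T c t) $ i) (at t within {0..T})" if i: "i < N" for t i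
    proof -
      have "((\<lambda>s. \<Sum>j<N. c $ j * (Za j s $ i + Zb j (s - T) $ i)) has_real_derivative
         (\<Sum>j<N. c $ j * ((A *\<^sub>v Za j t) $ i + (A *\<^sub>v Zb j (t - T)) $ i))) (at t)"
      proof (intro DERIV_sum DERIV_cmult DERIV_add)
        fix j assume "j \<in> {..<N}"
        then have j: "j < N" by simp
        show "((\<lambda>s. Za j s $ i) has_real_derivative (A *\<^sub>v Za j t) $ i) (at t)"
          using Za[OF j] i by (simp add: real_decay_def)
        have "((\<lambda>s. Zb j s $ i) has_real_derivative (A *\<^sub>v Zb j (t - T)) $ i) (at (t - T))"
          using Zb[OF j] i by (simp add: real_decay_def)
        then show "((\<lambda>s. Zb j (s - T) $ i) has_real_derivative (A *\<^sub>v Zb j (t - T)) $ i) (at t)"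
          using DERIV_shift[of "\<lambda>s. Zb j s $ i" _ t "-T"] by simp
      qed
      also have "(\<Sum>j<N. c $ j * ((A *\<^sub>v Za j t) $ i + (A *\<^sub>v Zb j (t - T)) $ i))
         = (\<Sum>j<N. \<Sum>l<N. A $$ (i,l) * (c $ j * (Za j t $ l + Zb j (t - T) $ l)))"
      proof (rule sum.cong[OF refl])
        fix j assume "j \<in> {..<N}"
        then have j: "j < N" by simp
        show "c $ j * ((A *\<^sub>v Za j t) $ i + (A *\<^sub>v Zb j (t - T)) $ i)
           = (\<Sum>l<N. A $$ (i,l) * (c $ j * (Za j t $ l + Zb j (t - T) $ l)))"
          unfolding mult_mat_vec_index_sum[OF A Zac[OF j] i] mult_mat_vec_index_sum[OF A Zbc[OF j] i]
            sum.distrib[symmetric] sum_distrib_left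
          by (intro sum.cong refl) (simp add: algebra_simps)
      qed
      also have "\<dots> = (A *\<^sub>v Y T c t) $ i"
        unfolding mult_mat_vec_index_sum[OF A Yc i]
        by (subst sum.swap) (simp add: Y_def sum_distrib_left)
      finally show ?thesis
        using i by (auto simp: Y_def intro: has_field_derivative_at_within)
    qed
    from has_real_derivative_agree[OF this]
    have "((\<lambda>s. restrict (Y T c) {0..T} s $ i) has_real_derivative (A *\<^sub>v Y T c t) $ i) (at t within {0..T})"
      if "i < N" "t \<in> {0..T}" for i t using that by simp
    then show ?thesis
      unfolding linear_ode_solutions_def using A Yc by simp
  qed
  have Ybc: "C0 *\<^sub>v Y T c 0 + C1 *\<^sub>v Y T c T = \<Psi> T *\<^sub>v c" if c: "c \<in> carrier_vec N" for T c
  proof (rule eq_vecI)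
    fix i assume "i < dim_vec (\<Psi> T *\<^sub>v c)"
    then have i: "i < N" using \<Psi>c[of T] by simp
    have ent: "\<Psi> T $$ (i,j) = (\<Sum>l<N. C0 $$ (i,l) * (Za j 0 $ l + Zb j (-T) $ l) + C1 $$ (i,l) * (Za j T $ l + Zb j 0 $ l))"
      if j: "j < N" for j
    proof -
      have "\<Psi> T $$ (i,j) = (C0 *\<^sub>v a j + C1 *\<^sub>v b j) $ i + (C0 *\<^sub>v Zb j (-T) + C1 *\<^sub>v Za j T) $ i"
        using i j by (simp add: \<Psi>_def \<Delta>_def ab(3))
      also have "\<dots> = (C0 *\<^sub>v Za j 0) $ i + (C1 *\<^sub>v Zb j 0) $ i + (C0 *\<^sub>v Zb j (-T)) $ i + (C1 *\<^sub>v Za j T) $ i"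
        using i j C0 C1 by (simp add: Za0 Zb0 del: index_mult_mat_vec)
      finally show ?thesis
        unfolding mult_mat_vec_index_sum[OF C0 Zac[OF j] i] mult_mat_vec_index_sum[OF C1 Zac[OF j] i]
          mult_mat_vec_index_sum[OF C0 Zbc[OF j] i] mult_mat_vec_index_sum[OF C1 Zbc[OF j] i]
        by (simp add: sum.distrib algebra_simps)
    qed
    have "(C0 *\<^sub>v Y T c 0 + C1 *\<^sub>v Y T c T) $ i = (C0 *\<^sub>v Y T c 0) $ i + (C1 *\<^sub>v Y T c T) $ i"
      using i C1 by (simp del: index_mult_mat_vec)
    also have "\<dots> = (\<Sum>l<N. C0 $$ (i,l) * Y T c 0 $ l + C1 $$ (i,l) * Y T c T $ l)"
      unfolding mult_mat_vec_index_sum[OF C0 Yc i] mult_mat_vec_index_sum[OF C1 Yc i]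
      by (rule sum.distrib[symmetric])
    also have "\<dots> = (\<Sum>l<N. \<Sum>j<N. (C0 $$ (i,l) * (Za j 0 $ l + Zb j (-T) $ l) + C1 $$ (i,l) * (Za j T $ l + Zb j 0 $ l)) * c $ j)"
    proof (rule sum.cong[OF refl])
      fix l assume "l \<in> {..<N}"
      then have Y: "Y T c 0 $ l = (\<Sum>j<N. c $ j * (Za j 0 $ l + Zb j (-T) $ l))"
        "Y T c T $ l = (\<Sum>j<N. c $ j * (Za j T $ l + Zb j 0 $ l))" by (simp_all add: Y_def)
      show "C0 $$ (i,l) * Y T c 0 $ l + C1 $$ (i,l) * Y T c T $ l =
        (\<Sum>j<N. (C0 $$ (i,l) * (Za j 0 $ l + Zb j (-T) $ l) + C1 $$ (i,l) * (Za j T $ l + Zb j 0 $ l)) * c $ j)"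
        unfolding Y sum_distrib_left sum.distrib[symmetric]
        by (intro sum.cong refl) (simp add: algebra_simps)
    qed
    also have "\<dots> = (\<Sum>j<N. \<Psi> T $$ (i,j) * c $ j)"
      by (subst sum.swap) (intro sum.cong refl, simp only: ent lessThan_iff sum_distrib_right)
    finally show "(C0 *\<^sub>v Y T c 0 + C1 *\<^sub>v Y T c T) $ i = (\<Psi> T *\<^sub>v c) $ i"
      unfolding mult_mat_vec_index_sum[OF \<Psi>c c i] .
  qed (use C0 C1 \<Psi>c[of T] in auto)
  \<comment> \<open>The map from coefficients to the value at 0. It is square, so injectivity makes
    it invertible, and then every solution belongs to the family \<open>Y\<close>.\<close>
  define \<Theta> where "\<Theta> T = Matrix.mat N N (\<lambda>(l,j). Za j 0 $ l + Zb j (-T) $ l)" for T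
  have \<Theta>c: "\<Theta> T \<in> carrier_mat N N" for T by (simp add: \<Theta>_def)
  have Y0: "Y T c 0 = \<Theta> T *\<^sub>v c" if "c \<in> carrier_vec N" for T c
  proof (rule eq_vecI)
    fix i assume "i < dim_vec (\<Theta> T *\<^sub>v c)"
    then have i: "i < N" using \<Theta>c[of T] by simp
    show "Y T c 0 $ i = (\<Theta> T *\<^sub>v c) $ i"
      unfolding mult_mat_vec_index_sum[OF \<Theta>c that i] using i by (simp add: Y_def \<Theta>_def mult.commute)
  qed (use \<Theta>c[of T] in \<open>simp add: Y_def\<close>)
  define S where "S = (\<Sum>i<N. \<bar>\<eta> $ i\<bar>)"
  have S: "0 \<le> S" unfolding S_def by (intro sum_nonneg) auto
  show ?thesis
  \<comment> \<open>The coefficients have l1 norm at most 2 S, and each superposed pair of solutions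
    is at most K times the weight; the + 1 makes the constant positive.\<close>
  proof (rule that[of T\<^sub>0 "2 * S * K + 1" \<mu>])
    fix T assume T: "T\<^sub>0 \<le> T"
    obtain P where P: "P \<in> carrier_mat N N" "\<Psi> T * P = 1\<^sub>m N"
      using inverse_mat_exists[OF \<Psi>c \<Psi>inj[OF _ T]] by blast
    define c where "c = P *\<^sub>v \<eta>"
    have c: "c \<in> carrier_vec N" unfolding c_def by (rule mult_mat_vec_carrier[OF P(1) \<eta>])
    have \<Psi>: "\<Psi> T *\<^sub>v c = \<eta>"
      unfolding c_def using assoc_mult_mat_vec[OF \<Psi>c P(1) \<eta>, of T] P(2) \<eta> by simp
    have sumc: "(\<Sum>i<N. \<bar>c $ i\<bar>) \<le> 2 * S" using coercive[OF c T] by (simp add: \<Psi> S_def)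
    have bound: "\<bar>Y T c t $ i\<bar> \<le> (2 * S * K + 1) * turnpike_weight \<mu> T t" if t: "t \<in> {0..T}" and i: "i < N" for t i
    proof -
      have w: "0 \<le> turnpike_weight \<mu> T t" by (simp add: turnpike_weight_def)
      have "\<bar>Y T c t $ i\<bar> \<le> (\<Sum>j<N. \<bar>c $ j\<bar> * \<bar>Za j t $ i + Zb j (t - T) $ i\<bar>)"
        using i by (simp add: Y_def abs_mult[symmetric])
      also have "\<dots> \<le> (\<Sum>j<N. \<bar>c $ j\<bar> * (K * turnpike_weight \<mu> T t))"
      proof (intro sum_mono mult_left_mono)
        fix j assume "j \<in> {..<N}"
        then have "\<bar>Za j t $ i\<bar> \<le> K * exp (- \<mu> * t)" "\<bar>Zb j (- (T - t)) $ i\<bar> \<le> K * exp (- \<mu> * (T - t))"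
          using Zab[of j i t] Zbb[of j i "T - t"] i t by auto
        then show "\<bar>Za j t $ i + Zb j (t - T) $ i\<bar> \<le> K * turnpike_weight \<mu> T t"
          by (simp add: turnpike_weight_def distrib_left)
      qed auto
      also have "\<dots> = (\<Sum>j<N. \<bar>c $ j\<bar>) * (K * turnpike_weight \<mu> T t)" by (simp add: sum_distrib_right)
      also have "\<dots> \<le> (2 * S) * (K * turnpike_weight \<mu> T t)"
        using sumc K w by (intro mult_right_mono) auto
      also have "\<dots> \<le> (2 * S * K + 1) * turnpike_weight \<mu> T t"
        using w by (simp add: algebra_simps)
      finally show ?thesis .
    qed
    show "\<exists>Z\<in>linear_ode_solutions A T. C0 *\<^sub>v Z 0 + C1 *\<^sub>v Z T = \<eta>
       \<and> (\<forall>t\<in>{0..T}. \<forall>i<N. \<bar>Z t $ i\<bar> \<le> (2 * S * K + 1) * turnpike_weight \<mu> T t)"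
      using Ysol[of T c] Ybc[OF c, of T] \<Psi> bound T T0
      by (intro bexI[of _ "restrict (Y T c) {0..T}"]) auto
  next
    fix T Z t assume T: "T\<^sub>0 \<le> T" and Z: "Z \<in> linear_ode_solutions A T"
      and bc: "C0 *\<^sub>v Z 0 + C1 *\<^sub>v Z T = 0\<^sub>v N" and t: "t \<in> {0..T}"
    have T': "0 < T" using T T0 by simp
    have Z0: "Z 0 \<in> carrier_vec N" using linear_ode_solutions_carrier[OF Z] A T' by simp
    \<comment> \<open>A member of the family that vanishes at 0 vanishes on all of [0,T]; in
      particular its boundary value \<Psi> c does.\<close>
    have "c = 0\<^sub>v N" if c: "c \<in> carrier_vec N" and "\<Theta> T *\<^sub>v c = 0\<^sub>v N" for c
    proof -
      have "Y T c t = 0\<^sub>v N" if "t \<in> {0..T}" for t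
        using linear_ode_zero[OF A Ysol[of T c] T' _ that] that Y0[OF c] \<open>\<Theta> T *\<^sub>v c = 0\<^sub>v N\<close> by simp
      moreover have "M *\<^sub>v 0\<^sub>v N = 0\<^sub>v N" if "M \<in> carrier_mat N N" for M :: "real Matrix.mat"
        using that by (intro eq_vecI) auto
      ultimately have "\<Psi> T *\<^sub>v c = 0\<^sub>v N" using Ybc[OF c, of T] T' C0 C1 by simp
      then show ?thesis by (rule \<Psi>inj[OF c T])
    qed
    then obtain P where P: "P \<in> carrier_mat N N" "\<Theta> T * P = 1\<^sub>m N"
      using inverse_mat_exists[OF \<Theta>c] by blast
    define c where "c = P *\<^sub>v Z 0"
    have c: "c \<in> carrier_vec N" unfolding c_def by (rule mult_mat_vec_carrier[OF P(1) Z0])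
    have "\<Theta> T *\<^sub>v c = Z 0"
      unfolding c_def using assoc_mult_mat_vec[OF \<Theta>c P(1) Z0, of T] P(2) Z0 by simp
    then have "Y T c 0 = Z 0" unfolding Y0[OF c] .
    have eq: "Z s = Y T c s" if s: "s \<in> {0..T}" for s
    proof -
      have "(\<lambda>t\<in>{0..T}. Z t + (-1) \<cdot>\<^sub>v restrict (Y T c) {0..T} t) s = 0\<^sub>v N"
        using \<open>Y T c 0 = Z 0\<close> T' Z0
        by (intro linear_ode_zero[OF A linear_ode_solutions_lincomb[OF A Z Ysol] T' _ s]) auto
      then have "(Z s + (-1) \<cdot>\<^sub>v Y T c s) $ i = 0" if "i < N" for i using s that by simp
      then show ?thesis
        using linear_ode_solutions_carrier[OF Z s] A Yc[of T c s] by (intro eq_vecI) auto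
    qed
    have "\<Psi> T *\<^sub>v c = 0\<^sub>v N" using Ybc[OF c, of T] bc eq[of 0] eq[of T] T' by simp
    then have "c = 0\<^sub>v N" by (rule \<Psi>inj[OF c T])
    then show "Z t = 0\<^sub>v N" using eq[OF t] by (auto simp: Y_def)
  qed (use T0 \<mu> S K in \<open>auto intro!: add_nonneg_pos mult_nonneg_nonneg\<close>)
qed

section \<open>Square-integrable trajectories\<close>

lemma absolutely_integrable_continuous_mult:
  fixes p f :: "real \<Rightarrow> real"
  assumes "continuous_on {a..b} p" "f absolutely_integrable_on {a..b}"
  shows "(\<lambda>t. p t * f t) absolutely_integrable_on {a..b}"
  using assms by (intro absolutely_integrable_bounded_measurable_product_real
      continuous_imp_measurable_on_sets_lebesgue compact_imp_bounded compact_continuous_image) auto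

lemma integral_interval_diff:
  fixes f :: "real \<Rightarrow> real"
  assumes "f integrable_on {0..T}" "s \<in> {0..T}" "t \<in> {0..T}" "s \<le> t"
  shows "integral {0..t} f - integral {0..s} f = integral {s..t} f" "f integrable_on {s..t}"
proof -
  have "f integrable_on {0..t}" by (rule integrable_on_subinterval[OF assms(1)]) (use assms in auto)
  then show "integral {0..t} f - integral {0..s} f = integral {s..t} f"
    using Henstock_Kurzweil_Integration.integral_combine[of 0 s t f] assms by simp
  show "f integrable_on {s..t}" by (rule integrable_on_subinterval[OF assms(1)]) (use assms in auto)
qed

text \<open>The difference of the two sides, as a function of the upper limit, has derivative \<open>0\<close> everywhere
  because its increments are of order \<open>\<bar>t - s\<bar> \<integral> \<bar>f\<bar>\<close>; no differentiation theorem for \<open>L\<^sup>1\<close> is needed.\<close>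
lemma integral_by_parts_abs_continuous:
  fixes p p' f F :: "real \<Rightarrow> real"
  assumes T: "0 < T"
    and p: "\<And>t. t \<in> {0..T} \<Longrightarrow> (p has_real_derivative p' t) (at t within {0..T})"
    and p': "continuous_on {0..T} p'"
    and f: "f absolutely_integrable_on {0..T}"
    and F: "\<And>t. t \<in> {0..T} \<Longrightarrow> F t = F 0 + integral {0..t} f"
  shows "((\<lambda>t. p t * f t + p' t * F t) has_integral (p T * F T - p 0 * F 0)) {0..T}"
proof -
  have fi: "f integrable_on {0..T}" and afi: "(\<lambda>r. \<bar>f r\<bar>) integrable_on {0..T}"
    using f by (auto simp: absolutely_integrable_on_def)
  have cp: "continuous_on {0..T} p" using p by (rule DERIV_continuous_on)
  have "continuous_on {0..T} (\<lambda>t. F 0 + integral {0..t} f)"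
    by (intro continuous_intros indefinite_integral_continuous_1 fi)
  then have cF: "continuous_on {0..T} F" by (subst continuous_on_cong[OF refl F]) auto
  obtain M where "\<forall>x\<in>p' ` {0..T}. norm x \<le> M"
    using compact_imp_bounded[OF compact_continuous_image[OF p' compact_Icc]] unfolding bounded_iff by blast
  then have M: "\<bar>p' t\<bar> \<le> M" if "t \<in> {0..T}" for t using that by simp
  have M0: "0 \<le> M" using order.trans[OF abs_ge_zero M[of 0]] T by simp
  define \<Gamma> where "\<Gamma> t = integral {0..t} (\<lambda>r. \<bar>f r\<bar>)" for t
  have c\<Gamma>: "continuous_on {0..T} \<Gamma>"
    unfolding \<Gamma>_def by (intro indefinite_integral_continuous_1 afi)
  define g where "g t = p t * f t + p' t * F t" for t
  have "(\<lambda>t. p t * f t) integrable_on {0..T}"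
    using absolutely_integrable_continuous_mult[OF cp f] unfolding absolutely_integrable_on_def by blast
  moreover have "(\<lambda>t. p' t * F t) integrable_on {0..T}"
    by (intro integrable_continuous_interval continuous_intros p' cF)
  ultimately have gi: "g integrable_on {0..T}" unfolding g_def by (rule integrable_add)
  define h where "h t = p t * F t - integral {0..t} g" for t
  have inc: "\<bar>h t - h s\<bar> \<le> 2 * M * \<bar>t - s\<bar> * \<bar>\<Gamma> t - \<Gamma> s\<bar>" if s: "s \<in> {0..T}" and t: "t \<in> {0..T}" and st: "s \<le> t" for s t
  proof -
    have sub: "{s..t} \<subseteq> {0..T}" using s t by auto
    have Fi: "F t - F r = integral {r..t} f" "\<Gamma> t - \<Gamma> r = integral {r..t} (\<lambda>r. \<bar>f r\<bar>)" if "r \<in> {s..t}" for r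
      using integral_interval_diff[OF fi, of r t] integral_interval_diff[OF afi, of r t] F[of t] F[of r] that s t
      by (auto simp: \<Gamma>_def)
    have pi: "(p' has_integral (p t - p s)) {s..t}"
    proof (rule fundamental_theorem_of_calculus[OF st])
      fix r assume r: "r \<in> {s..t}"
      show "(p has_vector_derivative p' r) (at r within {s..t})"
        using DERIV_subset[OF p sub] r sub by (auto simp: has_real_derivative_iff_has_vector_derivative)
    qed
    have fst: "f integrable_on {s..t}" "(\<lambda>r. \<bar>f r\<bar>) integrable_on {s..t}" "g integrable_on {s..t}"
      using integral_interval_diff(2)[OF _ s t st] fi afi gi by auto
    \<comment> \<open>F is frozen at t and p at s: then F t (p t - p s) + p s (F t - F s) is exactly
      the increment of p F.\<close>
    have "((\<lambda>r. F t * p' r + p s * f r - g r) has_integral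
       (F t * (p t - p s) + p s * integral {s..t} f - integral {s..t} g)) {s..t}"
      by (intro has_integral_add has_integral_diff has_integral_mult_right pi integrable_integral fst)
    moreover have "F t * (p t - p s) + p s * integral {s..t} f - integral {s..t} g = h t - h s"
      using Fi(1)[of s] integral_interval_diff(1)[OF gi s t st] st by (simp add: h_def algebra_simps)
    ultimately have hi: "((\<lambda>r. F t * p' r + p s * f r - g r) has_integral (h t - h s)) {s..t}" by simp
    have \<Gamma>st: "\<Gamma> s \<le> \<Gamma> t"
      using Fi(2)[of s] Henstock_Kurzweil_Integration.integral_nonneg[OF fst(2)] st by simp
    have bi: "((\<lambda>r. M * (\<Gamma> t - \<Gamma> s) + M * (t - s) * \<bar>f r\<bar>) has_integral
        ((t - s) * (M * (\<Gamma> t - \<Gamma> s)) + M * (t - s) * (\<Gamma> t - \<Gamma> s))) {s..t}"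
      using has_integral_const_real[of "M * (\<Gamma> t - \<Gamma> s)" s t] Fi(2)[of s] st
        has_integral_mult_right[OF integrable_integral[OF fst(2)], of "M * (t - s)"]
      by (intro has_integral_add) auto
    have "norm (F t * p' r + p s * f r - g r) \<le> M * (\<Gamma> t - \<Gamma> s) + M * (t - s) * \<bar>f r\<bar>" if r: "r \<in> {s..t}" for r
    proof -
      have r0: "r \<in> {0..T}" using r sub by auto
      have "\<bar>F t - F r\<bar> \<le> \<Gamma> t - \<Gamma> r"
        using integral_norm_bound_integral[of f "{r..t}" "\<lambda>r. \<bar>f r\<bar>"] Fi[OF r]
          integral_interval_diff(2)[OF fi r0 t] integral_interval_diff(2)[OF afi r0 t] r by auto
      also have "\<dots> \<le> \<Gamma> t - \<Gamma> s"
      proof -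
        have "\<Gamma> r - \<Gamma> s = integral {s..r} (\<lambda>r. \<bar>f r\<bar>)" "(\<lambda>r. \<bar>f r\<bar>) integrable_on {s..r}"
          using integral_interval_diff[OF afi s r0] r by (auto simp: \<Gamma>_def)
        then show ?thesis using Henstock_Kurzweil_Integration.integral_nonneg[of "\<lambda>r. \<bar>f r\<bar>" "{s..r}"] by simp
      qed
      finally have 1: "\<bar>F t - F r\<bar> \<le> \<Gamma> t - \<Gamma> s" .
      have "norm (p s - p r) \<le> M * norm (s - r)"
        using field_differentiable_bound[OF convex_real_interval(5)[of 0 T] p _ s r0, of M] M by auto
      also have "\<dots> \<le> M * (t - s)" using r M0 by (intro mult_left_mono) auto
      finally have 2: "\<bar>p s - p r\<bar> \<le> M * (t - s)" by simp
      \<comment> \<open>Both summands carry a small factor: |F t - F r| is at most the increment of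
        \<Gamma>, and |p s - p r| is at most M (t - s).\<close>
      have "F t * p' r + p s * f r - g r = p' r * (F t - F r) + (p s - p r) * f r"
        by (simp add: g_def algebra_simps)
      also have "norm \<dots> \<le> \<bar>p' r\<bar> * \<bar>F t - F r\<bar> + \<bar>p s - p r\<bar> * \<bar>f r\<bar>"
        unfolding real_norm_def abs_mult[symmetric] by (rule abs_triangle_ineq)
      also have "\<dots> \<le> M * (\<Gamma> t - \<Gamma> s) + M * (t - s) * \<bar>f r\<bar>"
        using M[OF r0] M0 1 2 by (intro add_mono mult_mono) auto
      finally show ?thesis .
    qed
    then have "norm (integral {s..t} (\<lambda>r. F t * p' r + p s * f r - g r))
        \<le> integral {s..t} (\<lambda>r. M * (\<Gamma> t - \<Gamma> s) + M * (t - s) * \<bar>f r\<bar>)"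
      using hi bi by (intro integral_norm_bound_integral) (auto simp: has_integral_integrable)
    then have "\<bar>h t - h s\<bar> \<le> 2 * M * (t - s) * (\<Gamma> t - \<Gamma> s)"
      using integral_unique[OF hi] integral_unique[OF bi] by (simp add: algebra_simps)
    also have "\<dots> \<le> 2 * M * \<bar>t - s\<bar> * \<bar>\<Gamma> t - \<Gamma> s\<bar>"
      using st M0 \<Gamma>st by (intro mult_mono) auto
    finally show ?thesis .
  qed
  have inc': "\<bar>h t - h s\<bar> \<le> 2 * M * \<bar>t - s\<bar> * \<bar>\<Gamma> t - \<Gamma> s\<bar>" if "s \<in> {0..T}" "t \<in> {0..T}" for s t
    using inc[OF that] inc[OF that(2,1)] by (cases "s \<le> t") (auto simp: abs_minus_commute)
  have "(h has_real_derivative 0) (at s within {0..T})" if s: "s \<in> {0..T}" for s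
    unfolding has_field_derivative_iff
  proof (rule Lim_null_comparison)
    show "\<forall>\<^sub>F t in at s within {0..T}. norm ((h t - h s) / (t - s)) \<le> 2 * M * \<bar>\<Gamma> t - \<Gamma> s\<bar>"
      unfolding eventually_at_filter
    proof (rule always_eventually, intro allI impI)
      fix t assume "t \<noteq> s" "t \<in> {0..T}"
      then show "norm ((h t - h s) / (t - s)) \<le> 2 * M * \<bar>\<Gamma> t - \<Gamma> s\<bar>"
        using inc'[OF s, of t] by (simp add: field_simps)
    qed
    have "(\<Gamma> \<longlongrightarrow> \<Gamma> s) (at s within {0..T})" using c\<Gamma> s by (simp add: continuous_on_def)
    then have "((\<lambda>t. 2 * M * \<bar>\<Gamma> t - \<Gamma> s\<bar>) \<longlongrightarrow> 2 * M * \<bar>\<Gamma> s - \<Gamma> s\<bar>) (at s within {0..T})"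
      by (intro tendsto_intros)
    then show "((\<lambda>t. 2 * M * \<bar>\<Gamma> t - \<Gamma> s\<bar>) \<longlongrightarrow> 0) (at s within {0..T})" by simp
  qed
  then obtain c where "\<And>s. s \<in> {0..T} \<Longrightarrow> h s = c"
    using has_field_derivative_zero_constant[of "{0..T}" h] by auto
  then have "h T = h 0" using T by auto
  then have "integral {0..T} g = p T * F T - p 0 * F 0" by (simp add: h_def)
  with gi show ?thesis unfolding g_def by (metis integrable_integral)
qed

text \<open>A Borel representative g' of f, extended by 0, has integral 0 over each half-line
  \<open>{a<..}\<close>. So the measures whose densities are the positive and the negative part of
  g' agree on half-lines, hence are equal, and their densities coincide almost everywhere.\<close>

lemma AE_zero_if_indefinite_integral_zero:
  fixes f :: "real \<Rightarrow> real"
  assumes f: "f absolutely_integrable_on {0..T}"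
    and 0: "\<And>t. t \<in> {0..T} \<Longrightarrow> integral {0..t} f = 0"
  shows "AE t in lebesgue. t \<in> {0..T} \<longrightarrow> f t = 0"
proof -
  define g where "g x = indicator {0..T} x *\<^sub>R f x" for x
  have g: "integrable lebesgue g" using f unfolding set_integrable_def g_def by simp
  then obtain g' where g'm: "g' \<in> borel_measurable lborel" and "AE x in lborel. g x = g' x"
    using completion_ex_borel_measurable_real[of g lborel] by auto
  then have ae: "AE x in lebesgue. g x = g' x" by (simp add: AE_completion)
  have g'm': "g' \<in> borel_measurable lebesgue" using g'm by (simp add: measurable_completion)
  have "integrable lebesgue g'" using integrable_cong_AE_imp[OF g g'm'] ae by (simp add: eq_commute)
  then have g': "integrable lborel g'" using g'm by (simp add: integrable_completion)
  \<comment> \<open>The integral over x > a is the total minus the integral over [0, min a T], and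
    both of these vanish by assumption.\<close>
  have zero: "(LINT x|lborel. indicator {a<..} x * g' x) = 0" for a :: real
  proof -
    let ?S = "{0..min a T}"
    have fS: "set_integrable lebesgue ?S f" by (rule absolutely_integrable_on_subinterval[OF f]) auto
    have "integral ?S f = 0" by (cases "0 \<le> a \<and> 0 \<le> T") (auto intro: 0)
    then have 1: "(LINT x|lebesgue. indicator ?S x *\<^sub>R f x) = 0"
      using set_lebesgue_integral_eq_integral(2)[OF fS] by (simp add: set_lebesgue_integral_def)
    have "integral {0..T} f = 0" by (cases "0 \<le> T") (auto intro: 0)
    then have 2: "(LINT x|lebesgue. g x) = 0"
      using set_lebesgue_integral_eq_integral(2)[OF f] by (simp add: set_lebesgue_integral_def g_def)
    have "(LINT x|lborel. indicator {a<..} x * g' x) = (LINT x|lebesgue. indicator {a<..} x * g' x)"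
      using g'm by (intro integral_completion[symmetric]) auto
    also have "\<dots> = (LINT x|lebesgue. g x - indicator ?S x *\<^sub>R f x)"
    proof (rule integral_cong_AE)
      show "AE x in lebesgue. indicator {a<..} x * g' x = g x - indicator ?S x *\<^sub>R f x"
        using ae by eventually_elim (auto simp: g_def indicator_def of_bool_def split: if_splits)
      show "(\<lambda>x. indicator {a<..} x * g' x) \<in> borel_measurable lebesgue"
        by (intro borel_measurable_times g'm' borel_measurable_indicator) auto
      show "(\<lambda>x. g x - indicator ?S x *\<^sub>R f x) \<in> borel_measurable lebesgue"
        using g fS by (intro borel_measurable_diff borel_measurable_integrable) (auto simp: set_integrable_def)
    qed
    also have "\<dots> = 0"
      using g fS 1 2 by (subst Bochner_Integration.integral_diff) (auto simp: set_integrable_def)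
    finally show ?thesis .
  qed
  have i: "integrable lborel (\<lambda>x. indicator {a<..} x * max 0 (\<sigma> * g' x))" for a \<sigma> :: real
  proof -
    have "integrable lborel (\<lambda>x. max 0 (\<sigma> * g' x) * indicator {a<..} x)"
      using g' by (intro integrable_real_mult_indicator integrable_max integrable_mult_right) auto
    then show ?thesis by (simp only: mult.commute)
  qed
  \<comment> \<open>\<open>ennreal\<close> sends negative numbers to 0, so \<sigma> = 1 and \<sigma>
    = -1 select the positive and the negative part of g'.\<close>
  have em: "emeasure (density lborel (\<lambda>x. ennreal (\<sigma> * g' x))) {a<..}
     = ennreal (LINT x|lborel. indicator {a<..} x * max 0 (\<sigma> * g' x))" for a \<sigma> :: real
  proof -
    have "emeasure (density lborel (\<lambda>x. ennreal (\<sigma> * g' x))) {a<..}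
       = (\<integral>\<^sup>+x. ennreal (\<sigma> * g' x) * indicator {a<..} x \<partial>lborel)"
      using g'm by (intro emeasure_density) auto
    also have "\<dots> = (\<integral>\<^sup>+x. ennreal (indicator {a<..} x * max 0 (\<sigma> * g' x)) \<partial>lborel)"
      by (intro nn_integral_cong) (auto simp: indicator_def max_def ennreal_neg)
    also have "\<dots> = ennreal (LINT x|lborel. indicator {a<..} x * max 0 (\<sigma> * g' x))"
      by (rule nn_integral_eq_integral[OF i]) auto
    finally show ?thesis .
  qed
  have "density lborel (\<lambda>x. ennreal (1 * g' x)) = density lborel (\<lambda>x. ennreal (-1 * g' x))"
  proof (rule measure_eqI_lessThan)
    fix a :: real
    have "(LINT x|lborel. indicator {a<..} x * max 0 (1 * g' x)) - (LINT x|lborel. indicator {a<..} x * max 0 (-1 * g' x))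
       = (LINT x|lborel. indicator {a<..} x * max 0 (1 * g' x) - indicator {a<..} x * max 0 (-1 * g' x))"
      by (rule Bochner_Integration.integral_diff[symmetric]) (rule i)+
    also have "\<dots> = (LINT x|lborel. indicator {a<..} x * g' x)"
      by (intro Bochner_Integration.integral_cong) (auto simp: indicator_def max_def)
    finally show "emeasure (density lborel (\<lambda>x. ennreal (1 * g' x))) {a<..}
        = emeasure (density lborel (\<lambda>x. ennreal (-1 * g' x))) {a<..}"
      unfolding em zero by simp
    show "emeasure (density lborel (\<lambda>x. ennreal (1 * g' x))) {a<..} < \<infinity>" unfolding em by simp
  qed auto
  then have "AE x in lborel. ennreal (1 * g' x) = ennreal (-1 * g' x)"
    using g'm by (subst (asm) sigma_finite_measure.density_unique_iff[OF sigma_finite_lborel]) auto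
  then have "AE x in lborel. g' x = 0"
  proof eventually_elim
    case (elim x)
    then show ?case by (cases "g' x \<ge> 0") (auto simp: ennreal_neg ennreal_eq_0_iff dest: sym)
  qed
  then have "AE x in lebesgue. g' x = 0" by (rule AE_completion)
  with ae show ?thesis
    by eventually_elim (auto simp: g_def)
qed

section \<open>Square-integrable functions and controls\<close>

definition L2_fun :: "real \<Rightarrow> (real \<Rightarrow> real) \<Rightarrow> bool" where
  "L2_fun T f \<longleftrightarrow> set_borel_measurable lebesgue {0..T} f \<and> set_integrable lebesgue {0..T} (\<lambda>t. (f t)\<^sup>2)"

lemma L2_control_iff:
  "L2_control m T u \<longleftrightarrow> (\<forall>t\<in>{0..T}. u t \<in> carrier_vec m) \<and> (\<forall>i<m. L2_fun T (\<lambda>t. u t $ i))"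
  by (simp add: L2_control_def L2_fun_def)

lemma L2_control_dim: "L2_control m T u \<Longrightarrow> t \<in> {0..T} \<Longrightarrow> dim_vec (u t) = m"
  by (auto simp: L2_control_iff)

lemma set_borel_measurable_mult:
  fixes f g :: "real \<Rightarrow> real"
  assumes "set_borel_measurable M S f" "set_borel_measurable M S g"
  shows "set_borel_measurable M S (\<lambda>t. f t * g t)"
proof -
  have "(\<lambda>t. (indicator S t *\<^sub>R f t) * (indicator S t *\<^sub>R g t)) \<in> borel_measurable M"
    using assms unfolding set_borel_measurable_def by (intro borel_measurable_times)
  also have "(\<lambda>t. (indicator S t *\<^sub>R f t) * (indicator S t *\<^sub>R g t)) = (\<lambda>t. indicator S t *\<^sub>R (f t * g t))"
    by (auto simp: indicator_def)
  finally show ?thesis unfolding set_borel_measurable_def .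
qed

lemma L2_fun_mult_integrable:
  assumes "L2_fun T f" "L2_fun T g"
  shows "(\<lambda>t. f t * g t) absolutely_integrable_on {0..T}"
proof (rule set_integrable_bound)
  show "set_integrable lebesgue {0..T} (\<lambda>t. (f t)\<^sup>2 + (g t)\<^sup>2)"
    using assms by (intro set_integral_add) (auto simp: L2_fun_def)
  show "set_borel_measurable lebesgue {0..T} (\<lambda>t. f t * g t)"
    using assms by (intro set_borel_measurable_mult) (auto simp: L2_fun_def)
  show "AE t in lebesgue. t \<in> {0..T} \<longrightarrow> norm (f t * g t) \<le> norm ((f t)\<^sup>2 + (g t)\<^sup>2)"
  proof (rule AE_I2, rule impI)
    fix t
    have "2 * (\<bar>f t\<bar> * \<bar>g t\<bar>) \<le> (f t)\<^sup>2 + (g t)\<^sup>2"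
      using sum_squares_bound[of "\<bar>f t\<bar>" "\<bar>g t\<bar>"] by simp
    moreover have "0 \<le> \<bar>f t\<bar> * \<bar>g t\<bar>" by simp
    ultimately have "\<bar>f t\<bar> * \<bar>g t\<bar> \<le> (f t)\<^sup>2 + (g t)\<^sup>2" by linarith
    then show "norm (f t * g t) \<le> norm ((f t)\<^sup>2 + (g t)\<^sup>2)" by (simp add: abs_mult)
  qed
qed

lemma L2_fun_cong:
  assumes "\<And>t. t \<in> {0..T} \<Longrightarrow> f t = g t" "L2_fun T f" shows "L2_fun T g"
proof -
  have "(\<lambda>t. indicator {0..T} t *\<^sub>R f t) = (\<lambda>t. indicator {0..T} t *\<^sub>R g t)"
    "(\<lambda>t. indicator {0..T} t *\<^sub>R (f t)\<^sup>2) = (\<lambda>t. indicator {0..T} t *\<^sub>R (g t)\<^sup>2)"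
    using assms(1) by (auto simp: indicator_def)
  then show ?thesis
    using assms(2) by (simp add: L2_fun_def set_borel_measurable_def set_integrable_def)
qed

lemma L2_fun_continuous:
  assumes "continuous_on {0..T} f" shows "L2_fun T f"
proof -
  have "set_integrable lebesgue {0..T} f"
    by (rule absolutely_integrable_continuous_real[OF assms])
  then have "set_borel_measurable lebesgue {0..T} f"
    unfolding set_integrable_def set_borel_measurable_def by (rule borel_measurable_integrable)
  moreover have "set_integrable lebesgue {0..T} (\<lambda>t. (f t)\<^sup>2)"
    using assms by (intro absolutely_integrable_continuous_real continuous_intros)
  ultimately show ?thesis by (simp add: L2_fun_def)
qed

lemma L2_fun_add:
  assumes "L2_fun T f" "L2_fun T g" shows "L2_fun T (\<lambda>t. f t + g t)"
proof -
  have "(\<lambda>t. indicator {0..T} t *\<^sub>R f t + indicator {0..T} t *\<^sub>R g t) \<in> borel_measurable lebesgue"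
    using assms unfolding L2_fun_def set_borel_measurable_def by (intro borel_measurable_add) auto
  then have "set_borel_measurable lebesgue {0..T} (\<lambda>t. f t + g t)"
    unfolding set_borel_measurable_def by (simp only: scaleR_add_right)
  moreover have "set_integrable lebesgue {0..T} (\<lambda>t. ((f t)\<^sup>2 + 2 * (f t * g t)) + (g t)\<^sup>2)"
    using assms L2_fun_mult_integrable[OF assms]
    by (intro set_integral_add set_integrable_mult_right) (auto simp: L2_fun_def)
  ultimately show ?thesis
    by (simp add: L2_fun_def power2_sum algebra_simps)
qed

lemma L2_fun_cmult:
  assumes "L2_fun T f" shows "L2_fun T (\<lambda>t. c * f t)"
proof -
  have "set_borel_measurable lebesgue {0..T} (\<lambda>t. c * f t)"
    using assms unfolding L2_fun_def set_borel_measurable_def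
    by (auto simp: mult.left_commute intro: borel_measurable_times)
  then show ?thesis using assms
    by (auto simp: L2_fun_def power_mult_distrib intro!: set_integrable_mult_right)
qed

lemma L2_fun_sum:
  "(\<And>i. i \<in> I \<Longrightarrow> L2_fun T (f i)) \<Longrightarrow> L2_fun T (\<lambda>t. \<Sum>i\<in>I. f i t)"
  by (induction I rule: infinite_finite_induct) (auto intro: L2_fun_add L2_fun_continuous)

lemma L2_fun_integrable: "L2_fun T f \<Longrightarrow> f absolutely_integrable_on {0..T}"
  using L2_fun_mult_integrable[of T f "\<lambda>_. 1"] L2_fun_continuous[of T "\<lambda>_. 1"] by simp

lemma L2_control_mult_mat:
  assumes M: "M \<in> carrier_mat r n" and a: "L2_control n T a"
  shows "L2_control r T (\<lambda>t. M *\<^sub>v a t)"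
  unfolding L2_control_iff
proof (intro conjI ballI allI impI)
  show "M *\<^sub>v a t \<in> carrier_vec r" if "t \<in> {0..T}" for t
    using mult_mat_vec_carrier[OF M] a that by (simp add: L2_control_iff)
  fix i assume i: "i < r"
  show "L2_fun T (\<lambda>t. (M *\<^sub>v a t) $ i)"
  proof (rule L2_fun_cong)
    show "L2_fun T (\<lambda>t. \<Sum>j<n. M $$ (i,j) * a t $ j)"
      using a by (intro L2_fun_sum L2_fun_cmult) (auto simp: L2_control_iff)
    show "(\<Sum>j<n. M $$ (i,j) * a t $ j) = (M *\<^sub>v a t) $ i" if "t \<in> {0..T}" for t
      using mult_mat_vec_index_sum[OF M _ i, of "a t"] a that by (simp add: L2_control_iff)
  qed
qed

lemma L2_control_add:
  assumes a: "L2_control n T a" and b: "L2_control n T b"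
  shows "L2_control n T (\<lambda>t. a t + b t)"
  unfolding L2_control_iff
proof (intro conjI ballI allI impI)
  show "a t + b t \<in> carrier_vec n" if "t \<in> {0..T}" for t
    using a b that by (simp add: L2_control_iff)
  fix i assume i: "i < n"
  show "L2_fun T (\<lambda>t. (a t + b t) $ i)"
  proof (rule L2_fun_cong)
    show "L2_fun T (\<lambda>t. a t $ i + b t $ i)"
      using a b i by (intro L2_fun_add) (auto simp: L2_control_iff)
    show "a t $ i + b t $ i = (a t + b t) $ i" if "t \<in> {0..T}" for t
      using L2_control_dim[OF b that] i by simp
  qed
qed

lemma L2_control_diff:
  assumes a: "L2_control n T a" and b: "L2_control n T b"
  shows "L2_control n T (\<lambda>t. a t - b t)"
  unfolding L2_control_iff
proof (intro conjI ballI allI impI)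
  show "a t - b t \<in> carrier_vec n" if "t \<in> {0..T}" for t
    using a b that by (simp add: L2_control_iff)
  fix i assume i: "i < n"
  have "L2_fun T (\<lambda>t. a t $ i + (-1) * b t $ i)"
    using a b i by (intro L2_fun_add L2_fun_cmult) (auto simp: L2_control_iff)
  then show "L2_fun T (\<lambda>t. (a t - b t) $ i)"
  proof (rule L2_fun_cong[rotated])
    show "a t $ i + (-1) * b t $ i = (a t - b t) $ i" if "t \<in> {0..T}" for t
      using L2_control_dim[OF b that] i by simp
  qed
qed

lemma L2_control_continuous:
  assumes "\<And>t. t \<in> {0..T} \<Longrightarrow> a t \<in> carrier_vec n" "\<And>i. i < n \<Longrightarrow> continuous_on {0..T} (\<lambda>t. a t $ i)"
  shows "L2_control n T a"
  using assms by (simp add: L2_control_iff L2_fun_continuous)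

lemma L2_control_scalar_prod:
  assumes a: "L2_control n T a" and b: "L2_control n T b"
  shows "(\<lambda>t. a t \<bullet> b t) absolutely_integrable_on {0..T}"
proof -
  have "(\<lambda>t. \<Sum>i<n. a t $ i * b t $ i) absolutely_integrable_on {0..T}"
    using a b by (intro absolutely_integrable_sum L2_fun_mult_integrable) (auto simp: L2_control_iff)
  also have "?this \<longleftrightarrow> ?thesis"
  proof (intro set_integrable_cong refl)
    show "(\<Sum>i<n. a t $ i * b t $ i) = a t \<bullet> b t" if "t \<in> {0..T}" for t
      using L2_control_dim[OF b that] by (simp add: scalar_prod_def atLeast0LessThan)
  qed
  finally show ?thesis .
qed

section \<open>Absolutely continuous trajectories and smooth solutions among them\<close>

lemma L2_trajectoryD:
  assumes A: "A \<in> carrier_mat n n" and B: "B \<in> carrier_mat n m" and xu: "L2_trajectory A B T x u"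
  shows "L2_control m T u" "t \<in> {0..T} \<Longrightarrow> x t \<in> carrier_vec n" "t \<in> {0..T} \<Longrightarrow> u t \<in> carrier_vec m"
    "i < n \<Longrightarrow> (\<lambda>t. (A *\<^sub>v x t + B *\<^sub>v u t) $ i) absolutely_integrable_on {0..T}"
    "i < n \<Longrightarrow> t \<in> {0..T} \<Longrightarrow> x t $ i = x 0 $ i + integral {0..t} (\<lambda>t. (A *\<^sub>v x t + B *\<^sub>v u t) $ i)"
    "i < n \<Longrightarrow> continuous_on {0..T} (\<lambda>t. x t $ i)"
    "L2_control n T x"
proof -
  show u: "L2_control m T u" using xu B by (simp add: L2_trajectory_def)
  show x: "x t \<in> carrier_vec n" if "t \<in> {0..T}" for t
    using xu A that by (simp add: L2_trajectory_def ac_solution_def)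
  show "t \<in> {0..T} \<Longrightarrow> u t \<in> carrier_vec m" using u by (simp add: L2_control_iff)
  show h: "(\<lambda>t. (A *\<^sub>v x t + B *\<^sub>v u t) $ i) absolutely_integrable_on {0..T}" if "i < n" for i
    using xu A that by (simp add: L2_trajectory_def ac_solution_def)
  show xi: "x t $ i = x 0 $ i + integral {0..t} (\<lambda>t. (A *\<^sub>v x t + B *\<^sub>v u t) $ i)"
    if "i < n" "t \<in> {0..T}" for i t
  proof -
    have "(\<lambda>t. (A *\<^sub>v x t + B *\<^sub>v u t) $ i) absolutely_integrable_on {0..t}"
      by (rule absolutely_integrable_on_subinterval[OF h[OF that(1)]]) (use that in auto)
    moreover have "x t $ i = x 0 $ i + (LINT s:{0..t}|lebesgue. (A *\<^sub>v x s + B *\<^sub>v u s) $ i)"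
      using xu A that unfolding L2_trajectory_def ac_solution_def by blast
    ultimately show ?thesis by (simp add: set_lebesgue_integral_eq_integral(2))
  qed
  show c: "continuous_on {0..T} (\<lambda>t. x t $ i)" if "i < n" for i
  proof (subst continuous_on_cong[OF refl xi[OF that]])
    show "continuous_on {0..T} (\<lambda>t. x 0 $ i + integral {0..t} (\<lambda>t. (A *\<^sub>v x t + B *\<^sub>v u t) $ i))"
      using h[OF that] by (intro continuous_intros indefinite_integral_continuous_1)
        (simp add: absolutely_integrable_on_def)
  qed auto
  show "L2_control n T x" by (rule L2_control_continuous[OF x c])
qed

lemma L2_trajectoryI:
  assumes A: "A \<in> carrier_mat n n" and B: "B \<in> carrier_mat n m"
    and u: "L2_control m T u" and x: "\<And>t. t \<in> {0..T} \<Longrightarrow> x t \<in> carrier_vec n"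
    and h: "\<And>i. i < n \<Longrightarrow> (\<lambda>t. (A *\<^sub>v x t + B *\<^sub>v u t) $ i) absolutely_integrable_on {0..T}"
    and xi: "\<And>i t. i < n \<Longrightarrow> t \<in> {0..T} \<Longrightarrow> x t $ i = x 0 $ i + integral {0..t} (\<lambda>t. (A *\<^sub>v x t + B *\<^sub>v u t) $ i)"
  shows "L2_trajectory A B T x u"
proof -
  have "x t $ i = x 0 $ i + (LINT s:{0..t}|lebesgue. (A *\<^sub>v x s + B *\<^sub>v u s) $ i)"
    if "i < n" "t \<in> {0..T}" for i t
  proof -
    have "(\<lambda>t. (A *\<^sub>v x t + B *\<^sub>v u t) $ i) absolutely_integrable_on {0..t}"
      by (rule absolutely_integrable_on_subinterval[OF h[OF that(1)]]) (use that in auto)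
    then show ?thesis using xi[OF that] by (simp add: set_lebesgue_integral_eq_integral(2))
  qed
  moreover have "dim_row A = n" "dim_col B = m" using A B by auto
  ultimately show ?thesis
    using u x h unfolding L2_trajectory_def ac_solution_def by blast
qed

lemma L2_trajectory_diff:
  assumes A: "A \<in> carrier_mat n n" and B: "B \<in> carrier_mat n m" and xu: "L2_trajectory A B T x u"
    and xu': "L2_trajectory A B T x' u'"
  shows "L2_trajectory A B T (\<lambda>t. x' t - x t) (\<lambda>t. u' t - u t)"
proof -
  note D = L2_trajectoryD[OF A B xu] and D' = L2_trajectoryD[OF A B xu']
  let ?h = "\<lambda>i t. (A *\<^sub>v x t + B *\<^sub>v u t) $ i" and ?h' = "\<lambda>i t. (A *\<^sub>v x' t + B *\<^sub>v u' t) $ i"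
  have eq: "(A *\<^sub>v (x' t - x t) + B *\<^sub>v (u' t - u t)) $ i = ?h' i t - ?h i t" if "i < n" "t \<in> {0..T}" for i t
  proof -
    note c = D(2,3)[OF that(2)] D'(2,3)[OF that(2)]
    have "A *\<^sub>v (x' t - x t) = A *\<^sub>v x' t - A *\<^sub>v x t"
      by (rule mult_minus_distrib_mat_vec[OF A c(3,1)])
    moreover have "B *\<^sub>v (u' t - u t) = B *\<^sub>v u' t - B *\<^sub>v u t"
      by (rule mult_minus_distrib_mat_vec[OF B c(4,2)])
    ultimately show ?thesis using that(1) carrier_matD[OF A] carrier_matD[OF B]
      by (simp del: index_mult_mat_vec)
  qed
  show ?thesis
  proof (rule L2_trajectoryI[OF A B])
    show "L2_control m T (\<lambda>t. u' t - u t)" by (rule L2_control_diff[OF D'(1) D(1)])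
    show "x' t - x t \<in> carrier_vec n" if "t \<in> {0..T}" for t using D(2) D'(2) that by simp
    fix i assume i: "i < n"
    have "(\<lambda>t. ?h' i t - ?h i t) absolutely_integrable_on {0..T}"
      using D'(4)[OF i] D(4)[OF i] by (rule set_integral_diff(1))
    also have "?this \<longleftrightarrow> (\<lambda>t. (A *\<^sub>v (x' t - x t) + B *\<^sub>v (u' t - u t)) $ i) absolutely_integrable_on {0..T}"
      by (rule set_integrable_cong[OF refl refl eq[OF i, symmetric]])
    finally show "(\<lambda>t. (A *\<^sub>v (x' t - x t) + B *\<^sub>v (u' t - u t)) $ i) absolutely_integrable_on {0..T}" .
    fix t assume t: "t \<in> {0..T}"
    have "integral {0..t} (\<lambda>t. (A *\<^sub>v (x' t - x t) + B *\<^sub>v (u' t - u t)) $ i) = integral {0..t} (\<lambda>t. ?h' i t - ?h i t)"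
      using eq[OF i] t by (intro Henstock_Kurzweil_Integration.integral_cong) auto
    also have "\<dots> = integral {0..t} (?h' i) - integral {0..t} (?h i)"
      using absolutely_integrable_on_subinterval[OF D'(4)[OF i], of 0 t]
        absolutely_integrable_on_subinterval[OF D(4)[OF i], of 0 t] t
      by (intro Henstock_Kurzweil_Integration.integral_diff) (auto simp: absolutely_integrable_on_def)
    finally show "(x' t - x t) $ i = (x' 0 - x 0) $ i
        + integral {0..t} (\<lambda>t. (A *\<^sub>v (x' t - x t) + B *\<^sub>v (u' t - u t)) $ i)"
      using D(2)[OF t] D'(2)[OF t] D(2)[of 0] D'(2)[of 0] D(5)[OF i t] D'(5)[OF i t] i t by simp
  qed
qed

lemma smooth_trajectory_L2:
  assumes A: "A \<in> carrier_mat n n" and B: "B \<in> carrier_mat n m" and T: "0 < T"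
    and xu: "(x, u) \<in> smooth_trajectories A B T"
  shows "L2_trajectory A B T x u"
proof -
  have xs: "x \<in> smooth_curves T n" and us: "u \<in> smooth_curves T m"
    and d: "\<And>t i. t \<in> {0..T} \<Longrightarrow> i < n \<Longrightarrow> ((\<lambda>s. x s $ i) has_real_derivative
              (A *\<^sub>v x t + B *\<^sub>v u t) $ i) (at t within {0..T})"
    using xu A B by (auto simp: smooth_trajectories_def)
  have x: "x t \<in> carrier_vec n" and u: "u t \<in> carrier_vec m" if "t \<in> {0..T}" for t
    using smooth_curves_carrier[OF xs that] smooth_curves_carrier[OF us that] .
  have cx: "continuous_on {0..T} (\<lambda>t. x t $ i)" if "i < n" for i
    using smooth_fun_continuous[OF smooth_curves_smooth[OF xs that], of 0] by simp
  have cu: "continuous_on {0..T} (\<lambda>t. u t $ i)" if "i < m" for i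
    using smooth_fun_continuous[OF smooth_curves_smooth[OF us that], of 0] by simp
  have ch: "continuous_on {0..T} (\<lambda>t. (A *\<^sub>v x t + B *\<^sub>v u t) $ i)" if i: "i < n" for i
  proof (subst continuous_on_cong[OF refl])
    show "continuous_on {0..T} (\<lambda>t. (\<Sum>j<n. A $$ (i,j) * x t $ j) + (\<Sum>j<m. B $$ (i,j) * u t $ j))"
      by (intro continuous_intros cx cu) auto
    show "(A *\<^sub>v x t + B *\<^sub>v u t) $ i = (\<Sum>j<n. A $$ (i,j) * x t $ j) + (\<Sum>j<m. B $$ (i,j) * u t $ j)"
      if "t \<in> {0..T}" for t
      using mult_mat_vec_index_sum[OF A x[OF that] i] mult_mat_vec_index_sum[OF B u[OF that] i] B i
      by (simp del: index_mult_mat_vec)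
  qed
  show ?thesis
  proof (rule L2_trajectoryI[OF A B L2_control_continuous[OF u cu] x])
    show "(\<lambda>t. (A *\<^sub>v x t + B *\<^sub>v u t) $ i) absolutely_integrable_on {0..T}" if "i < n" for i
      using ch[OF that] by (rule absolutely_integrable_continuous_real)
    fix i t assume i: "i < n" and t: "t \<in> {0..T}"
    have "((\<lambda>t. (A *\<^sub>v x t + B *\<^sub>v u t) $ i) has_integral (x t $ i - x 0 $ i)) {0..t}"
    proof (rule fundamental_theorem_of_calculus)
      fix s assume "s \<in> {0..t}"
      then show "((\<lambda>s. x s $ i) has_vector_derivative (A *\<^sub>v x s + B *\<^sub>v u s) $ i) (at s within {0..t})"
        using DERIV_subset[OF d[OF _ i], of s "{0..t}"] t
        by (auto simp: has_real_derivative_iff_has_vector_derivative)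
    qed (use t in auto)
    then show "x t $ i = x 0 $ i + integral {0..t} (\<lambda>t. (A *\<^sub>v x t + B *\<^sub>v u t) $ i)"
      by (simp add: integral_unique)
  qed
qed

text \<open>Bootstrapping: the recursion F (p+1) = A F p + f^(p) names the successive derivatives of
  x in advance, and each is differentiable because it is built from the one before and from
  f.\<close>

lemma smooth_linear_ode:
  fixes A :: "real Matrix.mat"
  assumes T: "0 < T" and A: "A \<in> carrier_mat n n"
    and x: "\<And>t. t \<in> {0..T} \<Longrightarrow> x t \<in> carrier_vec n"
    and f: "\<And>t. t \<in> {0..T} \<Longrightarrow> f t \<in> carrier_vec n" "\<And>i. i < n \<Longrightarrow> smooth_fun T (\<lambda>t. f t $ i)"
    and d: "\<And>t i. t \<in> {0..T} \<Longrightarrow> i < n \<Longrightarrow>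
       ((\<lambda>s. x s $ i) has_real_derivative (A *\<^sub>v x t + f t) $ i) (at t within {0..T})"
    and i: "i < n"
  shows "smooth_fun T (\<lambda>t. x t $ i)"
proof -
  define F where "F = rec_nat x (\<lambda>p G t. A *\<^sub>v G t + Matrix.vec n (\<lambda>i. nderiv {0..T} p (\<lambda>s. f s $ i) t))"
  have F0: "F 0 = x" and FS: "F (Suc p) = (\<lambda>t. A *\<^sub>v F p t + Matrix.vec n (\<lambda>i. nderiv {0..T} p (\<lambda>s. f s $ i) t))" for p
    by (simp_all add: F_def)
  have Fc: "F p t \<in> carrier_vec n" if "t \<in> {0..T}" for p t
    using x[OF that] carrier_matD[OF A] by (cases p) (auto simp: F0 FS intro!: carrier_vecI)
  have "\<forall>t\<in>{0..T}. \<forall>i<n. ((\<lambda>s. F p s $ i) has_real_derivative F (Suc p) t $ i) (at t within {0..T})" for p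
  proof (induction p)
    case 0
    have "F (Suc 0) t = A *\<^sub>v x t + f t" if "t \<in> {0..T}" for t
      using A f(1)[OF that] by (intro eq_vecI) (auto simp: F0 FS)
    then show ?case using d by (simp add: F0)
  next
    case (Suc p)
    show ?case
    proof (intro ballI allI impI)
      fix t i assume t: "t \<in> {0..T}" and i: "i < n"
      have e: "F (Suc p) s $ i = (\<Sum>j<n. A $$ (i,j) * F p s $ j) + nderiv {0..T} p (\<lambda>s. f s $ i) s"
        if "s \<in> {0..T}" for p s
        unfolding FS using mult_mat_vec_index_sum[OF A Fc[OF that] i] i A by (simp del: index_mult_mat_vec)
      have "((\<lambda>s. (\<Sum>j<n. A $$ (i,j) * F p s $ j) + nderiv {0..T} p (\<lambda>s. f s $ i) s) has_real_derivative
         (\<Sum>j<n. A $$ (i,j) * F (Suc p) t $ j) + nderiv {0..T} (Suc p) (\<lambda>s. f s $ i) t) (at t within {0..T})"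
        using Suc t i by (intro DERIV_add DERIV_sum DERIV_cmult smooth_fun_has_derivative f) auto
      then show "((\<lambda>s. F (Suc p) s $ i) has_real_derivative F (Suc (Suc p)) t $ i) (at t within {0..T})"
        unfolding e[OF t, of "Suc p"] by (rule has_real_derivative_agree[OF _ t e])
    qed
  qed
  then show ?thesis
    using smooth_funI[OF T, of "\<lambda>p t. F p t $ i"] i by (simp add: F0)
qed

text \<open>With p' = -A^T p + f and x' = A x + B u the terms containing A cancel in the derivative
  of the scalar product of p and x. As x is only absolutely continuous, the product rule is replaced
  by \<open>integral_by_parts_abs_continuous\<close> in each component.\<close>

lemma costate_duality:
  assumes T: "0 < T" and A: "A \<in> carrier_mat n n" and B: "B \<in> carrier_mat n m"
    and xu: "L2_trajectory A B T x u"
    and p: "\<And>t. t \<in> {0..T} \<Longrightarrow> p t \<in> carrier_vec n"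
    and f: "\<And>t. t \<in> {0..T} \<Longrightarrow> f t \<in> carrier_vec n" "\<And>i. i < n \<Longrightarrow> continuous_on {0..T} (\<lambda>t. f t $ i)"
    and d: "\<And>t i. t \<in> {0..T} \<Longrightarrow> i < n \<Longrightarrow>
       ((\<lambda>s. p s $ i) has_real_derivative (- transpose_mat A *\<^sub>v p t + f t) $ i) (at t within {0..T})"
  shows "((\<lambda>t. u t \<bullet> (transpose_mat B *\<^sub>v p t) + x t \<bullet> f t) has_integral (p T \<bullet> x T - p 0 \<bullet> x 0)) {0..T}"
proof -
  note D = L2_trajectoryD[OF A B xu]
  have A': "- transpose_mat A \<in> carrier_mat n n" using A by simp
  have cp: "continuous_on {0..T} (\<lambda>t. p t $ i)" if "i < n" for i
    using d[OF _ that] by (rule DERIV_continuous_on)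
  let ?p' = "\<lambda>t. - transpose_mat A *\<^sub>v p t + f t" and ?h = "\<lambda>t. A *\<^sub>v x t + B *\<^sub>v u t"
  have cp': "continuous_on {0..T} (\<lambda>t. ?p' t $ i)" if i: "i < n" for i
  proof (subst continuous_on_cong[OF refl])
    show "continuous_on {0..T} (\<lambda>t. (\<Sum>j<n. (- transpose_mat A) $$ (i,j) * p t $ j) + f t $ i)"
      using i by (intro continuous_intros cp f) auto
    show "?p' t $ i = (\<Sum>j<n. (- transpose_mat A) $$ (i,j) * p t $ j) + f t $ i" if "t \<in> {0..T}" for t
      using mult_mat_vec_index_sum[OF A' p[OF that] i] f(1)[OF that] i by (simp del: index_mult_mat_vec)
  qed
  have "((\<lambda>t. \<Sum>i<n. p t $ i * ?h t $ i + ?p' t $ i * x t $ i) has_integral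
     (\<Sum>i<n. p T $ i * x T $ i - p 0 $ i * x 0 $ i)) {0..T}"
    by (intro has_integral_sum integral_by_parts_abs_continuous[OF T] d cp' D) auto
  also have "(\<Sum>i<n. p T $ i * x T $ i - p 0 $ i * x 0 $ i) = p T \<bullet> x T - p 0 \<bullet> x 0"
    using D(2)[of T] D(2)[of 0] T by (simp add: scalar_prod_def atLeast0LessThan sum_subtractf)
  finally show ?thesis
  proof (rule has_integral_eq[rotated])
    fix t assume t: "t \<in> {0..T}"
    note c = p[OF t] D(2,3)[OF t] f(1)[OF t]
    have h: "?h t \<in> carrier_vec n" using c A B by simp
    have Atp: "transpose_mat A *\<^sub>v p t \<in> carrier_vec n" and Btp: "transpose_mat B *\<^sub>v p t \<in> carrier_vec m"
      using c A B by auto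
    have "(\<Sum>i<n. p t $ i * ?h t $ i + ?p' t $ i * x t $ i) = p t \<bullet> ?h t + ?p' t \<bullet> x t"
      using carrier_vecD[OF h] carrier_vecD[OF c(2)]
      by (simp only: scalar_prod_def atLeast0LessThan sum.distrib)
    moreover have "p t \<bullet> ?h t = p t \<bullet> (A *\<^sub>v x t) + p t \<bullet> (B *\<^sub>v u t)"
      using c A B by (intro scalar_prod_add_distrib) auto
    moreover have "?p' t = f t - transpose_mat A *\<^sub>v p t"
      using c A by (intro eq_vecI) auto
    moreover have "(f t - transpose_mat A *\<^sub>v p t) \<bullet> x t = f t \<bullet> x t - (transpose_mat A *\<^sub>v p t) \<bullet> x t"
      using c Atp by (intro minus_scalar_prod_distrib) auto
    moreover have "(transpose_mat A *\<^sub>v p t) \<bullet> x t = p t \<bullet> (A *\<^sub>v x t)"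
      using transpose_vec_mult_scalar[OF A c(2,1)] by simp
    moreover have "p t \<bullet> (B *\<^sub>v u t) = u t \<bullet> (transpose_mat B *\<^sub>v p t)"
      using transpose_vec_mult_scalar[OF B c(3,1)] comm_scalar_prod[OF Btp c(3)] by simp
    moreover have "f t \<bullet> x t = x t \<bullet> f t" by (rule comm_scalar_prod[OF c(4,2)])
    ultimately show "(\<Sum>i<n. p t $ i * ?h t $ i + ?p' t $ i * x t $ i)
      = u t \<bullet> (transpose_mat B *\<^sub>v p t) + x t \<bullet> f t" by (simp only:)
  qed
qed

text \<open>Orthogonal projection of the last of \<open>k + 1\<close> vectors off the span of the others, in terms of their
  (possibly degenerate) Gram matrix.\<close>
lemma gram_projection:
  fixes G :: "nat \<Rightarrow> nat \<Rightarrow> real"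
  assumes sym: "\<And>i j. i \<le> k \<Longrightarrow> j \<le> k \<Longrightarrow> G i j = G j i"
    and psd: "\<And>\<alpha>. 0 \<le> (\<Sum>i\<le>k. \<alpha> i * (\<Sum>j\<le>k. \<alpha> j * G i j))"
  obtains \<alpha> where "\<alpha> k = 1" "\<And>i. i < k \<Longrightarrow> (\<Sum>j\<le>k. \<alpha> j * G i j) = 0"
proof -
  define R where "R \<alpha> i = (\<Sum>j\<le>k. \<alpha> j * G i j)" for \<alpha> i
  define q where "q \<alpha> \<beta> = (\<Sum>i\<le>k. \<alpha> i * R \<beta> i)" for \<alpha> \<beta>
  have R_lin: "R (\<lambda>i. \<alpha> i + c * \<beta> i) i = R \<alpha> i + c * R \<beta> i" for \<alpha> \<beta> c i
    by (simp add: R_def distrib_right sum.distrib sum_distrib_left mult.assoc)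
  have q_sym: "q \<alpha> \<beta> = q \<beta> \<alpha>" for \<alpha> \<beta>
  proof -
    have "q \<alpha> \<beta> = (\<Sum>j\<le>k. \<Sum>i\<le>k. \<alpha> i * (\<beta> j * G i j))"
      unfolding q_def R_def sum_distrib_left by (rule sum.swap)
    also have "\<dots> = q \<beta> \<alpha>"
      unfolding q_def R_def sum_distrib_left using sym by (intro sum.cong refl) auto
    finally show ?thesis .
  qed
  \<comment> \<open>Induction on the number r of conditions already met. Only coefficients with
    index below r may be changed, so that the last one stays 1.\<close>
  have "\<exists>\<beta>. (\<forall>i\<ge>r. \<beta> i = \<alpha> i) \<and> (\<forall>i<r. R \<beta> i = 0)" if "r \<le> k" for r \<alpha>
    using that
  proof (induction r arbitrary: \<alpha>)
    case 0
    show ?case by (rule exI[of _ \<alpha>]) simp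
  next
    case (Suc r)
    then obtain \<beta> where \<beta>: "\<And>i. i \<ge> r \<Longrightarrow> \<beta> i = \<alpha> i" "\<And>i. i < r \<Longrightarrow> R \<beta> i = 0"
      using Suc.IH[OF Suc_leD[OF Suc.prems], of \<alpha>] by blast
    \<comment> \<open>w is the r-th vector made orthogonal to those before it; its residue at r is
      therefore its squared length.\<close>
    obtain w where w: "\<And>i. i \<ge> r \<Longrightarrow> w i = (if i = r then 1 else 0)" "\<And>i. i < r \<Longrightarrow> R w i = 0"
      using Suc.IH[OF Suc_leD[OF Suc.prems], of "\<lambda>i. if i = r then 1 else 0"] by blast
    have qw: "q w \<zeta> = R \<zeta> r" if "\<And>i. i < r \<Longrightarrow> R \<zeta> i = 0" for \<zeta>
    proof -
      have "q w \<zeta> = (\<Sum>i\<le>k. if i = r then R \<zeta> r else 0)"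
        unfolding q_def
      proof (rule sum.cong[OF refl])
        fix i
        show "w i * R \<zeta> i = (if i = r then R \<zeta> r else 0)"
          using that[of i] w(1)[of i] by (cases "i < r") auto
      qed
      also have "\<dots> = R \<zeta> r" using Suc.prems by simp
      finally show ?thesis .
    qed
    show ?case
    proof (cases "R w r = 0")
      case False
      define c where "c = - R \<beta> r / R w r"
      have c: "R \<beta> r + c * R w r = 0" using False by (simp add: c_def)
      have "R (\<lambda>i. \<beta> i + c * w i) i = 0" if "i < Suc r" for i
        using that c \<beta>(2) w(2) by (cases "i = r") (auto simp: R_lin)
      moreover have "\<beta> i + c * w i = \<alpha> i" if "i \<ge> Suc r" for i
        using that \<beta>(1) w(1) by simp
      ultimately show ?thesis by (intro exI[of _ "\<lambda>i. \<beta> i + c * w i"]) blast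
    next
      \<comment> \<open>The orthogonalized r-th vector is null. Semidefiniteness keeps the form at
        \<beta> + s w nonnegative for all s, and as this value is affine in s, its slope must be
        0.\<close>
      case True
      then have qww: "q w w = 0" using qw[of w] w(2) by simp
      have qwb: "q w \<beta> = R \<beta> r" using qw[of \<beta>] \<beta>(2) by simp
      have lin: "0 \<le> q \<beta> \<beta> + 2 * s * R \<beta> r" for s
      proof -
        have "0 \<le> q (\<lambda>i. \<beta> i + s * w i) (\<lambda>i. \<beta> i + s * w i)"
          unfolding q_def R_def by (rule psd)
        also have "\<dots> = q \<beta> \<beta> + s * q \<beta> w + s * (q w \<beta> + s * q w w)"
          by (simp add: q_def R_lin distrib_left distrib_right sum.distrib sum_distrib_left mult_ac)
        finally show ?thesis using qww qwb q_sym[of \<beta> w] by simp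
      qed
      have "R \<beta> r = 0"
      proof (rule ccontr)
        assume "R \<beta> r \<noteq> 0"
        then show False using lin[of "- (q \<beta> \<beta> + 1) / (2 * R \<beta> r)"] by (simp add: field_simps)
      qed
      then have "R \<beta> i = 0" if "i < Suc r" for i using that \<beta>(2) by (cases "i = r") auto
      then show ?thesis using \<beta>(1) by (intro exI[of _ \<beta>]) auto
    qed
  qed
  from this[of k "\<lambda>_. 1"] obtain \<alpha> where "\<alpha> k = 1" "\<And>i. i < k \<Longrightarrow> R \<alpha> i = 0" by auto
  then show ?thesis using that[of \<alpha>] by (simp add: R_def)
qed

section \<open>Stationarity and zero-cost trajectories in \<open>L\<^sup>2\<close>\<close>

lemma mult_mat_vec_in_carrier: "M \<in> carrier_mat r c \<Longrightarrow> M *\<^sub>v v \<in> carrier_vec r"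
  by (auto intro!: carrier_vecI)

lemma row_in_carrier: "M \<in> carrier_mat r c \<Longrightarrow> Matrix.row M i \<in> carrier_vec c"
  by (auto intro!: carrier_vecI)

lemma real_scalar_prod_self_eq_0:
  fixes v :: "real Matrix.vec"
  assumes "v \<in> carrier_vec n" "v \<bullet> v = 0" shows "v = 0\<^sub>v n"
proof -
  have "(\<Sum>i<n. v $ i * v $ i) = 0"
    using assms by (simp add: scalar_prod_def atLeast0LessThan)
  then have "\<forall>i\<in>{..<n}. v $ i * v $ i = 0" by (subst (asm) sum_nonneg_eq_0_iff) auto
  then show ?thesis using assms by (intro eq_vecI) auto
qed

lemma real_scalar_prod_self_ge_0: "0 \<le> v \<bullet> (v :: real Matrix.vec)"
  by (auto simp: scalar_prod_def intro: sum_nonneg)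

lemma scalar_prod_lincomb:
  fixes a :: "real Matrix.vec"
  assumes "a \<in> carrier_vec n" "\<And>j. j \<le> k \<Longrightarrow> c j \<in> carrier_vec n"
  shows "a \<bullet> Matrix.vec n (\<lambda>i. \<Sum>j\<le>k. \<alpha> j * c j $ i) = (\<Sum>j\<le>k. \<alpha> j * (a \<bullet> c j))"
proof -
  have "a \<bullet> Matrix.vec n (\<lambda>i. \<Sum>j\<le>k. \<alpha> j * c j $ i) = (\<Sum>i<n. \<Sum>j\<le>k. \<alpha> j * (a $ i * c j $ i))"
    by (simp add: scalar_prod_def atLeast0LessThan sum_distrib_left mult.left_commute)
  also have "\<dots> = (\<Sum>j\<le>k. \<alpha> j * (\<Sum>i<n. a $ i * c j $ i))"
    by (subst sum.swap) (simp add: sum_distrib_left)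
  also have "\<dots> = (\<Sum>j\<le>k. \<alpha> j * (a \<bullet> c j))"
  proof (intro sum.cong refl)
    fix j assume "j \<in> {..k}"
    then have "dim_vec (c j) = n" using assms(2) by (auto dest: carrier_vecD)
    then show "\<alpha> j * (\<Sum>i<n. a $ i * c j $ i) = \<alpha> j * (a \<bullet> c j)"
      by (simp add: scalar_prod_def atLeast0LessThan)
  qed
  finally show ?thesis .
qed

text \<open>Every endpoint constraint, and the first variation itself, is a functional
  \<open>(x, u) \<mapsto> c \<bullet> x(0) + \<integral> g \<bullet> u\<close> with \<open>g\<close> smooth. Projecting the pair \<open>(c, g)\<close> of the first variation off
  those of the constraints gives a pair that is itself a smooth admissible variation, hence vanishes;
  so the first variation is a linear combination of the constraints on all of \<open>L\<^sup>2\<close>.\<close>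
lemma first_variation_L2:
  assumes T: "0 < T" and A: "A \<in> carrier_mat n n" and B: "B \<in> carrier_mat n m"
    and M0: "M0 \<in> carrier_mat k n" and M1: "M1 \<in> carrier_mat k n"
    and w: "\<And>t. w t \<in> carrier_vec n" "\<And>i. i < n \<Longrightarrow> smooth_fun T (\<lambda>t. w t $ i)"
    and v: "\<And>t. v t \<in> carrier_vec m" "\<And>i. i < m \<Longrightarrow> smooth_fun T (\<lambda>t. v t $ i)"
    and sm: "\<And>x u. (x, u) \<in> smooth_trajectories A B T \<Longrightarrow> endpoint_value M0 M1 T x = 0\<^sub>v k
       \<Longrightarrow> integral {0..T} (\<lambda>t. x t \<bullet> w t + u t \<bullet> v t) = 0"
    and xu: "L2_trajectory A B T x u" and ep: "endpoint_value M0 M1 T x = 0\<^sub>v k"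
  shows "integral {0..T} (\<lambda>t. x t \<bullet> w t + u t \<bullet> v t) = 0"
proof -
  let ?A' = "- transpose_mat A"
  have A': "?A' \<in> carrier_mat n n" and B': "transpose_mat B \<in> carrier_mat m n" using A B by auto
  \<comment> \<open>Index k stands for the first variation, indices below k for the rows of the
    endpoint condition. The costate of the former is driven by -w and ends at 0; that of the latter
    is unforced and ends at a row of \<open>M1\<close>.\<close>
  define f where "f j t = (if j = k then - w t else 0\<^sub>v n)" for j :: nat and t
  define b where "b j = (if j = k then 0\<^sub>v n else Matrix.row M1 j)" for j
  have f: "f j t \<in> carrier_vec n" for j t using w(1) by (simp add: f_def)
  have b: "b j \<in> carrier_vec n" for j using row_in_carrier[OF M1] by (simp add: b_def)
  have fs: "smooth_fun T (\<lambda>t. f j t $ i)" if "i < n" for i j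
  proof (cases "j = k")
    case True
    have "(\<lambda>t. f j t $ i) = (\<lambda>t. (-1) * w t $ i)"
      using True that carrier_vecD[OF w(1)] by (auto simp: f_def)
    then show ?thesis using smooth_fun_cmult(1)[OF T w(2)[OF that], of "-1"] by simp
  next
    case False
    then show ?thesis using that smooth_fun_const[OF T] by (simp add: f_def)
  qed
  have fc: "continuous_on {0..T} (\<lambda>t. f j t $ i)" if "i < n" for i j
    using smooth_fun_continuous[OF fs[OF that], of 0] by simp
  have "\<exists>p. (\<forall>t. p t \<in> carrier_vec n) \<and> p T = b j \<and> (\<forall>t\<in>{0..T}. \<forall>i<n.
     ((\<lambda>t. p t $ i) has_real_derivative (?A' *\<^sub>v p t + f j t) $ i) (at t within {0..T}))" for j
    using T by (intro linear_ode_forced[OF A' T _ b f fc]) auto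
  then obtain p where p: "\<And>j t. p j t \<in> carrier_vec n" "\<And>j. p j T = b j"
    "\<And>j t i. t \<in> {0..T} \<Longrightarrow> i < n \<Longrightarrow>
      ((\<lambda>t. p j t $ i) has_real_derivative (?A' *\<^sub>v p j t + f j t) $ i) (at t within {0..T})"
    by metis
  have ps: "smooth_fun T (\<lambda>t. p j t $ i)" if "i < n" for i j
    by (rule smooth_linear_ode[OF T A' p(1) f fs p(3) that])
  \<comment> \<open>Duality moves x(T) and the integral of x against w back to the initial time: g j
    is the kernel acting on u, and c j the covector acting on x(0).\<close>
  define g where "g j t = transpose_mat B *\<^sub>v p j t + (if j = k then v t else 0\<^sub>v m)" for j t
  define c where "c j = p j 0 + (if j = k then 0\<^sub>v n else Matrix.row M0 j)" for j
  have Btp: "transpose_mat B *\<^sub>v p j t \<in> carrier_vec m" for j t by (rule mult_mat_vec_carrier[OF B' p(1)])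
  have g: "g j t \<in> carrier_vec m" for j t using Btp v(1) by (simp add: g_def)
  have c: "c j \<in> carrier_vec n" for j using p(1) row_in_carrier[OF M0] by (simp add: c_def)
  have gs: "smooth_fun T (\<lambda>t. g j t $ i)" if i: "i < m" for i j
  proof -
    have e: "g j t $ i = (\<Sum>l<n. transpose_mat B $$ (i,l) * p j t $ l) + (if j = k then v t $ i else 0)" for t
      using mult_mat_vec_index_sum[OF B' p(1) i, of j t] carrier_vecD[OF v(1)] i
      by (simp add: g_def del: index_mult_mat_vec)
    show ?thesis unfolding e
    proof (rule smooth_fun_add(1)[OF T])
      show "smooth_fun T (\<lambda>t. \<Sum>l<n. transpose_mat B $$ (i,l) * p j t $ l)"
        by (intro smooth_fun_lincomb(1) T ps) auto
      show "smooth_fun T (\<lambda>t. if j = k then v t $ i else 0)"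
        using v(2)[OF i] smooth_fun_const[OF T] by (cases "j = k") auto
    qed
  qed
  have gc: "continuous_on {0..T} (\<lambda>t. g j t $ i)" if "i < m" for i j
    using smooth_fun_continuous[OF gs[OF that], of 0] by simp
  have gL: "L2_control m T (g j)" for j by (rule L2_control_continuous[OF g gc])
  have int: "(\<lambda>t. y t \<bullet> z t) integrable_on {0..T}" if "L2_control d T y" "L2_control d T z" for d y z
    using L2_control_scalar_prod[OF that] by (simp add: absolutely_integrable_on_def)
  have \<psi>: "c j \<bullet> x 0 + integral {0..T} (\<lambda>t. u t \<bullet> g j t) =
      (if j = k then integral {0..T} (\<lambda>t. x t \<bullet> w t + u t \<bullet> v t) else endpoint_value M0 M1 T x $ j)"
    if xu: "L2_trajectory A B T x u" and j: "j \<le> k" for x u j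
  proof -
    note D = L2_trajectoryD[OF A B xu]
    have x0: "x 0 \<in> carrier_vec n" and xT: "x T \<in> carrier_vec n" using D(2) T by auto
    have dual: "((\<lambda>t. u t \<bullet> (transpose_mat B *\<^sub>v p j t) + x t \<bullet> f j t) has_integral (b j \<bullet> x T - p j 0 \<bullet> x 0)) {0..T}"
      using costate_duality[OF T A B xu, of "p j" "f j"] p f fc by simp
    have ug: "((\<lambda>t. u t \<bullet> g j t) has_integral integral {0..T} (\<lambda>t. u t \<bullet> g j t)) {0..T}"
      by (rule integrable_integral[OF int[OF D(1) gL]])
    show ?thesis
    proof (cases "j = k")
      case True
      have "((\<lambda>t. u t \<bullet> g j t - (u t \<bullet> (transpose_mat B *\<^sub>v p j t) + x t \<bullet> f j t)) has_integral
         (integral {0..T} (\<lambda>t. u t \<bullet> g j t) - (b j \<bullet> x T - p j 0 \<bullet> x 0))) {0..T}"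
        by (rule has_integral_diff[OF ug dual])
      then have "((\<lambda>t. x t \<bullet> w t + u t \<bullet> v t) has_integral
         (integral {0..T} (\<lambda>t. u t \<bullet> g j t) - (b j \<bullet> x T - p j 0 \<bullet> x 0))) {0..T}"
      proof (rule has_integral_eq[rotated])
        fix t assume t: "t \<in> {0..T}"
        have "u t \<bullet> g j t = u t \<bullet> (transpose_mat B *\<^sub>v p j t) + u t \<bullet> v t"
          using True scalar_prod_add_distrib[OF D(3)[OF t] Btp v(1)] by (simp add: g_def)
        moreover have "x t \<bullet> f j t = - (x t \<bullet> w t)"
          using True D(2)[OF t] w(1)[of t] by (simp add: f_def scalar_prod_uminus_right)
        ultimately show "u t \<bullet> g j t - (u t \<bullet> (transpose_mat B *\<^sub>v p j t) + x t \<bullet> f j t) = x t \<bullet> w t + u t \<bullet> v t"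
          by simp
      qed
      then have "integral {0..T} (\<lambda>t. x t \<bullet> w t + u t \<bullet> v t)
          = integral {0..T} (\<lambda>t. u t \<bullet> g j t) - (b j \<bullet> x T - p j 0 \<bullet> x 0)" by (rule integral_unique)
      moreover have "c j = p j 0" using True p(1)[of j 0] by (simp add: c_def)
      ultimately show ?thesis using True xT by (simp add: b_def)
    next
      case False
      have "((\<lambda>t. u t \<bullet> g j t) has_integral (b j \<bullet> x T - p j 0 \<bullet> x 0)) {0..T}"
        using dual
      proof (rule has_integral_eq[rotated])
        fix t assume t: "t \<in> {0..T}"
        show "u t \<bullet> (transpose_mat B *\<^sub>v p j t) + x t \<bullet> f j t = u t \<bullet> g j t"
          using False D(2)[OF t] Btp[of j t] by (simp add: f_def g_def)
      qed
      then have "integral {0..T} (\<lambda>t. u t \<bullet> g j t) = b j \<bullet> x T - p j 0 \<bullet> x 0" by (rule integral_unique)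
      moreover have "c j \<bullet> x 0 = p j 0 \<bullet> x 0 + Matrix.row M0 j \<bullet> x 0"
        using False add_scalar_prod_distrib[OF p(1) row_in_carrier[OF M0] x0] by (simp add: c_def)
      moreover have "endpoint_value M0 M1 T x $ j = Matrix.row M0 j \<bullet> x 0 + Matrix.row M1 j \<bullet> x T"
        using False j M0 M1 by (simp add: endpoint_value_def)
      ultimately show ?thesis using False by (simp add: b_def)
    qed
  qed
  \<comment> \<open>Gram matrix of the pairs (c j, g j) in the product of R^n and L^2.\<close>
  define G where "G i j = c i \<bullet> c j + integral {0..T} (\<lambda>t. g i t \<bullet> g j t)" for i j
  have G_sym: "G i j = G j i" for i j
    by (simp add: G_def comm_scalar_prod[OF c c, of i j] comm_scalar_prod[OF g g, of i _ j])
  define C where "C \<alpha> = Matrix.vec n (\<lambda>i. \<Sum>j\<le>k. \<alpha> j * c j $ i)" for \<alpha>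
  define W where "W \<alpha> t = Matrix.vec m (\<lambda>i. \<Sum>j\<le>k. \<alpha> j * g j t $ i)" for \<alpha> t
  have C: "C \<alpha> \<in> carrier_vec n" and W: "W \<alpha> t \<in> carrier_vec m" for \<alpha> t by (simp_all add: C_def W_def)
  have Ws: "smooth_fun T (\<lambda>t. W \<alpha> t $ i)" if "i < m" for \<alpha> i
    using smooth_fun_lincomb(1)[OF T, of "{..k}" "\<lambda>j t. g j t $ i" \<alpha>] gs[OF that] that by (simp add: W_def)
  have Wc: "continuous_on {0..T} (\<lambda>t. W \<alpha> t $ i)" if "i < m" for \<alpha> i
    using smooth_fun_continuous[OF Ws[OF that], of 0] by simp
  have WL: "L2_control m T (W \<alpha>)" for \<alpha> by (rule L2_control_continuous[OF W Wc])
  have lin: "a \<bullet> C \<alpha> + integral {0..T} (\<lambda>t. z t \<bullet> W \<alpha> t)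
      = (\<Sum>j\<le>k. \<alpha> j * (a \<bullet> c j + integral {0..T} (\<lambda>t. z t \<bullet> g j t)))"
    if a: "a \<in> carrier_vec n" and z: "L2_control m T z" for a z \<alpha>
  proof -
    have "((\<lambda>t. \<Sum>j\<le>k. \<alpha> j * (z t \<bullet> g j t)) has_integral
       (\<Sum>j\<le>k. \<alpha> j * integral {0..T} (\<lambda>t. z t \<bullet> g j t))) {0..T}"
      by (intro has_integral_sum has_integral_mult_right integrable_integral int[OF z gL]) auto
    then have "((\<lambda>t. z t \<bullet> W \<alpha> t) has_integral
       (\<Sum>j\<le>k. \<alpha> j * integral {0..T} (\<lambda>t. z t \<bullet> g j t))) {0..T}"
    proof (rule has_integral_eq[rotated])
      fix t assume "t \<in> {0..T}"
      then have "z t \<in> carrier_vec m" using z by (simp add: L2_control_iff)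
      then show "(\<Sum>j\<le>k. \<alpha> j * (z t \<bullet> g j t)) = z t \<bullet> W \<alpha> t"
        unfolding W_def by (intro scalar_prod_lincomb[symmetric] g)
    qed
    then have "integral {0..T} (\<lambda>t. z t \<bullet> W \<alpha> t) = (\<Sum>j\<le>k. \<alpha> j * integral {0..T} (\<lambda>t. z t \<bullet> g j t))"
      by (rule integral_unique)
    moreover have "a \<bullet> C \<alpha> = (\<Sum>j\<le>k. \<alpha> j * (a \<bullet> c j))"
      unfolding C_def by (rule scalar_prod_lincomb[OF a c])
    ultimately show ?thesis by (simp add: distrib_left sum.distrib)
  qed
  have GW: "(\<Sum>j\<le>k. \<alpha> j * G i j) = C \<alpha> \<bullet> c i + integral {0..T} (\<lambda>t. W \<alpha> t \<bullet> g i t)" for \<alpha> i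
    unfolding G_def lin[OF c gL, symmetric]
    by (simp add: comm_scalar_prod[OF c C] comm_scalar_prod[OF g W])
  have quad: "(\<Sum>i\<le>k. \<alpha> i * (C \<alpha> \<bullet> c i + integral {0..T} (\<lambda>t. W \<alpha> t \<bullet> g i t)))
      = C \<alpha> \<bullet> C \<alpha> + integral {0..T} (\<lambda>t. W \<alpha> t \<bullet> W \<alpha> t)" for \<alpha>
    by (rule lin[OF C WL, symmetric])
  have W2: "0 \<le> integral {0..T} (\<lambda>t. W \<alpha> t \<bullet> W \<alpha> t)" for \<alpha>
    by (rule Henstock_Kurzweil_Integration.integral_nonneg[OF int[OF WL WL]]) (rule real_scalar_prod_self_ge_0)
  obtain \<alpha> where \<alpha>: "\<alpha> k = 1" "\<And>i. i < k \<Longrightarrow> (\<Sum>j\<le>k. \<alpha> j * G i j) = 0"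
  proof (rule gram_projection[of k G])
    show "0 \<le> (\<Sum>i\<le>k. \<alpha> i * (\<Sum>j\<le>k. \<alpha> j * G i j))" for \<alpha>
      unfolding GW quad using W2 real_scalar_prod_self_ge_0[of "C \<alpha>"] by simp
  qed (use G_sym in blast)+
  \<comment> \<open>The projected pair is read as data, with initial state C \<alpha> and control W
    \<alpha>; the trajectory is smooth because the kernels are.\<close>
  obtain x1 where x1: "\<And>t. x1 t \<in> carrier_vec n" "x1 0 = C \<alpha>" "\<And>t i. t \<in> {0..T} \<Longrightarrow> i < n \<Longrightarrow>
      ((\<lambda>t. x1 t $ i) has_real_derivative (A *\<^sub>v x1 t + B *\<^sub>v W \<alpha> t) $ i) (at t within {0..T})"
    and x1s: "\<And>i. i < n \<Longrightarrow> smooth_fun T (\<lambda>t. x1 t $ i)"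
  proof -
    have BW: "B *\<^sub>v W \<alpha> t \<in> carrier_vec n" for t by (rule mult_mat_vec_carrier[OF B W])
    have BWs: "smooth_fun T (\<lambda>t. (B *\<^sub>v W \<alpha> t) $ i)" if "i < n" for i
      unfolding mult_mat_vec_index_sum[OF B W that] by (intro smooth_fun_lincomb(1) T Ws) auto
    have BWc: "continuous_on {0..T} (\<lambda>t. (B *\<^sub>v W \<alpha> t) $ i)" if "i < n" for i
      using smooth_fun_continuous[OF BWs[OF that], of 0] by simp
    have "0 \<in> {0..T}" using T by simp
    from linear_ode_forced[OF A T this C[of \<alpha>] BW BWc]
    obtain x1 where x1: "\<And>t. x1 t \<in> carrier_vec n" "x1 0 = C \<alpha>" "\<And>t i. t \<in> {0..T} \<Longrightarrow> i < n \<Longrightarrow>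
      ((\<lambda>t. x1 t $ i) has_real_derivative (A *\<^sub>v x1 t + B *\<^sub>v W \<alpha> t) $ i) (at t within {0..T})" by blast
    show ?thesis
      by (rule that[OF x1]) (use smooth_linear_ode[OF T A x1(1) BW BWs x1(3)] in auto)
  qed
  let ?x = "restrict x1 {0..T}" and ?u = "restrict (W \<alpha>) {0..T}"
  have traj: "(?x, ?u) \<in> smooth_trajectories A B T"
    unfolding smooth_trajectories_def mem_Collect_eq prod.case
  proof (intro conjI ballI allI impI)
    show "?x \<in> smooth_curves T (dim_row A)" "?u \<in> smooth_curves T (dim_col B)"
      using A B x1(1) W x1s Ws by (auto intro!: smooth_curves_restrictI)
    fix t i assume t: "t \<in> {0..T}" and i: "i < dim_row A"
    have "((\<lambda>s. ?x s $ i) has_real_derivative (A *\<^sub>v x1 t + B *\<^sub>v W \<alpha> t) $ i) (at t within {0..T})"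
      by (rule has_real_derivative_agree[OF x1(3)[OF t] t]) (use i A in auto)
    then show "((\<lambda>s. ?x s $ i) has_real_derivative (A *\<^sub>v ?x t + B *\<^sub>v ?u t) $ i) (at t within {0..T})"
      using t by simp
  qed
  have trajL: "L2_trajectory A B T ?x ?u" by (rule smooth_trajectory_L2[OF A B T traj])
  have \<psi>1: "c j \<bullet> ?x 0 + integral {0..T} (\<lambda>t. ?u t \<bullet> g j t)
      = C \<alpha> \<bullet> c j + integral {0..T} (\<lambda>t. W \<alpha> t \<bullet> g j t)" for j
  proof -
    have "integral {0..T} (\<lambda>t. ?u t \<bullet> g j t) = integral {0..T} (\<lambda>t. W \<alpha> t \<bullet> g j t)"
      by (rule Henstock_Kurzweil_Integration.integral_cong) simp
    then show ?thesis using T by (simp add: x1(2) comm_scalar_prod[OF c C])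
  qed
  have "endpoint_value M0 M1 T ?x = 0\<^sub>v k"
  proof (rule eq_vecI)
    fix i assume "i < dim_vec (0\<^sub>v k :: real Matrix.vec)"
    then have i: "i < k" by simp
    then show "endpoint_value M0 M1 T ?x $ i = 0\<^sub>v k $ i"
      using \<psi>[OF trajL, of i] \<psi>1[of i] GW[of \<alpha> i] \<alpha>(2)[OF i] by simp
  qed (use M1 in \<open>simp add: endpoint_value_def\<close>)
  \<comment> \<open>Orthogonality made this trajectory satisfy all constraints, so the first
    variation vanishes on it as well. Thus (C \<alpha>, W \<alpha>) is orthogonal to every pair,
    hence to itself.\<close>
  from sm[OF traj this] have "C \<alpha> \<bullet> c k + integral {0..T} (\<lambda>t. W \<alpha> t \<bullet> g k t) = 0"
    using \<psi>[OF trajL, of k] \<psi>1[of k] by simp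
  then have "C \<alpha> \<bullet> c i + integral {0..T} (\<lambda>t. W \<alpha> t \<bullet> g i t) = 0" if "i \<le> k" for i
    using GW[of \<alpha> i] \<alpha>(2)[of i] that by (cases "i = k") auto
  then have "C \<alpha> \<bullet> C \<alpha> + integral {0..T} (\<lambda>t. W \<alpha> t \<bullet> W \<alpha> t) = 0"
    unfolding quad[symmetric] by (intro sum.neutral) auto
  then have CC: "C \<alpha> \<bullet> C \<alpha> = 0" and WW: "integral {0..T} (\<lambda>t. W \<alpha> t \<bullet> W \<alpha> t) = 0"
    using W2[of \<alpha>] real_scalar_prod_self_ge_0[of "C \<alpha>"] by linarith+
  have C0: "C \<alpha> = 0\<^sub>v n" by (rule real_scalar_prod_self_eq_0[OF C CC])
  have W0: "W \<alpha> t = 0\<^sub>v m" if t: "t \<in> {0..T}" for t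
  proof -
    have eq: "(\<lambda>t. W \<alpha> t \<bullet> W \<alpha> t) = (\<lambda>t. \<Sum>i<m. W \<alpha> t $ i * W \<alpha> t $ i)"
      using carrier_vecD[OF W] by (simp add: scalar_prod_def atLeast0LessThan)
    have "continuous_on {0..T} (\<lambda>t. W \<alpha> t \<bullet> W \<alpha> t)"
      unfolding eq by (intro continuous_intros Wc) auto
    then have "\<forall>t\<in>{0..T}. W \<alpha> t \<bullet> W \<alpha> t = 0"
      using integral_eq_0_iff[of 0 T "\<lambda>t. W \<alpha> t \<bullet> W \<alpha> t"] T WW real_scalar_prod_self_ge_0 by auto
    then show ?thesis using real_scalar_prod_self_eq_0[OF W] t by blast
  qed
  note D = L2_trajectoryD[OF A B xu]
  have x0: "x 0 \<in> carrier_vec n" using D(2) T by auto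
  \<comment> \<open>As \<alpha> k = 1 and the constraints hold for (x, u), the combination of all
    functionals reduces to the first variation; but the combined pair is 0.\<close>
  have "x 0 \<bullet> C \<alpha> + integral {0..T} (\<lambda>t. u t \<bullet> W \<alpha> t)
      = (\<Sum>j\<le>k. \<alpha> j * (x 0 \<bullet> c j + integral {0..T} (\<lambda>t. u t \<bullet> g j t)))"
    by (rule lin[OF x0 D(1)])
  also have "\<dots> = (\<Sum>j\<le>k. if j = k then integral {0..T} (\<lambda>t. x t \<bullet> w t + u t \<bullet> v t) else 0)"
  proof (intro sum.cong refl)
    fix j assume "j \<in> {..k}"
    then show "\<alpha> j * (x 0 \<bullet> c j + integral {0..T} (\<lambda>t. u t \<bullet> g j t))
       = (if j = k then integral {0..T} (\<lambda>t. x t \<bullet> w t + u t \<bullet> v t) else 0)"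
      using \<psi>[OF xu, of j] ep \<alpha>(1) comm_scalar_prod[OF x0 c, of j] by auto
  qed
  finally have "integral {0..T} (\<lambda>t. x t \<bullet> w t + u t \<bullet> v t)
      = x 0 \<bullet> C \<alpha> + integral {0..T} (\<lambda>t. u t \<bullet> W \<alpha> t)" by simp
  also have "integral {0..T} (\<lambda>t. u t \<bullet> W \<alpha> t) = integral {0..T} (\<lambda>t. 0)"
    using D(3) W0 by (intro Henstock_Kurzweil_Integration.integral_cong) simp
  finally show ?thesis using C0 x0 by simp
qed

lemma pow_mat_add:
  fixes H :: "'a :: comm_ring_1 Matrix.mat"
  assumes H: "H \<in> carrier_mat n n" shows "H ^\<^sub>m a * H ^\<^sub>m b = H ^\<^sub>m (a + b)"
proof (induction a)
  case (Suc a)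
  show ?case
    using Suc pow_mat_Suc_left[OF H, of a] pow_mat_Suc_left[OF H, of "a + b"]
      assoc_mult_mat[OF H pow_carrier_mat[OF H, of a] pow_carrier_mat[OF H, of b]] by simp
qed (use H in simp)

text \<open>The powers of \<open>H\<close> are linearly dependent; \<open>r\<close> is the least exponent with a nonzero coefficient.\<close>
lemma power_stable_left_inverse:
  fixes H :: "real Matrix.mat"
  assumes H: "H \<in> carrier_mat n n"
  obtains K r where "K \<in> carrier_mat n n" "(K * H) * H ^\<^sub>m r = H ^\<^sub>m r"
proof -
  have Hp: "H ^\<^sub>m k \<in> carrier_mat n n" for k by (rule pow_carrier_mat[OF H])
  define D where "D = n * n"
  \<comment> \<open>Column k holds the n^2 entries of H^k for k = 0, ..., n^2. The extra row of
    zeros makes the matrix square and singular, so a vanishing determinant yields the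
    dependency.\<close>
  define M where "M = Matrix.mat (Suc D) (Suc D) (\<lambda>(i,k). if i < D then (H ^\<^sub>m k) $$ (i div n, i mod n) else 0)"
  have M: "M \<in> carrier_mat (Suc D) (Suc D)" by (simp add: M_def)
  have Mt: "transpose_mat M \<in> carrier_mat (Suc D) (Suc D)" using M by simp
  have "transpose_mat M *\<^sub>v unit_vec (Suc D) D = 0\<^sub>v (Suc D)"
  proof (rule eq_vecI)
    fix i assume "i < dim_vec (0\<^sub>v (Suc D) :: real Matrix.vec)"
    then have i: "i < Suc D" by simp
    show "(transpose_mat M *\<^sub>v unit_vec (Suc D) D) $ i = 0\<^sub>v (Suc D) $ i"
      unfolding mult_mat_vec_index_sum[OF Mt unit_vec_carrier i]
      using i by (simp add: M_def unit_vec_def)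
  qed (use Mt in auto)
  moreover have "unit_vec (Suc D) D \<noteq> (0\<^sub>v (Suc D) :: real Matrix.vec)"
    by (metis index_unit_vec(1) index_zero_vec(1) lessI zero_neq_one)
  ultimately have "Determinant.det (transpose_mat M) = 0"
    using det_0_iff_vec_prod_zero_field[OF Mt] unit_vec_carrier by blast
  then have "Determinant.det M = 0" using det_transpose[OF M] by simp
  then obtain c where c: "c \<in> carrier_vec (Suc D)" "c \<noteq> 0\<^sub>v (Suc D)" "M *\<^sub>v c = 0\<^sub>v (Suc D)"
    using det_0_iff_vec_prod_zero_field[OF M] by blast
  have dep: "(\<Sum>k<Suc D. c $ k * (H ^\<^sub>m k) $$ (i,j)) = 0" if ij: "i < n" "j < n" for i j
  proof -
    have "i * n + j < Suc i * n" using ij by simp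
    also have "\<dots> \<le> D" unfolding D_def using ij by (intro mult_le_mono1) simp
    finally have lt: "i * n + j < D" .
    have "(i * n + j) div n = i" "(i * n + j) mod n = j" using ij by auto
    then have "(M *\<^sub>v c) $ (i * n + j) = (\<Sum>k<Suc D. (H ^\<^sub>m k) $$ (i,j) * c $ k)"
      unfolding mult_mat_vec_index_sum[OF M c(1) less_SucI[OF lt]] using lt by (simp add: M_def)
    then show ?thesis using c(3) lt by (simp add: mult.commute)
  qed
  have "\<exists>r. r < Suc D \<and> c $ r \<noteq> 0"
    using c(1,2) by (metis carrier_vecD eq_vecI index_zero_vec)
  then have "\<exists>r. (r < Suc D \<and> c $ r \<noteq> 0) \<and> (\<forall>k<r. \<not> (k < Suc D \<and> c $ k \<noteq> 0))"
    by (rule exists_least_iff[THEN iffD1])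
  then obtain r where r: "r < Suc D" "c $ r \<noteq> 0" and least: "\<And>k. k < r \<Longrightarrow> c $ k = 0"
    by fastforce
  \<comment> \<open>Solved from the dependency, whose terms start at k = r: after division by the
    coefficient of H^r and splitting off H^(r+1) from the higher powers it reads H^r = K
    H^(r+1).\<close>
  define K where "K = Matrix.mat n n (\<lambda>(i,j). - (1 / c $ r) * (\<Sum>k\<in>{r<..D}. c $ k * (H ^\<^sub>m (k - Suc r)) $$ (i,j)))"
  have K: "K \<in> carrier_mat n n" by (simp add: K_def)
  have "(K * H) * H ^\<^sub>m r = K * H ^\<^sub>m Suc r"
    unfolding pow_mat_Suc_left[OF H] by (rule assoc_mult_mat[OF K H Hp])
  also have "\<dots> = H ^\<^sub>m r"
  proof (rule eq_matI)
    fix i j assume "i < dim_row (H ^\<^sub>m r)" "j < dim_col (H ^\<^sub>m r)"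
    then have ij: "i < n" "j < n" using Hp[of r] by auto
    have "(K * H ^\<^sub>m Suc r) $$ (i,j) = (\<Sum>l<n. K $$ (i,l) * (H ^\<^sub>m Suc r) $$ (l,j))"
      by (rule mult_mat_index_sum[OF K Hp ij])
    also have "\<dots> = (\<Sum>l<n. \<Sum>k\<in>{r<..D}. - (1 / c $ r) * (c $ k * ((H ^\<^sub>m (k - Suc r)) $$ (i,l) * (H ^\<^sub>m Suc r) $$ (l,j))))"
      using ij by (intro sum.cong refl) (simp add: K_def sum_distrib_left sum_distrib_right mult.assoc del: pow_mat.simps)
    also have "\<dots> = (\<Sum>k\<in>{r<..D}. - (1 / c $ r) * (c $ k * (\<Sum>l<n. (H ^\<^sub>m (k - Suc r)) $$ (i,l) * (H ^\<^sub>m Suc r) $$ (l,j))))"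
      by (subst sum.swap) (simp add: sum_distrib_left del: pow_mat.simps)
    also have "\<dots> = (\<Sum>k\<in>{r<..D}. - (1 / c $ r) * (c $ k * (H ^\<^sub>m k) $$ (i,j)))"
    proof (intro sum.cong refl)
      fix k assume "k \<in> {r<..D}"
      then have "(k - Suc r) + Suc r = k" by auto
      then show "- (1 / c $ r) * (c $ k * (\<Sum>l<n. (H ^\<^sub>m (k - Suc r)) $$ (i,l) * (H ^\<^sub>m Suc r) $$ (l,j)))
         = - (1 / c $ r) * (c $ k * (H ^\<^sub>m k) $$ (i,j))"
        unfolding mult_mat_index_sum[OF Hp Hp ij, symmetric] pow_mat_add[OF H] by (simp only:)
    qed
    also have "\<dots> = - (1 / c $ r) * (\<Sum>k\<in>{r<..D}. c $ k * (H ^\<^sub>m k) $$ (i,j))"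
      by (simp only: sum_distrib_left)
    also have "(\<Sum>k\<in>{r<..D}. c $ k * (H ^\<^sub>m k) $$ (i,j)) = - (c $ r * (H ^\<^sub>m r) $$ (i,j))"
    proof -
      let ?f = "\<lambda>k. c $ k * (H ^\<^sub>m k) $$ (i,j)"
      have "{..<Suc D} = {..<r} \<union> insert r {r<..D}" using r(1) by auto
      then have "sum ?f {..<Suc D} = sum ?f ({..<r} \<union> insert r {r<..D})" by (simp only:)
      also have "\<dots> = sum ?f {..<r} + sum ?f (insert r {r<..D})" by (rule sum.union_disjoint) auto
      also have "sum ?f {..<r} = 0" using least by (intro sum.neutral) auto
      also have "sum ?f (insert r {r<..D}) = ?f r + sum ?f {r<..D}" by (rule sum.insert) auto
      finally show ?thesis using dep[OF ij] by simp
    qed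
    finally show "(K * H ^\<^sub>m Suc r) $$ (i,j) = (H ^\<^sub>m r) $$ (i,j)" using r(2) by simp
  qed (use K Hp[of r] Hp[of "Suc r"] in auto)
  finally show ?thesis using that K by blast
qed

section \<open>Semidefinite forms and recovery of a zero-cost pair from its velocity\<close>

lemma sym_psdD:
  assumes "sym_psd n Q"
  shows "Q \<in> carrier_mat n n" "v \<in> carrier_vec n \<Longrightarrow> 0 \<le> v \<bullet> (Q *\<^sub>v v)"
    "v \<in> carrier_vec n \<Longrightarrow> w \<in> carrier_vec n \<Longrightarrow> w \<bullet> (Q *\<^sub>v v) = v \<bullet> (Q *\<^sub>v w)"
proof -
  show Q: "Q \<in> carrier_mat n n" and "v \<in> carrier_vec n \<Longrightarrow> 0 \<le> v \<bullet> (Q *\<^sub>v v)"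
    using assms by (auto simp: sym_psd_def)
  assume v: "v \<in> carrier_vec n" and w: "w \<in> carrier_vec n"
  have "(transpose_mat Q *\<^sub>v w) \<bullet> v = w \<bullet> (Q *\<^sub>v v)" by (rule transpose_vec_mult_scalar[OF Q v w])
  then show "w \<bullet> (Q *\<^sub>v v) = v \<bullet> (Q *\<^sub>v w)"
    using assms comm_scalar_prod[OF mult_mat_vec_carrier[OF Q w] v] by (simp add: sym_psd_def)
qed

lemma sym_psd_quadratic_add:
  assumes Q: "sym_psd n Q" and v: "v \<in> carrier_vec n" and w: "w \<in> carrier_vec n"
  shows "(v + w) \<bullet> (Q *\<^sub>v (v + w)) = v \<bullet> (Q *\<^sub>v v) + 2 * (w \<bullet> (Q *\<^sub>v v)) + w \<bullet> (Q *\<^sub>v w)"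
proof -
  note D = sym_psdD[OF Q]
  have Qv: "Q *\<^sub>v v \<in> carrier_vec n" "Q *\<^sub>v w \<in> carrier_vec n" using D(1) v w by auto
  have "Q *\<^sub>v (v + w) = Q *\<^sub>v v + Q *\<^sub>v w" by (rule mult_add_distrib_mat_vec[OF D(1) v w])
  then have "(v + w) \<bullet> (Q *\<^sub>v (v + w)) = v \<bullet> (Q *\<^sub>v v + Q *\<^sub>v w) + w \<bullet> (Q *\<^sub>v v + Q *\<^sub>v w)"
    using add_scalar_prod_distrib[OF v w, of "Q *\<^sub>v v + Q *\<^sub>v w"] Qv by simp
  also have "\<dots> = v \<bullet> (Q *\<^sub>v v) + v \<bullet> (Q *\<^sub>v w) + (w \<bullet> (Q *\<^sub>v v) + w \<bullet> (Q *\<^sub>v w))"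
    using scalar_prod_add_distrib[OF v Qv] scalar_prod_add_distrib[OF w Qv] by simp
  finally show ?thesis using D(3)[OF v w] by simp
qed

text \<open>The quadratic 2 s c + s^2 d is evaluated close to its minimizer s = -c/d, where a
  nonzero c makes it negative; the + 1 in the denominator covers d = 0.\<close>

lemma quadratic_minimum_zero:
  fixes c d :: real
  assumes d: "0 \<le> d" and q: "0 \<le> 2 * (- c / (d + 1)) * c + (- c / (d + 1))\<^sup>2 * d"
  shows "c = 0"
proof -
  define k where "k = c / (d + 1)"
  have e: "k * (d + 1) = c" using d by (simp add: k_def)
  have q: "0 \<le> 2 * (- k) * c + (- k)\<^sup>2 * d" using q by (simp add: k_def)
  have "(2 * (- k) * c + (- k)\<^sup>2 * d) * (d + 1)\<^sup>2 = - 2 * c * (k * (d + 1)) * (d + 1) + (k * (d + 1))\<^sup>2 * d"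
    by (simp add: power2_eq_square algebra_simps)
  also have "\<dots> = - (c\<^sup>2 * (d + 2))" unfolding e by (simp add: power2_eq_square algebra_simps)
  finally have "0 \<le> - (c\<^sup>2 * (d + 2))" using mult_nonneg_nonneg[OF q zero_le_power2[of "d + 1"]] by simp
  then show ?thesis using d by (simp add: mult_le_0_iff)
qed

text \<open>A vector of value 0 minimizes the form, so the form cannot decrease along v + s Qv; its
  slope at s = 0 is 2 |Qv|^2.\<close>

lemma sym_psd_kernel:
  assumes Q: "sym_psd n Q" and v: "v \<in> carrier_vec n" and 0: "v \<bullet> (Q *\<^sub>v v) = 0"
  shows "Q *\<^sub>v v = 0\<^sub>v n"
proof -
  note D = sym_psdD[OF Q]
  let ?w = "Q *\<^sub>v v"
  have w: "?w \<in> carrier_vec n" using D(1) v by simp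
  let ?c = "?w \<bullet> ?w" and ?d = "?w \<bullet> (Q *\<^sub>v ?w)"
  have d: "0 \<le> ?d" by (rule D(2)[OF w])
  have "0 \<le> 2 * s * ?c + s\<^sup>2 * ?d" for s
  proof -
    have "0 \<le> (v + s \<cdot>\<^sub>v ?w) \<bullet> (Q *\<^sub>v (v + s \<cdot>\<^sub>v ?w))" using D(2)[of "v + s \<cdot>\<^sub>v ?w"] v w by simp
    also have "\<dots> = 2 * ((s \<cdot>\<^sub>v ?w) \<bullet> ?w) + (s \<cdot>\<^sub>v ?w) \<bullet> (Q *\<^sub>v (s \<cdot>\<^sub>v ?w))"
      using sym_psd_quadratic_add[OF Q v, of "s \<cdot>\<^sub>v ?w"] w 0 by simp
    also have "Q *\<^sub>v (s \<cdot>\<^sub>v ?w) = s \<cdot>\<^sub>v (Q *\<^sub>v ?w)" by (rule mult_mat_vec[OF D(1) w])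
    also have "(s \<cdot>\<^sub>v ?w) \<bullet> (s \<cdot>\<^sub>v (Q *\<^sub>v ?w)) = s\<^sup>2 * ?d"
      using w D(1) by (simp add: power2_eq_square)
    also have "(s \<cdot>\<^sub>v ?w) \<bullet> ?w = s * ?c" using w by simp
    finally show ?thesis by (simp add: mult.assoc)
  qed
  from quadratic_minimum_zero[OF d this] have "?c = 0" .
  then show ?thesis by (rule real_scalar_prod_self_eq_0[OF w])
qed

text \<open>The matrix \<open>[Q + A\<^sup>T A, A\<^sup>T B; B\<^sup>T A, R + B\<^sup>T B]\<close> is positive definite, and on pairs with \<open>Q a = 0\<close>, \<open>R b = 0\<close>
  its value only depends on \<open>A a + B b\<close>.\<close>
lemma zero_cost_reconstruction:
  assumes A: "A \<in> carrier_mat n n" and B: "B \<in> carrier_mat n m" and Q: "sym_psd n Q" and R: "sym_psd m R"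
    and inj: "\<And>a b. a \<in> carrier_vec n \<Longrightarrow> b \<in> carrier_vec m \<Longrightarrow> Q *\<^sub>v a = 0\<^sub>v n \<Longrightarrow> R *\<^sub>v b = 0\<^sub>v m
       \<Longrightarrow> A *\<^sub>v a + B *\<^sub>v b = 0\<^sub>v n \<Longrightarrow> a = 0\<^sub>v n \<and> b = 0\<^sub>v m"
  obtains Hx Hu where "Hx \<in> carrier_mat n n" "Hu \<in> carrier_mat m n"
    "\<And>a b. a \<in> carrier_vec n \<Longrightarrow> b \<in> carrier_vec m \<Longrightarrow> Q *\<^sub>v a = 0\<^sub>v n \<Longrightarrow> R *\<^sub>v b = 0\<^sub>v m
       \<Longrightarrow> a = Hx *\<^sub>v (A *\<^sub>v a + B *\<^sub>v b) \<and> b = Hu *\<^sub>v (A *\<^sub>v a + B *\<^sub>v b)"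
proof -
  note Qc = sym_psdD(1)[OF Q] and Rc = sym_psdD(1)[OF R]
  let ?At = "transpose_mat A" and ?Bt = "transpose_mat B"
  have At: "?At \<in> carrier_mat n n" and Bt: "?Bt \<in> carrier_mat m n" using A B by auto
  define S where "S = four_block_mat (Q + ?At * A) (?At * B) (?Bt * A) (R + ?Bt * B)"
  have blocks: "Q + ?At * A \<in> carrier_mat n n" "?At * B \<in> carrier_mat n m"
    "?Bt * A \<in> carrier_mat m n" "R + ?Bt * B \<in> carrier_mat m m"
    using A B Qc Rc by auto
  have S: "S \<in> carrier_mat (n + m) (n + m)"
    unfolding S_def by (rule four_block_carrier_mat[OF blocks(1,4)])
  have Sab: "S *\<^sub>v (a @\<^sub>v b) = (Q *\<^sub>v a + ?At *\<^sub>v (A *\<^sub>v a + B *\<^sub>v b)) @\<^sub>v (R *\<^sub>v b + ?Bt *\<^sub>v (A *\<^sub>v a + B *\<^sub>v b))"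
    if a: "a \<in> carrier_vec n" and b: "b \<in> carrier_vec m" for a b
  proof -
    have Aa: "A *\<^sub>v a \<in> carrier_vec n" and Bb: "B *\<^sub>v b \<in> carrier_vec n" using A B a b by auto
    have "(Q + ?At * A) *\<^sub>v a + (?At * B) *\<^sub>v b = Q *\<^sub>v a + ?At *\<^sub>v (A *\<^sub>v a + B *\<^sub>v b)"
      using add_mult_distrib_mat_vec[OF Qc mult_carrier_mat[OF At A] a] assoc_mult_mat_vec[OF At A a]
        assoc_mult_mat_vec[OF At B b] mult_add_distrib_mat_vec[OF At Aa Bb]
        assoc_add_vec[OF mult_mat_vec_carrier[OF Qc a] mult_mat_vec_carrier[OF At Aa] mult_mat_vec_carrier[OF At Bb]]
      by simp
    moreover have "(?Bt * A) *\<^sub>v a + (R + ?Bt * B) *\<^sub>v b = R *\<^sub>v b + ?Bt *\<^sub>v (A *\<^sub>v a + B *\<^sub>v b)"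
    proof -
      let ?r = "R *\<^sub>v b" and ?p = "?Bt *\<^sub>v (A *\<^sub>v a)" and ?q = "?Bt *\<^sub>v (B *\<^sub>v b)"
      have c: "?r \<in> carrier_vec m" "?p \<in> carrier_vec m" "?q \<in> carrier_vec m"
        using Rc b Bt Aa Bb by (auto intro: mult_mat_vec_carrier)
      have "?p + (?r + ?q) = ?r + (?p + ?q)" using c by (intro eq_vecI) auto
      then show ?thesis
        using add_mult_distrib_mat_vec[OF Rc mult_carrier_mat[OF Bt B] b] assoc_mult_mat_vec[OF Bt A a]
          assoc_mult_mat_vec[OF Bt B b] mult_add_distrib_mat_vec[OF Bt Aa Bb] by simp
    qed
    ultimately show ?thesis
      unfolding S_def four_block_mat_mult_vec[OF blocks a b] by simp
  qed
  have "z = 0\<^sub>v (n + m)" if z: "z \<in> carrier_vec (n + m)" and Sz: "S *\<^sub>v z = 0\<^sub>v (n + m)" for z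
  proof -
    define a b where "a = vec_first z n" and "b = vec_last z m"
    have a: "a \<in> carrier_vec n" and b: "b \<in> carrier_vec m" by (simp_all add: a_def b_def)
    have zab: "z = a @\<^sub>v b" using z by (simp add: a_def b_def)
    let ?h = "A *\<^sub>v a + B *\<^sub>v b"
    have h: "?h \<in> carrier_vec n" using A B a b by simp
    have c: "Q *\<^sub>v a \<in> carrier_vec n" "?At *\<^sub>v ?h \<in> carrier_vec n" "R *\<^sub>v b \<in> carrier_vec m" "?Bt *\<^sub>v ?h \<in> carrier_vec m"
      using Qc Rc At Bt a b h by (auto intro: mult_mat_vec_carrier)
    have z0: "0\<^sub>v (n + m) = 0\<^sub>v n @\<^sub>v (0\<^sub>v m :: real Matrix.vec)" by (intro eq_vecI) auto
    have "(Q *\<^sub>v a + ?At *\<^sub>v ?h) @\<^sub>v (R *\<^sub>v b + ?Bt *\<^sub>v ?h) = 0\<^sub>v n @\<^sub>v 0\<^sub>v m"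
      using Sz[unfolded zab Sab[OF a b] z0] .
    then have e: "Q *\<^sub>v a + ?At *\<^sub>v ?h = 0\<^sub>v n" "R *\<^sub>v b + ?Bt *\<^sub>v ?h = 0\<^sub>v m"
      using append_vec_eq[of "Q *\<^sub>v a + ?At *\<^sub>v ?h" n "0\<^sub>v n"] c by auto
    \<comment> \<open>S z = 0 is tested against z: the nonnegative terms belonging to Qa, Rb and |Aa
      + Bb|^2 add up to 0.\<close>
    have "a \<bullet> (Q *\<^sub>v a) + a \<bullet> (?At *\<^sub>v ?h) = 0" "b \<bullet> (R *\<^sub>v b) + b \<bullet> (?Bt *\<^sub>v ?h) = 0"
      using scalar_prod_add_distrib[OF a c(1,2)] scalar_prod_add_distrib[OF b c(3,4)] e a b by auto
    moreover have "a \<bullet> (?At *\<^sub>v ?h) = ?h \<bullet> (A *\<^sub>v a)" "b \<bullet> (?Bt *\<^sub>v ?h) = ?h \<bullet> (B *\<^sub>v b)"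
      using transpose_vec_mult_scalar[OF A a h] transpose_vec_mult_scalar[OF B b h]
        comm_scalar_prod[OF a c(2)] comm_scalar_prod[OF b c(4)] by auto
    moreover have "?h \<bullet> ?h = ?h \<bullet> (A *\<^sub>v a) + ?h \<bullet> (B *\<^sub>v b)"
      using A B a b by (intro scalar_prod_add_distrib[OF h]) auto
    ultimately have "?h \<bullet> ?h = 0"
      using sym_psdD(2)[OF Q a] sym_psdD(2)[OF R b] real_scalar_prod_self_ge_0[of ?h] by linarith
    then have h0: "?h = 0\<^sub>v n" by (rule real_scalar_prod_self_eq_0[OF h])
    have "?At *\<^sub>v 0\<^sub>v n = 0\<^sub>v n" "?Bt *\<^sub>v 0\<^sub>v n = 0\<^sub>v m" using At Bt by (auto intro!: eq_vecI)
    then have "Q *\<^sub>v a = 0\<^sub>v n" "R *\<^sub>v b = 0\<^sub>v m" using e c unfolding h0 by auto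
    from inj[OF a b this h0] show ?thesis unfolding zab by auto
  qed
  then obtain P where P: "P \<in> carrier_mat (n + m) (n + m)" "P * S = 1\<^sub>m (n + m)"
    using inverse_mat_exists[OF S] by blast
  \<comment> \<open>V stacks A^T on B^T. If Qa = 0 and Rb = 0, then S maps (a, b) to V (Aa + Bb), so
    the two row blocks of P V recover a and b.\<close>
  define V where "V = Matrix.mat (n + m) n (\<lambda>(i,j). if i < n then A $$ (j,i) else B $$ (j,i - n))"
  have V: "V \<in> carrier_mat (n + m) n" by (simp add: V_def)
  have Vh: "V *\<^sub>v h = (?At *\<^sub>v h) @\<^sub>v (?Bt *\<^sub>v h)" if h: "h \<in> carrier_vec n" for h
  proof (rule eq_vecI)
    fix i assume "i < dim_vec ((?At *\<^sub>v h) @\<^sub>v (?Bt *\<^sub>v h))"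
    then have i: "i < n + m" using A B by simp
    show "(V *\<^sub>v h) $ i = ((?At *\<^sub>v h) @\<^sub>v (?Bt *\<^sub>v h)) $ i"
    proof (cases "i < n")
      case True
      then show ?thesis
        using mult_mat_vec_index_sum[OF V h i] mult_mat_vec_index_sum[OF At h True] i A B
        by (simp add: V_def del: index_mult_mat_vec)
    next
      case False
      then have i': "i - n < m" using i by simp
      show ?thesis
        using mult_mat_vec_index_sum[OF V h i] mult_mat_vec_index_sum[OF Bt h i'] i i' A B False
        by (simp add: V_def del: index_mult_mat_vec)
    qed
  qed (use V A B in auto)
  have PV: "P * V \<in> carrier_mat (n + m) n" by (rule mult_carrier_mat[OF P(1) V])
  define Hx where "Hx = Matrix.mat n n (\<lambda>(i,j). (P * V) $$ (i,j))"
  define Hu where "Hu = Matrix.mat m n (\<lambda>(i,j). (P * V) $$ (n + i,j))"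
  have Hx: "Hx \<in> carrier_mat n n" and Hu: "Hu \<in> carrier_mat m n" by (simp_all add: Hx_def Hu_def)
  show ?thesis
  proof (rule that[OF Hx Hu])
    fix a b assume a: "a \<in> carrier_vec n" and b: "b \<in> carrier_vec m"
      and Qa: "Q *\<^sub>v a = 0\<^sub>v n" and Rb: "R *\<^sub>v b = 0\<^sub>v m"
    let ?h = "A *\<^sub>v a + B *\<^sub>v b"
    have h: "?h \<in> carrier_vec n" using A B a b by simp
    have ab: "a @\<^sub>v b \<in> carrier_vec (n + m)" using a b by simp
    have "S *\<^sub>v (a @\<^sub>v b) = V *\<^sub>v ?h"
      unfolding Sab[OF a b] Vh[OF h] Qa Rb using At Bt h by simp
    then have e: "a @\<^sub>v b = (P * V) *\<^sub>v ?h"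
      using assoc_mult_mat_vec[OF P(1) S ab] assoc_mult_mat_vec[OF P(1) V h] P(2) ab by simp
    have "a $ i = (Hx *\<^sub>v ?h) $ i" if i: "i < n" for i
    proof -
      have "a $ i = (a @\<^sub>v b) $ i" using i a b by simp
      also have "\<dots> = (\<Sum>j<n. (P * V) $$ (i,j) * ?h $ j)"
        unfolding e by (rule mult_mat_vec_index_sum[OF PV h]) (use i in simp)
      also have "\<dots> = (Hx *\<^sub>v ?h) $ i"
        unfolding mult_mat_vec_index_sum[OF Hx h i] using i by (simp add: Hx_def)
      finally show ?thesis .
    qed
    moreover have "b $ i = (Hu *\<^sub>v ?h) $ i" if i: "i < m" for i
    proof -
      have "b $ i = (a @\<^sub>v b) $ (n + i)" using i a b by simp
      also have "\<dots> = (\<Sum>j<n. (P * V) $$ (n + i,j) * ?h $ j)"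
        unfolding e by (rule mult_mat_vec_index_sum[OF PV h]) (use i in simp)
      also have "\<dots> = (Hu *\<^sub>v ?h) $ i"
        unfolding mult_mat_vec_index_sum[OF Hu h i] using i by (simp add: Hu_def)
      finally show ?thesis .
    qed
    ultimately show "a = Hx *\<^sub>v ?h \<and> b = Hu *\<^sub>v ?h"
      using a b Hx Hu by (intro conjI eq_vecI) (auto simp del: index_mult_mat_vec)
  qed
qed

lemma continuous_indefinite_integral_zero:
  fixes f :: "real \<Rightarrow> real"
  assumes T: "0 < T" and f: "continuous_on {0..T} f" and 0: "\<And>t. t \<in> {0..T} \<Longrightarrow> integral {0..t} f = 0"
    and t: "t \<in> {0..T}"
  shows "f t = 0"
proof -
  let ?F = "\<lambda>t. integral {0..t} f"
  have u: "vector_derivative ?F (at t within {0..T}) = d" if "(?F has_vector_derivative d) (at t within {0..T})" for d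
    using vector_derivative_within_cbox[of 0 T t ?F d] that T t by simp
  have 1: "(?F has_vector_derivative f t) (at t within {0..T})"
    using integral_has_real_derivative[OF f t] by (simp add: has_real_derivative_iff_has_vector_derivative)
  have 2: "(?F has_vector_derivative 0) (at t within {0..T})"
    by (rule has_vector_derivative_agree[of "\<lambda>t. 0"]) (use 0 t in auto)
  show ?thesis using u[OF 1] u[OF 2] by simp
qed

lemma integral_cong_AE_interval:
  fixes f g :: "real \<Rightarrow> real"
  assumes "AE t in lebesgue. t \<in> {0..T} \<longrightarrow> f t = g t" "s \<in> {0..T}"
  shows "integral {0..s} f = integral {0..s} g"
proof -
  obtain N where "negligible N" "{t. \<not> (t \<in> {0..T} \<longrightarrow> f t = g t)} \<subseteq> N"
    using assms(1) unfolding eventually_ae_filter_negligible by blast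
  then show ?thesis using assms(2) by (intro integral_spike[of N]) auto
qed

lemma continuous_AE_zero:
  fixes f :: "real \<Rightarrow> real"
  assumes T: "0 < T" and f: "continuous_on {0..T} f" and ae: "AE t in lebesgue. t \<in> {0..T} \<longrightarrow> f t = 0"
    and t: "t \<in> {0..T}"
  shows "f t = 0"
  using continuous_indefinite_integral_zero[OF T f _ t] integral_cong_AE_interval[OF ae] by simp

text \<open>Along a zero-cost trajectory \<open>(x, u) = (H x', H' x')\<close>. Hence \<open>x\<close> takes values in the range of every power
  of \<open>H\<close>, on which \<open>H\<close> is eventually invertible, and \<open>x\<close> solves a linear equation \<open>x' = K x\<close>.\<close>
lemma zero_cost_trajectory_smooth:
  assumes T: "0 < T" and A: "A \<in> carrier_mat n n" and B: "B \<in> carrier_mat n m"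
    and Q: "sym_psd n Q" and R: "sym_psd m R"
    and inj: "\<And>a b. a \<in> carrier_vec n \<Longrightarrow> b \<in> carrier_vec m \<Longrightarrow> Q *\<^sub>v a = 0\<^sub>v n \<Longrightarrow> R *\<^sub>v b = 0\<^sub>v m
       \<Longrightarrow> A *\<^sub>v a + B *\<^sub>v b = 0\<^sub>v n \<Longrightarrow> a = 0\<^sub>v n \<and> b = 0\<^sub>v m"
    and xu: "L2_trajectory A B T x u"
    and Q0: "AE t in lebesgue. t \<in> {0..T} \<longrightarrow> Q *\<^sub>v x t = 0\<^sub>v n"
    and R0: "AE t in lebesgue. t \<in> {0..T} \<longrightarrow> R *\<^sub>v u t = 0\<^sub>v m"
  obtains x' u' where "(x', u') \<in> smooth_trajectories A B T" "\<And>t. t \<in> {0..T} \<Longrightarrow> x t = x' t"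
    "AE t in lebesgue. t \<in> {0..T} \<longrightarrow> u t = u' t"
    "\<And>t. t \<in> {0..T} \<Longrightarrow> Q *\<^sub>v x' t = 0\<^sub>v n" "\<And>t. t \<in> {0..T} \<Longrightarrow> R *\<^sub>v u' t = 0\<^sub>v m"
proof -
  note D = L2_trajectoryD[OF A B xu]
  note Qc = sym_psdD(1)[OF Q] and Rc = sym_psdD(1)[OF R]
  obtain Hx Hu where Hx: "Hx \<in> carrier_mat n n" and Hu: "Hu \<in> carrier_mat m n"
    and H: "\<And>a b. a \<in> carrier_vec n \<Longrightarrow> b \<in> carrier_vec m \<Longrightarrow> Q *\<^sub>v a = 0\<^sub>v n \<Longrightarrow> R *\<^sub>v b = 0\<^sub>v m
       \<Longrightarrow> a = Hx *\<^sub>v (A *\<^sub>v a + B *\<^sub>v b) \<and> b = Hu *\<^sub>v (A *\<^sub>v a + B *\<^sub>v b)"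
    using zero_cost_reconstruction[OF A B Q R inj] by blast
  obtain K r where K: "K \<in> carrier_mat n n" and KH: "(K * Hx) * Hx ^\<^sub>m r = Hx ^\<^sub>m r"
    using power_stable_left_inverse[OF Hx] .
  let ?h = "\<lambda>t. A *\<^sub>v x t + B *\<^sub>v u t"
  have hc: "?h t \<in> carrier_vec n" if "t \<in> {0..T}" for t using D(2,3)[OF that] A B by simp
  have ae: "AE t in lebesgue. t \<in> {0..T} \<longrightarrow> x t = Hx *\<^sub>v ?h t \<and> u t = Hu *\<^sub>v ?h t"
    using Q0 R0 by eventually_elim (use H D(2,3) in blast)
  have x0: "x 0 \<in> carrier_vec n" using D(2) T by auto
  have hint: "integral {0..t} (\<lambda>s. ?h s $ i) = x t $ i - x 0 $ i" if "i < n" "t \<in> {0..T}" for i t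
    using D(5)[OF that] by simp
  have hi: "(\<lambda>s. ?h s $ i) integrable_on {0..t}" if "i < n" "t \<in> {0..T}" for i t
    using absolutely_integrable_on_subinterval[OF D(4)[OF that(1)], of 0 t] that(2)
    by (simp add: absolutely_integrable_on_def)
  \<comment> \<open>x' is available only as the integrable function A x + B u. Linear relations for
    it are therefore integrated, which replaces it by x t - x 0.\<close>
  have Mint: "integral {0..t} (\<lambda>s. (M *\<^sub>v ?h s) $ i) = (M *\<^sub>v (x t - x 0)) $ i"
    if M: "M \<in> carrier_mat d n" and i: "i < d" and t: "t \<in> {0..T}" for M d i t
  proof -
    have "integral {0..t} (\<lambda>s. (M *\<^sub>v ?h s) $ i) = integral {0..t} (\<lambda>s. \<Sum>j<n. M $$ (i,j) * ?h s $ j)"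
      using mult_mat_vec_index_sum[OF M hc i] t by (intro Henstock_Kurzweil_Integration.integral_cong) auto
    also have "\<dots> = (\<Sum>j<n. M $$ (i,j) * (x t $ j - x 0 $ j))"
      using hi[OF _ t] hint[OF _ t]
      by (subst Henstock_Kurzweil_Integration.integral_sum) (auto intro!: integrable_on_mult_right)
    also have "\<dots> = (M *\<^sub>v (x t - x 0)) $ i"
      using mult_mat_vec_index_sum[OF M _ i, of "x t - x 0"] D(2)[OF t] x0 by simp
    finally show ?thesis .
  qed
  have xint: "integral {0..t} (\<lambda>s. x s $ i) = (Hx *\<^sub>v (x t - x 0)) $ i" if "i < n" "t \<in> {0..T}" for i t
  proof -
    have "AE t in lebesgue. t \<in> {0..T} \<longrightarrow> x t $ i = (Hx *\<^sub>v ?h t) $ i" using ae by eventually_elim metis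
    from integral_cong_AE_interval[OF this that(2)] show ?thesis using Mint[OF Hx that] by simp
  qed
  have uint: "integral {0..t} (\<lambda>s. u s $ i) = (Hu *\<^sub>v (x t - x 0)) $ i" if "i < m" "t \<in> {0..T}" for i t
  proof -
    have "AE t in lebesgue. t \<in> {0..T} \<longrightarrow> u t $ i = (Hu *\<^sub>v ?h t) $ i" using ae by eventually_elim metis
    from integral_cong_AE_interval[OF this that(2)] show ?thesis using Mint[OF Hu that] by simp
  qed
  have xii: "(\<lambda>s. x s $ i) integrable_on {0..t}" if "i < n" "t \<in> {0..T}" for i t
    using that by (intro integrable_continuous_interval continuous_on_subset[OF D(6)]) auto
  \<comment> \<open>If \<rho> kills the range of H^(k+1), then H^T \<rho> kills that of H^k, so by
    induction \<rho> is orthogonal to H x(t). The integral of \<rho> against x equals \<rho> against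
    H (x(t) - x(0)) and is thus 0 for all t.\<close>
  have annih: "\<rho> \<bullet> x t = 0"
    if "\<rho> \<in> carrier_vec n" "\<And>z. z \<in> carrier_vec n \<Longrightarrow> \<rho> \<bullet> (Hx ^\<^sub>m k *\<^sub>v z) = 0" "t \<in> {0..T}" for \<rho> k t
    using that
  proof (induction k arbitrary: \<rho> t)
    case 0
    then show ?case using D(2)[of t] Hx by simp
  next
    case (Suc k)
    note \<rho> = Suc.prems(1)
    let ?\<rho>' = "transpose_mat Hx *\<^sub>v \<rho>"
    have \<rho>': "?\<rho>' \<in> carrier_vec n" using Hx \<rho> by simp
    have "?\<rho>' \<bullet> (Hx ^\<^sub>m k *\<^sub>v z) = 0" if z: "z \<in> carrier_vec n" for z
    proof -
      have Hz: "Hx ^\<^sub>m k *\<^sub>v z \<in> carrier_vec n" by (rule mult_mat_vec_carrier[OF pow_carrier_mat[OF Hx] z])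
      have "?\<rho>' \<bullet> (Hx ^\<^sub>m k *\<^sub>v z) = \<rho> \<bullet> (Hx *\<^sub>v (Hx ^\<^sub>m k *\<^sub>v z))"
        by (rule transpose_vec_mult_scalar[OF Hx Hz \<rho>])
      also have "\<dots> = \<rho> \<bullet> (Hx ^\<^sub>m Suc k *\<^sub>v z)"
        unfolding pow_mat_Suc_left[OF Hx] using assoc_mult_mat_vec[OF Hx pow_carrier_mat[OF Hx] z] by simp
      finally show ?thesis using Suc.prems(2)[OF z] by simp
    qed
    then have "?\<rho>' \<bullet> x t = 0" if "t \<in> {0..T}" for t using Suc.IH[OF \<rho>'] that by blast
    then have \<rho>H: "\<rho> \<bullet> (Hx *\<^sub>v x t) = 0" if "t \<in> {0..T}" for t
      using transpose_vec_mult_scalar[OF Hx D(2)[OF that] \<rho>] that by simp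
    have eq: "(\<Sum>i<n. \<rho> $ i * x t $ i) = \<rho> \<bullet> x t" if "t \<in> {0..T}" for t
      using carrier_vecD[OF D(2)[OF that]] by (simp add: scalar_prod_def atLeast0LessThan)
    have "(\<Sum>i<n. \<rho> $ i * x t $ i) = 0"
    proof (rule continuous_indefinite_integral_zero[OF T _ _ Suc.prems(3)])
      show "continuous_on {0..T} (\<lambda>t. \<Sum>i<n. \<rho> $ i * x t $ i)"
        by (intro continuous_intros D(6)) auto
      fix t assume t: "t \<in> {0..T}"
      have Hd: "Hx *\<^sub>v (x t - x 0) \<in> carrier_vec n" by (rule mult_mat_vec_in_carrier[OF Hx])
      have "integral {0..t} (\<lambda>t. \<Sum>i<n. \<rho> $ i * x t $ i) = (\<Sum>i<n. \<rho> $ i * (Hx *\<^sub>v (x t - x 0)) $ i)"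
        using xii[OF _ t] xint[OF _ t]
        by (subst Henstock_Kurzweil_Integration.integral_sum)
          (auto intro!: integrable_on_mult_right simp del: index_mult_mat_vec)
      also have "\<dots> = \<rho> \<bullet> (Hx *\<^sub>v (x t - x 0))"
        using carrier_vecD[OF Hd] by (simp only: scalar_prod_def atLeast0LessThan)
      also have "Hx *\<^sub>v (x t - x 0) = Hx *\<^sub>v x t - Hx *\<^sub>v x 0"
        by (rule mult_minus_distrib_mat_vec[OF Hx D(2)[OF t] x0])
      also have "\<rho> \<bullet> (Hx *\<^sub>v x t - Hx *\<^sub>v x 0) = \<rho> \<bullet> (Hx *\<^sub>v x t) - \<rho> \<bullet> (Hx *\<^sub>v x 0)"
        using \<rho> Hx D(2)[OF t] x0 by (intro scalar_prod_minus_distrib) auto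
      also have "\<dots> = 0" using \<rho>H[OF t] \<rho>H[of 0] T by simp
      finally show "integral {0..t} (\<lambda>t. \<Sum>i<n. \<rho> $ i * x t $ i) = 0" .
    qed
    then show ?case using eq[OF Suc.prems(3)] by simp
  qed
  have xK: "x t = K *\<^sub>v (Hx *\<^sub>v x t)" if t: "t \<in> {0..T}" for t
  proof (rule eq_vecI)
    have KHc: "K * Hx \<in> carrier_mat n n" by (rule mult_carrier_mat[OF K Hx])
    fix i assume "i < dim_vec (K *\<^sub>v (Hx *\<^sub>v x t))"
    then have i: "i < n" using K by simp
    \<comment> \<open>A row of 1 - K H vanishes on the range of H^r by the choice of K, hence on the
      values of x.\<close>
    let ?\<rho> = "unit_vec n i - Matrix.row (K * Hx) i"
    have rc: "Matrix.row (K * Hx) i \<in> carrier_vec n" by (rule row_in_carrier[OF KHc])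
    have e: "?\<rho> \<bullet> z = z $ i - ((K * Hx) *\<^sub>v z) $ i" if z: "z \<in> carrier_vec n" for z
      using minus_scalar_prod_distrib[OF unit_vec_carrier rc z, of i] scalar_prod_left_unit[OF z i] i KHc K by simp
    have "?\<rho> \<bullet> x t = 0"
    proof (rule annih[OF _ _ t])
      show "?\<rho> \<in> carrier_vec n" using rc by simp
      fix z :: "real Matrix.vec" assume z: "z \<in> carrier_vec n"
      have Hz: "Hx ^\<^sub>m r *\<^sub>v z \<in> carrier_vec n" by (rule mult_mat_vec_carrier[OF pow_carrier_mat[OF Hx] z])
      have "(K * Hx) *\<^sub>v (Hx ^\<^sub>m r *\<^sub>v z) = Hx ^\<^sub>m r *\<^sub>v z"
        using assoc_mult_mat_vec[OF KHc pow_carrier_mat[OF Hx] z, of r] KH by simp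
      then show "?\<rho> \<bullet> (Hx ^\<^sub>m r *\<^sub>v z) = 0" using e[OF Hz] by simp
    qed
    then show "x t $ i = (K *\<^sub>v (Hx *\<^sub>v x t)) $ i"
      using e[OF D(2)[OF t]] assoc_mult_mat_vec[OF K Hx D(2)[OF t]] by simp
  qed (use K D(2)[OF t] in auto)
  \<comment> \<open>x is continuous, so the integrated form of x = H x' shows that H x is
    differentiable with derivative x. Applying K gives x' = K x.\<close>
  have dHx: "((\<lambda>s. (Hx *\<^sub>v x s) $ i) has_real_derivative x t $ i) (at t within {0..T})"
    if i: "i < n" and t: "t \<in> {0..T}" for i t
  proof -
    have "((\<lambda>s. (Hx *\<^sub>v x 0) $ i + integral {0..s} (\<lambda>s. x s $ i)) has_real_derivative x t $ i) (at t within {0..T})"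
      using integral_has_real_derivative[OF D(6)[OF i] t] by (auto intro!: derivative_eq_intros)
    then show ?thesis
    proof (rule has_real_derivative_agree[OF _ t])
      fix s assume s: "s \<in> {0..T}"
      show "(Hx *\<^sub>v x s) $ i = (Hx *\<^sub>v x 0) $ i + integral {0..s} (\<lambda>s. x s $ i)"
        unfolding xint[OF i s] mult_minus_distrib_mat_vec[OF Hx D(2)[OF s] x0] using i Hx
        by (simp del: index_mult_mat_vec)
    qed
  qed
  have dx: "((\<lambda>s. x s $ i) has_real_derivative (K *\<^sub>v x t) $ i) (at t within {0..T})"
    if i: "i < n" and t: "t \<in> {0..T}" for i t
  proof -
    have Hxx: "Hx *\<^sub>v x s \<in> carrier_vec n" for s by (rule mult_mat_vec_in_carrier[OF Hx])
    have "((\<lambda>s. \<Sum>j<n. K $$ (i,j) * (Hx *\<^sub>v x s) $ j) has_real_derivative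
        (\<Sum>j<n. K $$ (i,j) * x t $ j)) (at t within {0..T})"
      using t by (intro DERIV_sum DERIV_cmult dHx) auto
    then have "((\<lambda>s. (K *\<^sub>v (Hx *\<^sub>v x s)) $ i) has_real_derivative (K *\<^sub>v x t) $ i) (at t within {0..T})"
      unfolding mult_mat_vec_index_sum[OF K Hxx i] mult_mat_vec_index_sum[OF K D(2)[OF t] i] .
    then show ?thesis by (rule has_real_derivative_agree[OF _ t]) (use xK in simp)
  qed
  have xs: "smooth_fun T (\<lambda>t. x t $ i)" if "i < n" for i
  proof (rule smooth_linear_ode[OF T K D(2), of _ "\<lambda>_. 0\<^sub>v n"])
    fix t i assume t: "t \<in> {0..T}" and i: "i < n"
    show "((\<lambda>s. x s $ i) has_real_derivative (K *\<^sub>v x t + 0\<^sub>v n) $ i) (at t within {0..T})"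
      using dx[OF i t] K i by simp
  qed (use that smooth_fun_const[OF T] in auto)
  \<comment> \<open>The relation between u and x' with x' replaced by K x; this is the smooth
    representative of u.\<close>
  define u' where "u' = (\<lambda>t\<in>{0..T}. Hu *\<^sub>v (K *\<^sub>v x t))"
  define x' where "x' = restrict x {0..T}"
  have x's: "x' \<in> smooth_curves T n" unfolding x'_def by (rule smooth_curves_restrictI[OF D(2) xs])
  have HuK: "Hu * K \<in> carrier_mat m n" using Hu K by simp
  have u'e: "u' t = (Hu * K) *\<^sub>v x' t" if "t \<in> {0..T}" for t
    using that D(2)[OF that] Hu K by (simp add: u'_def x'_def)
  have u's: "u' \<in> smooth_curves T m"
  proof -
    have "u' = (\<lambda>t\<in>{0..T}. (Hu * K) *\<^sub>v x' t)"
      using u'e by (auto simp: u'_def restrict_def)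
    then show ?thesis using mult_mat_vec_smooth[OF T x's HuK] by simp
  qed
  have u'c: "continuous_on {0..T} (\<lambda>t. u' t $ i)" if "i < m" for i
    using smooth_fun_continuous[OF smooth_curves_smooth[OF u's that], of 0] by simp
  have dHu: "((\<lambda>s. (Hu *\<^sub>v x s) $ i) has_real_derivative u' t $ i) (at t within {0..T})"
    if i: "i < m" and t: "t \<in> {0..T}" for i t
  proof -
    have Kx: "K *\<^sub>v x t \<in> carrier_vec n" by (rule mult_mat_vec_in_carrier[OF K])
    have "((\<lambda>s. \<Sum>j<n. Hu $$ (i,j) * x s $ j) has_real_derivative
        (\<Sum>j<n. Hu $$ (i,j) * (K *\<^sub>v x t) $ j)) (at t within {0..T})"
      using t by (intro DERIV_sum DERIV_cmult dx) auto
    then have "((\<lambda>s. \<Sum>j<n. Hu $$ (i,j) * x s $ j) has_real_derivative u' t $ i) (at t within {0..T})"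
      unfolding mult_mat_vec_index_sum[OF Hu Kx i, symmetric] using t by (simp add: u'_def del: index_mult_mat_vec)
    then show ?thesis
      by (rule has_real_derivative_agree[OF _ t]) (rule mult_mat_vec_index_sum[OF Hu D(2) i])
  qed
  have u'int: "integral {0..t} (\<lambda>s. u' s $ i) = (Hu *\<^sub>v (x t - x 0)) $ i" if i: "i < m" and t: "t \<in> {0..T}" for i t
  proof -
    have "((\<lambda>s. u' s $ i) has_integral ((Hu *\<^sub>v x t) $ i - (Hu *\<^sub>v x 0) $ i)) {0..t}"
    proof (rule fundamental_theorem_of_calculus)
      fix s assume "s \<in> {0..t}"
      then show "((\<lambda>s. (Hu *\<^sub>v x s) $ i) has_vector_derivative u' s $ i) (at s within {0..t})"
        using DERIV_subset[OF dHu[OF i], of s "{0..t}"] t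
        by (auto simp: has_real_derivative_iff_has_vector_derivative)
    qed (use t in auto)
    then show ?thesis
      unfolding mult_minus_distrib_mat_vec[OF Hu D(2)[OF t] x0] using i Hu
      by (simp add: integral_unique del: index_mult_mat_vec)
  qed
  \<comment> \<open>u and u' are compared through their indefinite integrals, both equal to
    \<open>Hu\<close> applied to x(t) - x(0).\<close>
  have aeu: "AE t in lebesgue. t \<in> {0..T} \<longrightarrow> u t $ i - u' t $ i = 0" if i: "i < m" for i
  proof (rule AE_zero_if_indefinite_integral_zero)
    have ui: "(\<lambda>t. u t $ i) absolutely_integrable_on {0..T}"
      using D(1) i by (intro L2_fun_integrable) (simp add: L2_control_iff)
    have u'i: "(\<lambda>t. u' t $ i) absolutely_integrable_on {0..T}"
      by (rule absolutely_integrable_continuous_real[OF u'c[OF i]])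
    show "(\<lambda>t. u t $ i - u' t $ i) absolutely_integrable_on {0..T}"
      by (rule set_integral_diff(1)[OF ui u'i])
    fix t assume t: "t \<in> {0..T}"
    have "integral {0..t} (\<lambda>t. u t $ i - u' t $ i) = integral {0..t} (\<lambda>t. u t $ i) - integral {0..t} (\<lambda>t. u' t $ i)"
      using absolutely_integrable_on_subinterval[OF ui, of 0 t] absolutely_integrable_on_subinterval[OF u'i, of 0 t] t
      by (intro Henstock_Kurzweil_Integration.integral_diff) (auto simp: absolutely_integrable_on_def)
    then show "integral {0..t} (\<lambda>t. u t $ i - u' t $ i) = 0" by (simp add: uint[OF i t] u'int[OF i t])
  qed
  have "AE t in lebesgue. \<forall>i\<in>{..<m}. t \<in> {0..T} \<longrightarrow> u t $ i - u' t $ i = 0"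
    by (rule AE_finite_allI) (use aeu in auto)
  then have uu': "AE t in lebesgue. t \<in> {0..T} \<longrightarrow> u t = u' t"
  proof eventually_elim
    case (elim t)
    show ?case
    proof
      assume t: "t \<in> {0..T}"
      show "u t = u' t"
        using elim t carrier_vecD[OF D(3)[OF t]] carrier_vecD[OF smooth_curves_carrier[OF u's t]]
        by (intro eq_vecI) auto
    qed
  qed
  have "(x', u') \<in> smooth_trajectories A B T"
    unfolding smooth_trajectories_def mem_Collect_eq prod.case
  proof (intro conjI ballI allI impI)
    show "x' \<in> smooth_curves T (dim_row A)" "u' \<in> smooth_curves T (dim_col B)" using x's u's A B by auto
    fix t i assume t: "t \<in> {0..T}" and "i < dim_row A"
    then have i: "i < n" using A by simp
    let ?h' = "\<lambda>t. (A *\<^sub>v x' t + B *\<^sub>v u' t) $ i"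
    have e: "?h' t = (\<Sum>j<n. A $$ (i,j) * x' t $ j) + (\<Sum>j<m. B $$ (i,j) * u' t $ j)" if "t \<in> {0..T}" for t
      using mult_mat_vec_index_sum[OF A smooth_curves_carrier[OF x's that] i]
        mult_mat_vec_index_sum[OF B smooth_curves_carrier[OF u's that] i] B i
      by (simp del: index_mult_mat_vec)
    have c: "continuous_on {0..T} ?h'"
    proof (subst continuous_on_cong[OF refl e])
      show "continuous_on {0..T} (\<lambda>t. (\<Sum>j<n. A $$ (i,j) * x' t $ j) + (\<Sum>j<m. B $$ (i,j) * u' t $ j))"
        using smooth_fun_continuous[OF smooth_curves_smooth[OF x's], of _ 0]
        by (intro continuous_intros u'c) auto
    qed auto
    \<comment> \<open>Exchanging u for u' does not affect the integral equation, and its integrand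
      is now continuous; so it holds as a pointwise differential equation.\<close>
    have "((\<lambda>s. x 0 $ i + integral {0..s} ?h') has_real_derivative ?h' t) (at t within {0..T})"
      using integral_has_real_derivative[OF c t] by (auto intro!: derivative_eq_intros)
    then show "((\<lambda>s. x' s $ i) has_real_derivative ?h' t) (at t within {0..T})"
    proof (rule has_real_derivative_agree[OF _ t])
      fix s assume s: "s \<in> {0..T}"
      have "AE t in lebesgue. t \<in> {0..T} \<longrightarrow> ?h t $ i = ?h' t"
        using uu' by eventually_elim (simp add: x'_def)
      from integral_cong_AE_interval[OF this s]
      show "x' s $ i = x 0 $ i + integral {0..s} ?h'" using D(5)[OF i s] s by (simp add: x'_def)
    qed
  qed
  \<comment> \<open>The zero-cost relations are known almost everywhere; for smooth curves
    continuity extends them to every t.\<close>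
  moreover have "M *\<^sub>v z t = 0\<^sub>v d"
    if M: "M \<in> carrier_mat d d" and z: "z \<in> smooth_curves T d" and t: "t \<in> {0..T}"
      and ae: "AE t in lebesgue. t \<in> {0..T} \<longrightarrow> M *\<^sub>v z t = 0\<^sub>v d" for M z d t
  proof (rule eq_vecI)
    fix i assume "i < dim_vec (0\<^sub>v d :: real Matrix.vec)"
    then have i: "i < d" by simp
    have "(\<lambda>t\<in>{0..T}. M *\<^sub>v z t) t $ i = 0"
    proof (rule continuous_AE_zero[OF T _ _ t])
      show "continuous_on {0..T} (\<lambda>t. (\<lambda>t\<in>{0..T}. M *\<^sub>v z t) t $ i)"
        using smooth_fun_continuous[OF smooth_curves_smooth[OF mult_mat_vec_smooth[OF T z M] i], of 0] by simp
      show "AE t in lebesgue. t \<in> {0..T} \<longrightarrow> (\<lambda>t\<in>{0..T}. M *\<^sub>v z t) t $ i = 0"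
        using ae by eventually_elim (use i in \<open>simp del: index_mult_mat_vec\<close>)
    qed
    then show "(M *\<^sub>v z t) $ i = 0\<^sub>v d $ i" using t i by simp
  qed (use M in simp)
  moreover have "AE t in lebesgue. t \<in> {0..T} \<longrightarrow> Q *\<^sub>v x' t = 0\<^sub>v n"
    using Q0 by eventually_elim (simp add: x'_def)
  moreover have "AE t in lebesgue. t \<in> {0..T} \<longrightarrow> R *\<^sub>v u' t = 0\<^sub>v m"
    using R0 uu' by eventually_elim simp
  moreover have "x t = x' t" if "t \<in> {0..T}" for t using that by (simp add: x'_def)
  ultimately show ?thesis using that[of x' u'] uu' Qc Rc x's u's by blast
qed

section \<open>Cost and flat outputs\<close>

text \<open>Each differentiation of y = L Z contributes a factor \<A>, so a bound on Z alone
  controls derivatives of y of any order, with constants independent of T.\<close>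

lemma output_curve_nderiv:
  fixes \<A> L :: "real Matrix.mat"
  assumes T: "0 < T" and A: "\<A> \<in> carrier_mat N N" and L: "L \<in> carrier_mat d N"
    and Z: "Z \<in> linear_ode_solutions \<A> T" and t: "t \<in> {0..T}" and j: "j < d"
  shows "nderiv {0..T} p (\<lambda>s. output_curve T L Z s $ j) t = ((L * \<A> ^\<^sub>m p) *\<^sub>v Z t) $ j"
proof -
  have Zc: "Z t \<in> carrier_vec N" if "t \<in> {0..T}" for t
    using linear_ode_solutions_carrier[OF Z that] A by simp
  have LA: "L * \<A> ^\<^sub>m p \<in> carrier_mat d N" for p
    by (rule mult_carrier_mat[OF L pow_carrier_mat[OF A]])
  let ?F = "\<lambda>p t. ((L * \<A> ^\<^sub>m p) *\<^sub>v Z t) $ j"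
  have der: "(?F p has_real_derivative ?F (Suc p) t) (at t within {0..T})" if t: "t \<in> {0..T}" for p t
  proof -
    have AZ: "\<A> *\<^sub>v Z t \<in> carrier_vec N" by (rule mult_mat_vec_in_carrier[OF A])
    have "L * \<A> ^\<^sub>m Suc p = (L * \<A> ^\<^sub>m p) * \<A>"
      using assoc_mult_mat[OF L pow_carrier_mat[OF A] A] by simp
    then have e: "?F (Suc p) t = (\<Sum>l<N. (L * \<A> ^\<^sub>m p) $$ (j,l) * (\<A> *\<^sub>v Z t) $ l)"
      using assoc_mult_mat_vec[OF LA A Zc[OF t], of p] mult_mat_vec_index_sum[OF LA AZ j, of p] by simp
    have "((\<lambda>s. \<Sum>l<N. (L * \<A> ^\<^sub>m p) $$ (j,l) * Z s $ l) has_real_derivative ?F (Suc p) t) (at t within {0..T})"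
      unfolding e using Z A t by (intro DERIV_sum DERIV_cmult) (auto simp: linear_ode_solutions_def)
    then show ?thesis
      by (rule has_real_derivative_agree[OF _ t]) (rule mult_mat_vec_index_sum[OF LA Zc j])
  qed
  have "nderiv {0..T} p (\<lambda>s. output_curve T L Z s $ j) t = nderiv {0..T} p (?F 0) t"
    using L A by (intro nderiv_cong t) (auto simp: output_curve_def)
  also have "\<dots> = ?F p t" using nderiv_eqI[of T ?F t p, OF T] der t by blast
  finally show ?thesis .
qed

lemma enorm_le_sum: "v \<in> carrier_vec d \<Longrightarrow> enorm v \<le> (\<Sum>i<d. \<bar>v $ i\<bar>)"
  using L2_set_le_sum_abs[of "\<lambda>i. v $ i" "{..<d}"]
  by (simp add: enorm_def L2_set_def scalar_prod_def atLeast0LessThan power2_eq_square)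

lemma diffop_enorm_bound:
  assumes P: "P \<in> carrier_mat r d" and t: "t \<in> {0..T}"
    and b: "\<And>i j p. i < r \<Longrightarrow> j < d \<Longrightarrow> p \<le> degree (P $$ (i,j)) \<Longrightarrow> \<bar>nderiv {0..T} p (\<lambda>s. y s $ j) t\<bar> \<le> b"
  shows "enorm (diffop T P y t) \<le> (\<Sum>i<r. \<Sum>j<d. \<Sum>p\<le>degree (P $$ (i,j)). \<bar>coeff (P $$ (i,j)) p\<bar>) * b"
proof -
  have "enorm (diffop T P y t) \<le> (\<Sum>i<r. \<bar>diffop T P y t $ i\<bar>)"
    using P t by (intro enorm_le_sum) (simp add: diffop_def)
  also have "\<dots> \<le> (\<Sum>i<r. \<Sum>j<d. \<Sum>p\<le>degree (P $$ (i,j)). \<bar>coeff (P $$ (i,j)) p\<bar> * b)"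
  proof (rule sum_mono)
    fix i assume "i \<in> {..<r}"
    then have i: "i < r" by simp
    have "\<bar>diffop T P y t $ i\<bar> \<le> (\<Sum>j<d. \<bar>pdiff T (P $$ (i,j)) (\<lambda>s. y s $ j) t\<bar>)"
      using P t i by (simp add: diffop_index)
    also have "\<dots> \<le> (\<Sum>j<d. \<Sum>p\<le>degree (P $$ (i,j)). \<bar>coeff (P $$ (i,j)) p * nderiv {0..T} p (\<lambda>s. y s $ j) t\<bar>)"
      unfolding pdiff_def by (intro sum_mono sum_abs)
    also have "\<dots> \<le> (\<Sum>j<d. \<Sum>p\<le>degree (P $$ (i,j)). \<bar>coeff (P $$ (i,j)) p\<bar> * b)"
      using b[OF i] unfolding abs_mult by (intro sum_mono mult_left_mono) auto
    finally show "\<bar>diffop T P y t $ i\<bar> \<le> (\<Sum>j<d. \<Sum>p\<le>degree (P $$ (i,j)). \<bar>coeff (P $$ (i,j)) p\<bar> * b)" .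
  qed
  finally show ?thesis by (simp add: sum_distrib_right)
qed

lemma curve_deriv_enorm_bound:
  assumes t: "t \<in> {0..T}" and b: "\<And>j. j < d \<Longrightarrow> \<bar>nderiv {0..T} p (\<lambda>s. y s $ j) t\<bar> \<le> b"
  shows "enorm (curve_deriv T d p y t) \<le> real d * b"
proof -
  have "enorm (curve_deriv T d p y t) \<le> (\<Sum>j<d. \<bar>curve_deriv T d p y t $ j\<bar>)"
    using t by (intro enorm_le_sum) (simp add: curve_deriv_def)
  also have "\<dots> \<le> (\<Sum>j<d. b)" using t b by (intro sum_mono) (simp add: curve_deriv_def)
  finally show ?thesis by simp
qed

lemma diffop_const_curve:
  assumes T: "0 < T" and t: "t \<in> {0..T}" and P: "P \<in> carrier_mat r d" and c: "c \<in> carrier_vec d"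
    and y: "\<And>t. t \<in> {0..T} \<Longrightarrow> y t = c"
  shows "diffop T P y t = map_mat (\<lambda>p. poly p 0) P *\<^sub>v c"
proof (rule eq_vecI)
  have P': "map_mat (\<lambda>p. poly p 0) P \<in> carrier_mat r d" using P by simp
  fix i assume "i < dim_vec (map_mat (\<lambda>p. poly p 0) P *\<^sub>v c)"
  then have i: "i < r" using P by simp
  have "diffop T P y t $ i = (\<Sum>j<d. pdiff T (P $$ (i,j)) (\<lambda>s. c $ j) t)"
    using P t i y by (auto simp: diffop_index intro!: sum.cong pdiff_cong)
  also have "\<dots> = (\<Sum>j<d. poly (P $$ (i,j)) 0 * c $ j)" using T t by (simp add: pdiff_const)
  also have "\<dots> = (map_mat (\<lambda>p. poly p 0) P *\<^sub>v c) $ i"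
    unfolding mult_mat_vec_index_sum[OF P' c i] using P i by simp
  finally show "diffop T P y t $ i = (map_mat (\<lambda>p. poly p 0) P *\<^sub>v c) $ i" .
qed (use P t in auto)

lemma mult_mat_vec_zero: "M \<in> carrier_mat r d \<Longrightarrow> M *\<^sub>v 0\<^sub>v d = (0\<^sub>v r :: 'a :: comm_ring_1 Matrix.vec)"
  by (intro eq_vecI) auto

lemma diffop_zero_curve:
  assumes "0 < T" "t \<in> {0..T}" "P \<in> carrier_mat r d" "\<And>t. t \<in> {0..T} \<Longrightarrow> y t = 0\<^sub>v d"
  shows "diffop T P y t = 0\<^sub>v r"
  using diffop_const_curve[OF assms(1-3) zero_carrier_vec assms(4)]
    mult_mat_vec_zero[of "map_mat (\<lambda>p. poly p 0) P" r d] assms(3) by simp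

text \<open>The case \<omega> = 0 of hyperbolicity, passed from the complex matrix to the real
  one.\<close>

lemma hyperbolic_kernel_at_0:
  assumes E: "E \<in> carrier_mat m m" and H: "hyperbolic E" and c: "c \<in> carrier_vec m"
    and 0: "map_mat (\<lambda>p. poly p 0) E *\<^sub>v c = 0\<^sub>v m"
  shows "c = 0\<^sub>v m"
proof -
  let ?E = "map_mat (\<lambda>p. poly p 0) E" and ?M = "map_mat (\<lambda>p. poly (map_poly complex_of_real p) 0) E"
  let ?c = "map_vec complex_of_real c"
  have E': "?E \<in> carrier_mat m m" and M: "?M \<in> carrier_mat m m" and c': "?c \<in> carrier_vec m" using E c by auto
  have "Determinant.det ?M \<noteq> 0" using H unfolding hyperbolic_def by (auto dest: spec[of _ 0])
  moreover have "?M *\<^sub>v ?c = 0\<^sub>v m"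
  proof (rule eq_vecI)
    fix i assume "i < dim_vec (0\<^sub>v m :: complex Matrix.vec)"
    then have i: "i < m" by simp
    have "poly (map_poly complex_of_real p) 0 = complex_of_real (poly p 0)" for p
      by (simp add: poly_0_coeff_0 coeff_map_poly)
    then have "(?M *\<^sub>v ?c) $ i = complex_of_real (\<Sum>j<m. ?E $$ (i,j) * c $ j)"
      unfolding mult_mat_vec_index_sum[OF M c' i] using E c i by simp
    also have "(\<Sum>j<m. ?E $$ (i,j) * c $ j) = 0"
      using arg_cong[OF 0, of "\<lambda>v. v $ i"] i unfolding mult_mat_vec_index_sum[OF E' c i] by simp
    finally show "(?M *\<^sub>v ?c) $ i = 0\<^sub>v m $ i" using i by simp
  qed (use M in simp)
  ultimately have "?c = 0\<^sub>v m" using det_0_iff_vec_prod_zero_field[OF M] c' by blast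
  then have "complex_of_real (c $ i) = 0" if "i < m" for i
    using arg_cong[of ?c "0\<^sub>v m" "\<lambda>v. v $ i"] that c by simp
  then show ?thesis using c by (intro eq_vecI) auto
qed

lemma flat_parametrizationD:
  assumes "flat_parametrization A B X U" "A \<in> carrier_mat n n" "B \<in> carrier_mat n m"
  shows "X \<in> carrier_mat n m" "U \<in> carrier_mat m m"
    "0 < T \<Longrightarrow> bij_betw (\<lambda>y. (diffop T X y, diffop T U y)) (smooth_curves T m) (smooth_trajectories A B T)"
  using assms by (auto simp: flat_parametrization_def Let_def)

text \<open>A constant zero-cost trajectory comes from a constant flat output in the kernel of \<open>E(0)\<close>.\<close>
lemma zero_cost_equilibrium:
  assumes A: "A \<in> carrier_mat n n" and B: "B \<in> carrier_mat n m" and Q: "Q \<in> carrier_mat n n" and R: "R \<in> carrier_mat m m"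
    and flat: "flat_parametrization A B X U" and H: "hyperbolic (euler_lagrange Q R X U)"
    and a: "a \<in> carrier_vec n" and b: "b \<in> carrier_vec m" and Qa: "Q *\<^sub>v a = 0\<^sub>v n" and Rb: "R *\<^sub>v b = 0\<^sub>v m"
    and h: "A *\<^sub>v a + B *\<^sub>v b = 0\<^sub>v n"
  shows "a = 0\<^sub>v n \<and> b = 0\<^sub>v m"
proof -
  note X = flat_parametrizationD(1)[OF flat A B] and U = flat_parametrizationD(2)[OF flat A B]
  let ?T = "1::real"
  have T1: "0 < ?T" by simp
  let ?a = "\<lambda>t\<in>{0..?T}. a" and ?b = "\<lambda>t\<in>{0..?T}. b"
  have cs: "(\<lambda>t\<in>{0..?T}. v) \<in> smooth_curves ?T d" if "v \<in> carrier_vec d" for v d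
    by (rule smooth_curves_restrictI) (use that in \<open>auto simp: smooth_fun_const\<close>)
  have "(?a, ?b) \<in> smooth_trajectories A B ?T"
    unfolding smooth_trajectories_def mem_Collect_eq prod.case
  proof (intro conjI ballI allI impI)
    show "?a \<in> smooth_curves ?T (dim_row A)" "?b \<in> smooth_curves ?T (dim_col B)"
      using cs[OF a] cs[OF b] A B by auto
    fix t i assume t: "t \<in> {0..?T}" and i: "i < dim_row A"
    have "((\<lambda>s. ?a s $ i) has_real_derivative 0) (at t within {0..?T})"
      by (rule has_real_derivative_agree[of "\<lambda>_. a $ i", OF _ t]) auto
    then show "((\<lambda>s. ?a s $ i) has_real_derivative (A *\<^sub>v ?a t + B *\<^sub>v ?b t) $ i) (at t within {0..?T})"
      using t i h A by simp
  qed
  moreover have "(\<lambda>y. (diffop ?T X y, diffop ?T U y)) ` smooth_curves ?T m = smooth_trajectories A B ?T"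
    using flat_parametrizationD(3)[OF flat A B, of ?T] by (simp add: bij_betw_def)
  ultimately have "(?a, ?b) \<in> (\<lambda>y. (diffop ?T X y, diffop ?T U y)) ` smooth_curves ?T m" by simp
  then obtain \<delta> where \<delta>: "\<delta> \<in> smooth_curves ?T m" and "(?a, ?b) = (diffop ?T X \<delta>, diffop ?T U \<delta>)"
    by (rule imageE)
  then have X\<delta>: "diffop ?T X \<delta> = ?a" and U\<delta>: "diffop ?T U \<delta> = ?b" by simp_all
  obtain F G where F: "F \<in> carrier_mat m n" and G: "G \<in> carrier_mat m m"
    and inv: "\<And>T y t. 0 < T \<Longrightarrow> y \<in> smooth_curves T m \<Longrightarrow> t \<in> {0..T} \<Longrightarrow>
       y t = diffop T F (diffop T X y) t + diffop T G (diffop T U y) t"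
    using flat A B unfolding flat_parametrization_def Let_def by fastforce
  \<comment> \<open>The inverse operators F(D) and G(D) send constants to constants, so the flat
    output is the constant c.\<close>
  define c where "c = map_mat (\<lambda>p. poly p 0) F *\<^sub>v a + map_mat (\<lambda>p. poly p 0) G *\<^sub>v b"
  have c: "c \<in> carrier_vec m" using F G by (simp add: c_def carrier_vecI)
  have \<delta>c: "\<delta> t = c" if t: "t \<in> {0..?T}" for t
    unfolding inv[OF T1 \<delta> t] X\<delta> U\<delta> c_def
    using diffop_const_curve[OF T1 t F a, of ?a] diffop_const_curve[OF T1 t G b, of ?b] by simp
  let ?E = "euler_lagrange Q R X U"
  have E: "?E \<in> carrier_mat m m" by (rule euler_lagrange_carrier[OF Q R X U])
  have t0: "0 \<in> {0..?T}" by simp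
  \<comment> \<open>The curves Qa and Rb are 0, so E(D) annihilates \<delta>; for a constant this
    says E(0) c = 0.\<close>
  have "diffop ?T ?E \<delta> 0 = 0\<^sub>v m + 0\<^sub>v m"
    unfolding diffop_euler_lagrange[OF T1 Q R X U \<delta> t0] X\<delta> U\<delta>
    using diffop_zero_curve[OF T1 t0, of "adjoint_pmat X" m n "\<lambda>t. Q *\<^sub>v ?a t"]
      diffop_zero_curve[OF T1 t0, of "adjoint_pmat U" m m "\<lambda>t. R *\<^sub>v ?b t"] X U Qa Rb
    by (simp add: adjoint_pmat_def)
  then have "map_mat (\<lambda>p. poly p 0) ?E *\<^sub>v c = 0\<^sub>v m"
    using diffop_const_curve[OF T1 t0 E c \<delta>c] by simp
  then have c0: "c = 0\<^sub>v m" by (rule hyperbolic_kernel_at_0[OF E H c])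
  have "?a 0 = 0\<^sub>v n" "?b 0 = 0\<^sub>v m"
    using diffop_zero_curve[OF T1 t0 X, of \<delta>] diffop_zero_curve[OF T1 t0 U, of \<delta>] \<delta>c
    unfolding X\<delta> U\<delta> c0 by auto
  then show ?thesis by simp
qed

text \<open>Boundary terms involve derivatives within [0,T] only, so weights may be exchanged when
  they agree there.\<close>

lemma ibp_boundary_cong:
  assumes "0 \<le> T" "\<And>t. t \<in> {0..T} \<Longrightarrow> w t = w' t"
  shows "ibp_boundary T P w \<delta> = ibp_boundary T P w' \<delta>"
proof -
  have "nderiv {0..T} k (\<lambda>s. w s $ i) t = nderiv {0..T} k (\<lambda>s. w' s $ i) t" if "t \<in> {0..T}" for k i t
    using assms that by (intro nderiv_cong) auto
  then show ?thesis using assms(1) unfolding ibp_boundary_def Let_def by simp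
qed

section \<open>The quadratic cost on square-integrable pairs\<close>

lemma cost_integrand:
  assumes Q: "Q \<in> carrier_mat n n" and R: "R \<in> carrier_mat m m"
    and x: "L2_control n T x" and u: "L2_control m T u"
  shows "(\<lambda>t. x t \<bullet> (Q *\<^sub>v x t) + u t \<bullet> (R *\<^sub>v u t)) absolutely_integrable_on {0..T}"
    and "cost Q R T x u = 1 / 2 * integral {0..T} (\<lambda>t. x t \<bullet> (Q *\<^sub>v x t) + u t \<bullet> (R *\<^sub>v u t))"
proof -
  show *: "(\<lambda>t. x t \<bullet> (Q *\<^sub>v x t) + u t \<bullet> (R *\<^sub>v u t)) absolutely_integrable_on {0..T}"
    by (rule set_integral_add(1)[OF L2_control_scalar_prod[OF x L2_control_mult_mat[OF Q x]]
          L2_control_scalar_prod[OF u L2_control_mult_mat[OF R u]]])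
  show "cost Q R T x u = 1 / 2 * integral {0..T} (\<lambda>t. x t \<bullet> (Q *\<^sub>v x t) + u t \<bullet> (R *\<^sub>v u t))"
    unfolding cost_def set_lebesgue_integral_eq_integral(2)[OF *] ..
qed

lemma cost_nonneg:
  assumes Q: "sym_psd n Q" and R: "sym_psd m R" and x: "L2_control n T x" and u: "L2_control m T u"
  shows "0 \<le> cost Q R T x u"
proof -
  have "0 \<le> integral {0..T} (\<lambda>t. x t \<bullet> (Q *\<^sub>v x t) + u t \<bullet> (R *\<^sub>v u t))"
  proof (rule Henstock_Kurzweil_Integration.integral_nonneg)
    show "(\<lambda>t. x t \<bullet> (Q *\<^sub>v x t) + u t \<bullet> (R *\<^sub>v u t)) integrable_on {0..T}"
      using cost_integrand(1)[OF sym_psdD(1)[OF Q] sym_psdD(1)[OF R] x u] by (simp add: absolutely_integrable_on_def)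
    show "0 \<le> x t \<bullet> (Q *\<^sub>v x t) + u t \<bullet> (R *\<^sub>v u t)" if "t \<in> {0..T}" for t
      using sym_psdD(2)[OF Q, of "x t"] sym_psdD(2)[OF R, of "u t"] x u that by (simp add: L2_control_iff)
  qed
  then show ?thesis using cost_integrand(2)[OF sym_psdD(1)[OF Q] sym_psdD(1)[OF R] x u] by simp
qed

text \<open>For a quadratic functional the second-order Taylor expansion is exact; its linear term
  is the first variation.\<close>

lemma cost_add:
  assumes Q: "sym_psd n Q" and R: "sym_psd m R" and x: "L2_control n T x" and u: "L2_control m T u"
    and d: "L2_control n T d" and e: "L2_control m T e"
  shows "cost Q R T (\<lambda>t. x t + d t) (\<lambda>t. u t + e t)
     = cost Q R T x u + integral {0..T} (\<lambda>t. d t \<bullet> (Q *\<^sub>v x t) + e t \<bullet> (R *\<^sub>v u t)) + cost Q R T d e"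
proof -
  note Qc = sym_psdD(1)[OF Q] and Rc = sym_psdD(1)[OF R]
  note c = cost_integrand[OF Qc Rc]
  let ?q = "\<lambda>x u t. x t \<bullet> (Q *\<^sub>v x t) + u t \<bullet> (R *\<^sub>v u t)"
  let ?l = "\<lambda>t. d t \<bullet> (Q *\<^sub>v x t) + e t \<bullet> (R *\<^sub>v u t)"
  have "?l absolutely_integrable_on {0..T}"
    by (rule set_integral_add(1)[OF L2_control_scalar_prod[OF d L2_control_mult_mat[OF Qc x]]
          L2_control_scalar_prod[OF e L2_control_mult_mat[OF Rc u]]])
  then have l: "(?l has_integral integral {0..T} ?l) {0..T}"
    by (simp add: absolutely_integrable_on_def integrable_integral)
  have q: "(?q x u has_integral integral {0..T} (?q x u)) {0..T}" "(?q d e has_integral integral {0..T} (?q d e)) {0..T}"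
    using c(1)[OF x u] c(1)[OF d e] by (simp_all add: absolutely_integrable_on_def integrable_integral)
  have "((\<lambda>t. ?q x u t + 2 * ?l t + ?q d e t) has_integral
      (integral {0..T} (?q x u) + 2 * integral {0..T} ?l + integral {0..T} (?q d e))) {0..T}"
    by (intro has_integral_add has_integral_mult_right q l)
  then have "(?q (\<lambda>t. x t + d t) (\<lambda>t. u t + e t) has_integral
      (integral {0..T} (?q x u) + 2 * integral {0..T} ?l + integral {0..T} (?q d e))) {0..T}"
  proof (rule has_integral_eq[rotated])
    fix t assume "t \<in> {0..T}"
    then have "x t \<in> carrier_vec n" "d t \<in> carrier_vec n" "u t \<in> carrier_vec m" "e t \<in> carrier_vec m"
      using x u d e by (auto simp: L2_control_iff)
    then show "?q x u t + 2 * ?l t + ?q d e t = ?q (\<lambda>t. x t + d t) (\<lambda>t. u t + e t) t"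
      using sym_psd_quadratic_add[OF Q, of "x t" "d t"] sym_psd_quadratic_add[OF R, of "u t" "e t"] by simp
  qed
  then show ?thesis
    unfolding c(2)[OF x u] c(2)[OF d e] c(2)[OF L2_control_add[OF x d] L2_control_add[OF u e]]
    by (simp add: integral_unique)
qed

text \<open>A nonnegative integrand with integral 0 vanishes almost everywhere, and so do its two
  nonnegative summands; \<open>sym_psd_kernel\<close> passes from the values of the forms to Qx and
  Ru.\<close>

lemma cost_zero_AE:
  assumes Q: "sym_psd n Q" and R: "sym_psd m R" and x: "L2_control n T x" and u: "L2_control m T u"
    and 0: "cost Q R T x u = 0"
  shows "AE t in lebesgue. t \<in> {0..T} \<longrightarrow> Q *\<^sub>v x t = 0\<^sub>v n \<and> R *\<^sub>v u t = 0\<^sub>v m"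
proof -
  let ?q = "\<lambda>t. x t \<bullet> (Q *\<^sub>v x t) + u t \<bullet> (R *\<^sub>v u t)"
  have nn: "0 \<le> x t \<bullet> (Q *\<^sub>v x t)" "0 \<le> u t \<bullet> (R *\<^sub>v u t)" "x t \<in> carrier_vec n" "u t \<in> carrier_vec m"
    if "t \<in> {0..T}" for t
    using sym_psdD(2)[OF Q, of "x t"] sym_psdD(2)[OF R, of "u t"] x u that by (simp_all add: L2_control_iff)
  have "integrable lebesgue (\<lambda>t. indicator {0..T} t *\<^sub>R ?q t)"
    using cost_integrand(1)[OF sym_psdD(1)[OF Q] sym_psdD(1)[OF R] x u] by (simp add: set_integrable_def)
  moreover have "(LINT t|lebesgue. indicator {0..T} t *\<^sub>R ?q t) = 0"
    using 0 by (simp add: cost_def set_lebesgue_integral_def)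
  moreover have "AE t in lebesgue. 0 \<le> indicator {0..T} t *\<^sub>R ?q t"
    using nn(1,2) by (intro AE_I2) (auto simp: indicator_def)
  ultimately have "AE t in lebesgue. indicator {0..T} t *\<^sub>R ?q t = 0"
    using integral_nonneg_eq_0_iff_AE by blast
  then show ?thesis
  proof eventually_elim
    case (elim t)
    show ?case
    proof
      assume t: "t \<in> {0..T}"
      then have "x t \<bullet> (Q *\<^sub>v x t) = 0" "u t \<bullet> (R *\<^sub>v u t) = 0" using elim nn[OF t] by auto
      then show "Q *\<^sub>v x t = 0\<^sub>v n \<and> R *\<^sub>v u t = 0\<^sub>v m"
        using sym_psd_kernel[OF Q] sym_psd_kernel[OF R] nn[OF t] by blast
    qed
  qed
qed

lemma endpoint_value_diff:
  assumes M0: "M0 \<in> carrier_mat k n" and M1: "M1 \<in> carrier_mat k n"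
    and x: "x 0 \<in> carrier_vec n" "x T \<in> carrier_vec n" "x' 0 \<in> carrier_vec n" "x' T \<in> carrier_vec n"
  shows "endpoint_value M0 M1 T (\<lambda>t. x' t - x t) = endpoint_value M0 M1 T x' - endpoint_value M0 M1 T x"
proof -
  have "M0 *\<^sub>v (x' 0 - x 0) = M0 *\<^sub>v x' 0 - M0 *\<^sub>v x 0" "M1 *\<^sub>v (x' T - x T) = M1 *\<^sub>v x' T - M1 *\<^sub>v x T"
    using mult_minus_distrib_mat_vec[OF M0 x(3,1)] mult_minus_distrib_mat_vec[OF M1 x(4,2)] by auto
  then show ?thesis using M0 M1 by (intro eq_vecI) (auto simp: endpoint_value_def simp del: index_mult_mat_vec)
qed

section \<open>Optimality, uniqueness and exponential decay of the extremal\<close>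

theorem theorem5p1:
  fixes n m k N :: nat
    and A B Q R M0 M1 \<A> L C0 C1 :: "real Matrix.mat"
    and \<gamma> \<eta> :: "real Matrix.vec"
    and X U E :: "real poly Matrix.mat"
  assumes "A \<in> carrier_mat n n" and "B \<in> carrier_mat n m"
    and "sym_psd n Q" and "sym_psd m R"
    and "M0 \<in> carrier_mat k n" and "M1 \<in> carrier_mat k n"
    and "vec_space.rank k (mat_of_cols k (cols M0 @ cols M1)) = k"
    and "\<gamma> \<in> carrier_vec k"
    and H1: "controllable A B"
    and flat: "flat_parametrization A B X U"
    and E_def: "E = euler_lagrange Q R X U"
    and N: "has_total_order E N"
    and H2: "hyperbolic E"
    and realization: "first_order_realization E N \<A> L"
    and "C0 \<in> carrier_mat N N" and "C1 \<in> carrier_mat N N" and "\<eta> \<in> carrier_vec N"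
    and bc: "boundary_form Q R M0 M1 \<gamma> X U \<A> L C0 C1 \<eta>"
    and H3: "admissible_boundary_operator \<A> C0 C1"
  shows "\<exists>T\<^sub>0>0. \<exists>C>0. \<exists>\<mu>>0. \<forall>T\<ge>T\<^sub>0.
    \<exists>x \<in> smooth_curves T n. \<exists>u \<in> smooth_curves T m. \<exists>y \<in> smooth_curves T m.
      optimal_pair A B Q R M0 M1 \<gamma> T x u
    \<and> (\<forall>x' u'. optimal_pair A B Q R M0 M1 \<gamma> T x' u' \<longrightarrow>
         (\<forall>t\<in>{0..T}. x' t = x t) \<and> (AE t in lebesgue. t \<in> {0..T} \<longrightarrow> u' t = u t))
    \<and> x = diffop T X y \<and> u = diffop T U y
    \<and> (\<forall>t\<in>{0..T}. enorm (x t) + enorm (u t) \<le> C * turnpike_weight \<mu> T t)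
    \<and> (\<forall>p. enters X p \<or> enters U p \<longrightarrow>
         (\<forall>t\<in>{0..T}. enorm (curve_deriv T m p y t) \<le> C * turnpike_weight \<mu> T t))"
proof -
  note A = assms(1) and B = assms(2) and Q = assms(3) and R = assms(4) and M0 = assms(5) and M1 = assms(6)
    and \<gamma> = assms(8) and C0 = \<open>C0 \<in> carrier_mat N N\<close> and C1 = \<open>C1 \<in> carrier_mat N N\<close>
    and \<eta> = \<open>\<eta> \<in> carrier_vec N\<close>
  note Qc = sym_psdD(1)[OF Q] and Rc = sym_psdD(1)[OF R]
  note X = flat_parametrizationD(1)[OF flat A B] and U = flat_parametrizationD(2)[OF flat A B]
  have E: "E \<in> carrier_mat m m" unfolding E_def by (rule euler_lagrange_carrier[OF Qc Rc X U])
  have \<A>: "\<A> \<in> carrier_mat N N" and L: "L \<in> carrier_mat m N"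
    and bij: "\<And>T. 0 < T \<Longrightarrow> bij_betw (output_curve T L) (linear_ode_solutions \<A> T) (kernel_solutions E T)"
    using realization E by (auto simp: first_order_realization_def)
  have inj: "a = 0\<^sub>v n \<and> b = 0\<^sub>v m" if "a \<in> carrier_vec n" "b \<in> carrier_vec m" "Q *\<^sub>v a = 0\<^sub>v n"
    "R *\<^sub>v b = 0\<^sub>v m" "A *\<^sub>v a + B *\<^sub>v b = 0\<^sub>v n" for a b
    using zero_cost_equilibrium[OF A B Qc Rc flat H2[unfolded E_def] that] .
  obtain T\<^sub>0 K \<mu> where T0: "0 < T\<^sub>0" and K: "0 < K" and \<mu>: "0 < \<mu>"
    and ex: "\<And>T. T\<^sub>0 \<le> T \<Longrightarrow> \<exists>Z\<in>linear_ode_solutions \<A> T. C0 *\<^sub>v Z 0 + C1 *\<^sub>v Z T = \<eta>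
       \<and> (\<forall>t\<in>{0..T}. \<forall>i<N. \<bar>Z t $ i\<bar> \<le> K * turnpike_weight \<mu> T t)"
    and uniq: "\<And>T Z t. T\<^sub>0 \<le> T \<Longrightarrow> Z \<in> linear_ode_solutions \<A> T \<Longrightarrow> C0 *\<^sub>v Z 0 + C1 *\<^sub>v Z T = 0\<^sub>v N
       \<Longrightarrow> t \<in> {0..T} \<Longrightarrow> Z t = 0\<^sub>v N"
    by (rule boundary_value_problem[OF \<A> C0 C1 H3 \<eta>]) (rule that)
  \<comment> \<open>A common bound for all orders of differentiation in X(D) and U(D).\<close>
  define d where "d = (\<Sum>i<n. \<Sum>j<m. degree (X $$ (i,j))) + (\<Sum>i<m. \<Sum>j<m. degree (U $$ (i,j)))"
  have degX: "degree (X $$ (i,j)) \<le> d" if "i < n" "j < m" for i j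
  proof -
    have "degree (X $$ (i,j)) \<le> (\<Sum>j<m. degree (X $$ (i,j)))"
      using that by (intro member_le_sum[of j "{..<m}" "\<lambda>j. degree (X $$ (i,j))"]) auto
    also have "\<dots> \<le> (\<Sum>i<n. \<Sum>j<m. degree (X $$ (i,j)))"
      using that by (intro member_le_sum[of i "{..<n}" "\<lambda>i. \<Sum>j<m. degree (X $$ (i,j))"]) auto
    finally show ?thesis by (simp add: d_def)
  qed
  have degU: "degree (U $$ (i,j)) \<le> d" if "i < m" "j < m" for i j
  proof -
    have "degree (U $$ (i,j)) \<le> (\<Sum>j<m. degree (U $$ (i,j)))"
      using that by (intro member_le_sum[of j "{..<m}" "\<lambda>j. degree (U $$ (i,j))"]) auto
    also have "\<dots> \<le> (\<Sum>i<m. \<Sum>j<m. degree (U $$ (i,j)))"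
      using that by (intro member_le_sum[of i "{..<m}" "\<lambda>i. \<Sum>j<m. degree (U $$ (i,j))"]) auto
    finally show ?thesis by (simp add: d_def)
  qed
  have enters_le: "p \<le> d" if "enters X p \<or> enters U p" for p
  proof -
    have "p \<le> d" if "enters P p" "P \<in> carrier_mat r m" "\<And>i j. i < r \<Longrightarrow> j < m \<Longrightarrow> degree (P $$ (i,j)) \<le> d" for P r
      using that unfolding enters_def by (auto intro: order.trans[OF le_degree])
    then show ?thesis using that degX degU X U by blast
  qed
  \<comment> \<open>Transfers the estimate for Z to the derivatives of y of all orders p \<le> d at
    once, through y^(p) = L \<A>^p Z.\<close>
  define \<kappa> where "\<kappa> = (\<Sum>p\<le>d. \<Sum>j<m. \<Sum>l<N. \<bar>(L * \<A> ^\<^sub>m p) $$ (j,l)\<bar>)"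
  define cX where "cX = (\<Sum>i<n. \<Sum>j<m. \<Sum>p\<le>degree (X $$ (i,j)). \<bar>coeff (X $$ (i,j)) p\<bar>)"
  define cU where "cU = (\<Sum>i<m. \<Sum>j<m. \<Sum>p\<le>degree (U $$ (i,j)). \<bar>coeff (U $$ (i,j)) p\<bar>)"
  have nn: "0 \<le> \<kappa>" "0 \<le> cX" "0 \<le> cU"
    unfolding \<kappa>_def cX_def cU_def by (intro sum_nonneg abs_ge_zero)+
  \<comment> \<open>\<kappa> K bounds each component of y^(p) relative to the weight; cX, cU and m
    turn this into bounds for x, for u and for the norm of y^(p).\<close>
  define C where "C = (cX + cU + real m) * (\<kappa> * K) + 1"
  have C: "0 < C" unfolding C_def using nn K by (intro add_nonneg_pos mult_nonneg_nonneg) auto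
  show ?thesis
  proof (rule exI[of _ T\<^sub>0], rule conjI[OF T0], rule exI[of _ C], rule conjI[OF C], rule exI[of _ \<mu>],
      rule conjI[OF \<mu>], intro allI impI)
    fix T assume T0T: "T\<^sub>0 \<le> T"
    then have T: "0 < T" using T0 by simp
    have E0: "0 \<in> {0..T}" and ET: "T \<in> {0..T}" using T by auto
    obtain Z where Z: "Z \<in> linear_ode_solutions \<A> T" and Zbc: "C0 *\<^sub>v Z 0 + C1 *\<^sub>v Z T = \<eta>"
      and Zb: "\<And>t i. t \<in> {0..T} \<Longrightarrow> i < N \<Longrightarrow> \<bar>Z t $ i\<bar> \<le> K * turnpike_weight \<mu> T t"
      using ex[OF T0T] by blast
    define y where "y = output_curve T L Z"
    define x where "x = diffop T X y"
    define u where "u = diffop T U y"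
    have yK: "y \<in> kernel_solutions E T" using bij_betwE[OF bij[OF T]] Z by (simp add: y_def)
    then have ys: "y \<in> smooth_curves T m" using E by (simp add: kernel_solutions_def)
    have xs: "x \<in> smooth_curves T n" and us: "u \<in> smooth_curves T m"
      unfolding x_def u_def by (rule diffop_smooth[OF T ys X], rule diffop_smooth[OF T ys U])
    \<comment> \<open>The matrix equation for Z is translated back into the endpoint condition and
      transversality of y.\<close>
    have "endpoint_value M0 M1 T (diffop T X (output_curve T L Z)) = \<gamma>
         \<and> natural_transversality Q R M0 M1 X U T (output_curve T L Z)"
      using bc T Z Zbc unfolding boundary_form_def by blast
    then have ep: "endpoint_value M0 M1 T x = \<gamma>" and nt: "natural_transversality Q R M0 M1 X U T y"
      by (simp_all add: x_def y_def)
    note par = flat_parametrizationD(3)[OF flat A B T]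
    have flat_out: "\<exists>\<delta>\<in>smooth_curves T m. x1 = diffop T X \<delta> \<and> u1 = diffop T U \<delta>"
      if "(x1, u1) \<in> smooth_trajectories A B T" for x1 u1
    proof -
      have "(x1, u1) \<in> (\<lambda>y. (diffop T X y, diffop T U y)) ` smooth_curves T m"
        using that bij_betw_imp_surj_on[OF par] by simp
      then show ?thesis by blast
    qed
    have traj: "(x, u) \<in> smooth_trajectories A B T" using bij_betwE[OF par] ys by (simp add: x_def u_def)
    have xuL: "L2_trajectory A B T x u" by (rule smooth_trajectory_L2[OF A B T traj])
    note D = L2_trajectoryD[OF A B xuL]
    have dimM: "dim_row M0 = k" "dim_col X = m" using M0 X by auto
    have stationary: "integral {0..T} (\<lambda>t. dx t \<bullet> (Q *\<^sub>v x t) + du t \<bullet> (R *\<^sub>v u t)) = 0"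
      if dL: "L2_trajectory A B T dx du" and d0: "endpoint_value M0 M1 T dx = 0\<^sub>v k" for dx du
    proof (rule first_variation_L2[OF T A B M0 M1 _ _ _ _ _ dL d0])
      have sm: "smooth_fun T (\<lambda>t. (M *\<^sub>v z t) $ i)"
        if "M \<in> carrier_mat r r" "z \<in> smooth_curves T r" "i < r" for M z r i
        using smooth_curves_smooth[OF mult_mat_vec_smooth[OF T that(2,1)] that(3)]
        by (rule smooth_fun_cong[rotated]) simp
      show "smooth_fun T (\<lambda>t. (Q *\<^sub>v x t) $ i)" if "i < n" for i by (rule sm[OF Qc xs that])
      show "smooth_fun T (\<lambda>t. (R *\<^sub>v u t) $ i)" if "i < m" for i by (rule sm[OF Rc us that])
      fix x1 u1 assume "(x1, u1) \<in> smooth_trajectories A B T" and e1: "endpoint_value M0 M1 T x1 = 0\<^sub>v k"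
      then obtain \<delta> where \<delta>: "\<delta> \<in> smooth_curves T m" and x1: "x1 = diffop T X \<delta>" and u1: "u1 = diffop T U \<delta>"
        using flat_out by blast
      have "\<delta> \<in> admissible_variations M0 M1 X T"
        using \<delta> e1 by (simp add: admissible_variations_def dimM x1)
      then have "boundary_term Q R X U T y \<delta> = 0" using nt by (simp add: natural_transversality_def)
      then show "integral {0..T} (\<lambda>t. x1 t \<bullet> (Q *\<^sub>v x t) + u1 t \<bullet> (R *\<^sub>v u t)) = 0"
        using first_variation_smooth[OF T Qc Rc X U yK[unfolded E_def] \<delta>]
        by (simp add: x1 u1 x_def u_def integral_unique)
    qed (use mult_mat_vec_in_carrier[OF Qc] mult_mat_vec_in_carrier[OF Rc] in blast)+
    have feas: "feasible_pair A B M0 M1 \<gamma> T x u" using xuL ep by (simp add: feasible_pair_def)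
    \<comment> \<open>Stationarity removes the linear term of the expansion, so the excess cost of a
      competitor is exactly the cost of the difference.\<close>
    have comparison: "L2_trajectory A B T (\<lambda>t. x' t - x t) (\<lambda>t. u' t - u t)
        \<and> endpoint_value M0 M1 T (\<lambda>t. x' t - x t) = 0\<^sub>v k
        \<and> cost Q R T x' u' = cost Q R T x u + cost Q R T (\<lambda>t. x' t - x t) (\<lambda>t. u' t - u t)"
      if f': "feasible_pair A B M0 M1 \<gamma> T x' u'" for x' u'
    proof -
      have xuL': "L2_trajectory A B T x' u'" and ep': "endpoint_value M0 M1 T x' = \<gamma>"
        using f' by (auto simp: feasible_pair_def)
      note D' = L2_trajectoryD[OF A B xuL']
      let ?dx = "\<lambda>t. x' t - x t" and ?du = "\<lambda>t. u' t - u t"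
      have dL: "L2_trajectory A B T ?dx ?du" by (rule L2_trajectory_diff[OF A B xuL xuL'])
      have d0: "endpoint_value M0 M1 T ?dx = 0\<^sub>v k"
        using endpoint_value_diff[OF M0 M1, of x T x'] D(2) D'(2) E0 ET ep ep' \<gamma> by simp
      note dD = L2_trajectoryD[OF A B dL]
      have "cost Q R T x' u' = cost Q R T (\<lambda>t. x t + ?dx t) (\<lambda>t. u t + ?du t)"
      proof -
        have "x' t = x t + ?dx t" "u' t = u t + ?du t" if "t \<in> {0..T}" for t
          using D(2,3)[OF that] D'(2,3)[OF that] by (auto intro!: eq_vecI)
        then show ?thesis
          unfolding cost_def set_lebesgue_integral_def
          by (intro arg_cong[of _ _ "\<lambda>v. 1 / 2 * v"] Bochner_Integration.integral_cong refl)
            (auto simp: indicator_def)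
      qed
      also have "\<dots> = cost Q R T x u + cost Q R T ?dx ?du"
        using cost_add[OF Q R D(7,1) dD(7,1)] stationary[OF dL d0] by simp
      finally show ?thesis using dL d0 by blast
    qed
    have opt: "optimal_pair A B Q R M0 M1 \<gamma> T x u"
      unfolding optimal_pair_def
    proof (intro conjI feas allI impI)
      fix x' u' assume "feasible_pair A B M0 M1 \<gamma> T x' u'"
      from comparison[OF this] show "cost Q R T x u \<le> cost Q R T x' u'"
        using cost_nonneg[OF Q R L2_trajectoryD(7,1)[OF A B]] by force
    qed
    have unique: "(\<forall>t\<in>{0..T}. x' t = x t) \<and> (AE t in lebesgue. t \<in> {0..T} \<longrightarrow> u' t = u t)"
      if o': "optimal_pair A B Q R M0 M1 \<gamma> T x' u'" for x' u'
    proof -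
      let ?dx = "\<lambda>t. x' t - x t" and ?du = "\<lambda>t. u' t - u t"
      have f': "feasible_pair A B M0 M1 \<gamma> T x' u'" and le: "cost Q R T x' u' \<le> cost Q R T x u"
        using o' feas by (auto simp: optimal_pair_def)
      have dL: "L2_trajectory A B T ?dx ?du" and d0: "endpoint_value M0 M1 T ?dx = 0\<^sub>v k"
        and cst: "cost Q R T x' u' = cost Q R T x u + cost Q R T ?dx ?du"
        using comparison[OF f'] by auto
      note dD = L2_trajectoryD[OF A B dL]
      note D' = L2_trajectoryD[OF A B f'[unfolded feasible_pair_def, THEN conjunct1]]
      have "cost Q R T ?dx ?du = 0" using cst le cost_nonneg[OF Q R dD(7,1)] by simp
      from cost_zero_AE[OF Q R dD(7,1) this]
      have Q0: "AE t in lebesgue. t \<in> {0..T} \<longrightarrow> Q *\<^sub>v ?dx t = 0\<^sub>v n"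
        and R0: "AE t in lebesgue. t \<in> {0..T} \<longrightarrow> R *\<^sub>v ?du t = 0\<^sub>v m"
        by (eventually_elim, blast)+
      obtain x1 u1 where t1: "(x1, u1) \<in> smooth_trajectories A B T"
        and dx1: "\<And>t. t \<in> {0..T} \<Longrightarrow> ?dx t = x1 t" and du1: "AE t in lebesgue. t \<in> {0..T} \<longrightarrow> ?du t = u1 t"
        and Qx1: "\<And>t. t \<in> {0..T} \<Longrightarrow> Q *\<^sub>v x1 t = 0\<^sub>v n" and Ru1: "\<And>t. t \<in> {0..T} \<Longrightarrow> R *\<^sub>v u1 t = 0\<^sub>v m"
        using zero_cost_trajectory_smooth[OF T A B Q R inj dL Q0 R0] by blast
      obtain \<delta> where \<delta>: "\<delta> \<in> smooth_curves T m" and x1: "x1 = diffop T X \<delta>" and u1: "u1 = diffop T U \<delta>"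
        using flat_out[OF t1] by blast
      \<comment> \<open>E(D) \<delta> is built from Q x1 and R u1, which both vanish.\<close>
      have "diffop T E \<delta> t = 0\<^sub>v m" if t: "t \<in> {0..T}" for t
        unfolding E_def diffop_euler_lagrange[OF T Qc Rc X U \<delta> t] x1[symmetric] u1[symmetric]
        using diffop_zero_curve[OF T t, of "adjoint_pmat X" m n "\<lambda>t. Q *\<^sub>v x1 t"]
          diffop_zero_curve[OF T t, of "adjoint_pmat U" m m "\<lambda>t. R *\<^sub>v u1 t"] X U Qx1 Ru1
        by (simp add: adjoint_pmat_def)
      then have "\<delta> \<in> kernel_solutions E T" using \<delta> E by (simp add: kernel_solutions_def)
      then obtain Z' where Z': "Z' \<in> linear_ode_solutions \<A> T" and \<delta>Z: "\<delta> = output_curve T L Z'"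
        using bij_betw_imp_surj_on[OF bij[OF T]] by auto
      \<comment> \<open>\<open>boundary_form\<close> refers to the inhomogeneous data \<gamma> and
        \<eta>. So Z' is tested through Z + Z', which meets the same endpoint condition; subtracting
        the equation of Z afterwards gives the homogeneous one for Z'.\<close>
      define Y where "Y = (\<lambda>t\<in>{0..T}. Z t + 1 \<cdot>\<^sub>v Z' t)"
      have Y: "Y \<in> linear_ode_solutions \<A> T" unfolding Y_def by (rule linear_ode_solutions_lincomb[OF \<A> Z Z'])
      have Zc: "Z t \<in> carrier_vec N" "Z' t \<in> carrier_vec N" if "t \<in> {0..T}" for t
        using linear_ode_solutions_carrier[OF Z that] linear_ode_solutions_carrier[OF Z' that] \<A> by auto
      have LY: "output_curve T L Y = (\<lambda>t\<in>{0..T}. y t + 1 \<cdot>\<^sub>v \<delta> t)"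
      proof
        fix t
        show "output_curve T L Y t = (\<lambda>t\<in>{0..T}. y t + 1 \<cdot>\<^sub>v \<delta> t) t"
          using mult_add_distrib_mat_vec[OF L Zc(1) Zc(2), of t t]
          by (simp add: output_curve_def Y_def y_def \<delta>Z)
      qed
      have XY: "diffop T X (output_curve T L Y) t = x t + x1 t" if t: "t \<in> {0..T}" for t
        unfolding LY diffop_lincomb[OF T ys \<delta> X t] by (simp add: x_def x1)
      have UY: "diffop T U (output_curve T L Y) t = u t + u1 t" if t: "t \<in> {0..T}" for t
        unfolding LY diffop_lincomb[OF T ys \<delta> U t] by (simp add: u_def u1)
      have x1c: "x1 t \<in> carrier_vec n" and u1c: "u1 t \<in> carrier_vec m" if "t \<in> {0..T}" for t
        using that X U by (simp_all add: x1 u1 diffop_def)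
      have "x t + x1 t = x' t" if t: "t \<in> {0..T}" for t
        using dx1[OF t, symmetric] D(2)[OF t] D'(2)[OF t] by (auto intro!: eq_vecI)
      then have "endpoint_value M0 M1 T (diffop T X (output_curve T L Y)) = \<gamma>"
        using f' XY[OF E0] XY[OF ET] E0 ET by (simp add: endpoint_value_def feasible_pair_def)
      moreover have "natural_transversality Q R M0 M1 X U T (output_curve T L Y)"
        unfolding natural_transversality_def
      proof
        fix \<epsilon> assume \<epsilon>: "\<epsilon> \<in> admissible_variations M0 M1 X T"
        \<comment> \<open>The boundary term sees the extremal only through Qx and Ru, which adding
          x1 and u1 does not change.\<close>
        have "Q *\<^sub>v diffop T X (output_curve T L Y) t = Q *\<^sub>v diffop T X y t" if t: "t \<in> {0..T}" for t
          unfolding XY[OF t] mult_add_distrib_mat_vec[OF Qc D(2)[OF t] x1c[OF t]] Qx1[OF t]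
          using mult_mat_vec_in_carrier[OF Qc] by (simp add: x_def)
        moreover have "R *\<^sub>v diffop T U (output_curve T L Y) t = R *\<^sub>v diffop T U y t" if t: "t \<in> {0..T}" for t
          unfolding UY[OF t] mult_add_distrib_mat_vec[OF Rc D(3)[OF t] u1c[OF t]] Ru1[OF t]
          using mult_mat_vec_in_carrier[OF Rc] by (simp add: u_def)
        ultimately have "boundary_term Q R X U T (output_curve T L Y) \<epsilon> = boundary_term Q R X U T y \<epsilon>"
          unfolding boundary_term_def using T by (intro arg_cong2[of _ _ _ _ "(+)"] ibp_boundary_cong) auto
        then show "boundary_term Q R X U T (output_curve T L Y) \<epsilon> = 0"
          using nt \<epsilon> by (simp add: natural_transversality_def)
      qed
      ultimately have Ybc: "C0 *\<^sub>v Y 0 + C1 *\<^sub>v Y T = \<eta>"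
        using bc T Y unfolding boundary_form_def by blast
      have "C0 *\<^sub>v Z' 0 + C1 *\<^sub>v Z' T = 0\<^sub>v N"
      proof (rule eq_vecI)
        fix i assume "i < dim_vec (0\<^sub>v N :: real Matrix.vec)"
        then have i: "i < N" by simp
        have "C0 *\<^sub>v Y 0 = C0 *\<^sub>v Z 0 + C0 *\<^sub>v Z' 0" "C1 *\<^sub>v Y T = C1 *\<^sub>v Z T + C1 *\<^sub>v Z' T"
          using mult_add_distrib_mat_vec[OF C0 Zc[OF E0]] mult_add_distrib_mat_vec[OF C1 Zc[OF ET]] E0 ET
          by (simp_all add: Y_def)
        then have "\<eta> $ i = \<eta> $ i + (C0 *\<^sub>v Z' 0 + C1 *\<^sub>v Z' T) $ i"
          using arg_cong[OF Ybc, of "\<lambda>v. v $ i"] arg_cong[OF Zbc, of "\<lambda>v. v $ i"] C0 C1 i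
          by (simp del: index_mult_mat_vec)
        then show "(C0 *\<^sub>v Z' 0 + C1 *\<^sub>v Z' T) $ i = 0\<^sub>v N $ i" using i by simp
      qed (use C1 in auto)
      from uniq[OF T0T Z' this] have "\<delta> t = 0\<^sub>v m" if "t \<in> {0..T}" for t
        using that mult_mat_vec_zero[OF L] by (simp add: \<delta>Z output_curve_def)
      then have "x1 t = 0\<^sub>v n" "u1 t = 0\<^sub>v m" if "t \<in> {0..T}" for t
        using diffop_zero_curve[OF T that X, of \<delta>] diffop_zero_curve[OF T that U, of \<delta>] by (auto simp: x1 u1)
      note z = this
      have vec_eq: "v = w" if "v - w = 0\<^sub>v r" "v \<in> carrier_vec r" "w \<in> carrier_vec r" for v w :: "real Matrix.vec" and r
      proof (rule eq_vecI)
        fix i assume "i < dim_vec w"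
        then have i: "i < r" using that(3) by simp
        have "v $ i - w $ i = (v - w) $ i" using i that(3) by simp
        also have "\<dots> = 0" unfolding that(1) using i by simp
        finally show "v $ i = w $ i" by simp
      qed (use that in auto)
      have "x' t = x t" if t: "t \<in> {0..T}" for t
        using vec_eq[of "x' t" "x t" n] dx1[OF t] z(1)[OF t] D(2)[OF t] D'(2)[OF t] by simp
      moreover have "AE t in lebesgue. t \<in> {0..T} \<longrightarrow> u' t = u t"
        using du1
      proof eventually_elim
        case (elim t)
        then show ?case using vec_eq[of "u' t" "u t" m] z(2)[of t] D(3)[of t] D'(3)[of t] by simp
      qed
      ultimately show ?thesis by blast
    qed
    have w: "0 \<le> turnpike_weight \<mu> T t" for t by (simp add: turnpike_weight_def)
    have deriv_bound: "\<bar>nderiv {0..T} p (\<lambda>s. y s $ j) t\<bar> \<le> \<kappa> * K * turnpike_weight \<mu> T t"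
      if p: "p \<le> d" and j: "j < m" and t: "t \<in> {0..T}" for p j t
    proof -
      have LA: "L * \<A> ^\<^sub>m p \<in> carrier_mat m N" by (rule mult_carrier_mat[OF L pow_carrier_mat[OF \<A>]])
      have Zt: "Z t \<in> carrier_vec N" using linear_ode_solutions_carrier[OF Z t] \<A> by simp
      have "nderiv {0..T} p (\<lambda>s. y s $ j) t = (\<Sum>l<N. (L * \<A> ^\<^sub>m p) $$ (j,l) * Z t $ l)"
        unfolding y_def output_curve_nderiv[OF T \<A> L Z t j] by (rule mult_mat_vec_index_sum[OF LA Zt j])
      also have "\<bar>\<dots>\<bar> \<le> (\<Sum>l<N. \<bar>(L * \<A> ^\<^sub>m p) $$ (j,l)\<bar> * (K * turnpike_weight \<mu> T t))"
        using Zb[OF t] by (intro order.trans[OF sum_abs] sum_mono) (auto simp: abs_mult intro!: mult_left_mono)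
      also have "\<dots> = (\<Sum>l<N. \<bar>(L * \<A> ^\<^sub>m p) $$ (j,l)\<bar>) * (K * turnpike_weight \<mu> T t)"
        by (simp add: sum_distrib_right)
      also have "\<dots> \<le> \<kappa> * (K * turnpike_weight \<mu> T t)"
      proof (rule mult_right_mono)
        have "(\<Sum>l<N. \<bar>(L * \<A> ^\<^sub>m p) $$ (j,l)\<bar>) \<le> (\<Sum>j<m. \<Sum>l<N. \<bar>(L * \<A> ^\<^sub>m p) $$ (j,l)\<bar>)"
          using j by (intro member_le_sum[of j "{..<m}" "\<lambda>j. \<Sum>l<N. \<bar>(L * \<A> ^\<^sub>m p) $$ (j,l)\<bar>"]) (auto intro: sum_nonneg)
        also have "\<dots> \<le> \<kappa>"
          unfolding \<kappa>_def using p
          by (intro member_le_sum[of p "{..d}" "\<lambda>p. \<Sum>j<m. \<Sum>l<N. \<bar>(L * \<A> ^\<^sub>m p) $$ (j,l)\<bar>"]) (auto intro!: sum_nonneg)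
        finally show "(\<Sum>l<N. \<bar>(L * \<A> ^\<^sub>m p) $$ (j,l)\<bar>) \<le> \<kappa>" .
      qed (use K w in simp)
      finally show ?thesis by (simp add: mult.assoc)
    qed
    have bound_xu: "enorm (x t) + enorm (u t) \<le> C * turnpike_weight \<mu> T t" if t: "t \<in> {0..T}" for t
    proof -
      have "enorm (x t) \<le> cX * (\<kappa> * K * turnpike_weight \<mu> T t)"
        unfolding x_def cX_def by (intro diffop_enorm_bound[OF X t] deriv_bound t order.trans[OF _ degX])
      moreover have "enorm (u t) \<le> cU * (\<kappa> * K * turnpike_weight \<mu> T t)"
        unfolding u_def cU_def by (intro diffop_enorm_bound[OF U t] deriv_bound t order.trans[OF _ degU])
      moreover have "0 \<le> real m * (\<kappa> * K * turnpike_weight \<mu> T t)" using nn K w by simp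
      ultimately show ?thesis using w[of t] by (simp add: C_def algebra_simps)
    qed
    have bound_y: "enorm (curve_deriv T m p y t) \<le> C * turnpike_weight \<mu> T t"
      if p: "enters X p \<or> enters U p" and t: "t \<in> {0..T}" for p t
    proof -
      have "enorm (curve_deriv T m p y t) \<le> real m * (\<kappa> * K * turnpike_weight \<mu> T t)"
        by (rule curve_deriv_enorm_bound[OF t deriv_bound[OF enters_le[OF p] _ t]])
      moreover have "0 \<le> (cX + cU) * (\<kappa> * K * turnpike_weight \<mu> T t)" using nn K w by simp
      ultimately show ?thesis using w[of t] by (simp add: C_def algebra_simps)
    qed
    show "\<exists>x \<in> smooth_curves T n. \<exists>u \<in> smooth_curves T m. \<exists>y \<in> smooth_curves T m.
      optimal_pair A B Q R M0 M1 \<gamma> T x u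
    \<and> (\<forall>x' u'. optimal_pair A B Q R M0 M1 \<gamma> T x' u' \<longrightarrow>
         (\<forall>t\<in>{0..T}. x' t = x t) \<and> (AE t in lebesgue. t \<in> {0..T} \<longrightarrow> u' t = u t))
    \<and> x = diffop T X y \<and> u = diffop T U y
    \<and> (\<forall>t\<in>{0..T}. enorm (x t) + enorm (u t) \<le> C * turnpike_weight \<mu> T t)
    \<and> (\<forall>p. enters X p \<or> enters U p \<longrightarrow>
         (\<forall>t\<in>{0..T}. enorm (curve_deriv T m p y t) \<le> C * turnpike_weight \<mu> T t))"
      using xs us ys opt unique x_def u_def bound_xu bound_y by blast
  qed
qed

end
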